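(* Let $M$ be a smooth finite-dimensional manifold, $V$ a Banach space, $\mathbf y=(y,y^\dagger)\in CRP_{\mathbf X}(M)$, $\alpha\in\Omega^1(M,V)$ a smooth $V$-valued one-form on $M$, and $U$ a parallelism on $M$. Then $$\boldsymbol\alpha_s^{(y,U)}:=\left(\alpha|_{T_{y_s}M},\;\nabla^U_{y_s^\dagger(\cdot)}\alpha\right)\in CRP_y^U(M,V),$$ where the second component is the map $w\otimes v\mapsto\left(\nabla^U_{y_s^\dagger w}\alpha\right)(v)$, $w\in W$, $v\in T_{y_s}M$.
   Context: Rough paths. $W=\mathbb R^k$, $T>0$, $1\le p<3$, $\Delta_{[0,T]}=\{(s,t):0\le s\le t\le T\}$. A control is a continuous $\omega:\Delta_{[0,T]}\to[0,\infty)$ with $\omega(s,s)=0$ and $\omega(s,t)+\omega(t,u)\le\omega(s,u)$ for $s\le t\le u$. $\mathbf X=(x,\mathbb X)$ is a fixed weak-geometric $p$-rough path with control $\omega$: $x:[0,T]\to W$ and $\mathbb X:\Delta_{[0,T]}\to W\otimes W$ are continuous and, with $x_{s,t}:=x_t-x_s$, one has $\mathbb X_{s,u}=\mathbb X_{s,t}+\mathbb X_{t,u}+x_{s,t}\otimes x_{t,u}$ for $s\le t\le u$, $|x_{s,t}|\le\omega(s,t)^{1/p}$, $|\mathbb X_{s,t}|\le\omega(s,t)^{2/p}$, and the symmetric part of $\mathbb X_{s,t}$ equals $\frac12x_{s,t}\otimes x_{s,t}$. $F_{s,t}\approx_iG_{s,t}$ means: there are $C<\infty$, $\delta>0$ (with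 $\delta$ small enough that all expressions are defined) such that $|F_{s,t}-G_{s,t}|\le C\omega(s,t)^{i/p}$ for all $0\le s\le t\le T$ with $t-s\le\delta$; for values in spaces built from $T_{y_s}M$ the norm is the (operator) norm from any fixed Riemannian metric on $M$. Gauges. A diagonal domain is an open $\mathcal D\subseteq M\times M$ containing the diagonal. A logarithm is a smooth $\psi:\mathcal D\to TM$ with $\psi(m,n)\in T_mM$, $\psi(m,m)=0_m$, and differential of $\psi(m,\cdot)$ at $m$ equal to the identity of $T_mM$. A parallelism is a smooth map $(n,m)\in\mathcal D\mapsto U(n,m)\in L(T_mM,T_nM)$ with $U(m,m)=I$. A gauge is a pair $(\psi,U)$ of these with common domain $\mathcal D$. $CRP_{\mathbf X}(M)$: continuous pairs $(y,y^\dagger)$, $y:[0,T]\to M$, $y_s^\dagger\in L(W,T_{y_s}M)$, with $\psi(y_s,y_t)\approx_2y_s^\dagger x_{s,t}$ and $U(y_s,y_t)y_t^\dagger\approx_1y_s^\dagger$ for some (equivalently every) gauge $(\psi,U)$. $CRP_y^U(M,V)$: pairs $(\alpha,\alpha^\dagger)$ with $\alpha_s\in L(T_{y_s}M,V)$, $\alpha_s^\dagger\in L(W\otimes T_{y_s}M,V)$, $\alpha_t\circ U(y_t,y_s)-\alpha_s-\alpha_s^\dagger(x_{s,t}\otimes(\cdot))\approx_20$ and $\alpha_t^\dagger\circ(I\otimes U(y_t,y_s))-\alpha_s^\dagger\approx_10$. Covariant derivative $\nabla^U$: for a vector field $Y$ and $v\in T_mM$, $\nabla^U_vY:=\frac{d}{dt}\big|_0U(m,\sigma_t)Y(\sigma_t)$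 where $\sigma$ is a curve with $\dot\sigma_0=v$; on one-forms it is defined by the product rule $v[\alpha(Y)]=(\nabla^U_v\alpha)(Y(m))+\alpha_m(\nabla^U_vY)$. *)

theory Defs
  imports "HOL-Analysis.Analysis" "HOL-Library.Function_Algebras"
begin

text \<open>Tangent vectors are represented by functions, so functions into a real vector space
  get their pointwise vector space structure.\<close>

instantiation "fun" :: (type, real_vector) real_vector
begin

definition scaleR_fun :: "real \<Rightarrow> ('a \<Rightarrow> 'b) \<Rightarrow> 'a \<Rightarrow> 'b"
  where "scaleR_fun r f = (\<lambda>x. r *\<^sub>R f x)"

instance
  by standard (auto simp: scaleR_fun_def fun_eq_iff algebra_simps)

end

text \<open>\<open>linear\<close> of the library is about maps defined on a whole type; here only the values on the
  linear subspace \<open>S\<close> matter.\<close>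

definition linear_map_on :: "'a::real_vector set \<Rightarrow> ('a \<Rightarrow> 'b::real_vector) \<Rightarrow> bool"
  where "linear_map_on S f \<longleftrightarrow>
    (\<forall>v\<in>S. \<forall>w\<in>S. f (v + w) = f v + f w) \<and> (\<forall>r. \<forall>v\<in>S. f (r *\<^sub>R v) = r *\<^sub>R f v)"


section \<open>Smooth maps between normed spaces\<close>

text \<open>Meant for an open subset \<open>S\<close> of a finite-dimensional space, where continuity of all
  iterated directional derivatives of a map that is differentiable up to the previous order is the
  usual \<open>C\<^sup>n\<close> condition.\<close>

primrec Ck_on :: "nat \<Rightarrow> 'a::real_normed_vector set \<Rightarrow> ('a \<Rightarrow> 'b::real_normed_vector) \<Rightarrow> bool"
  where
    "Ck_on 0 S f \<longleftrightarrow> continuous_on S f"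
  | "Ck_on (Suc n) S f \<longleftrightarrow>
      (\<forall>x\<in>S. f differentiable (at x)) \<and>
      (\<forall>v. Ck_on n S (\<lambda>x. frechet_derivative f (at x) v))"

definition smooth_on :: "'a::real_normed_vector set \<Rightarrow> ('a \<Rightarrow> 'b::real_normed_vector) \<Rightarrow> bool"
  where "smooth_on S f \<longleftrightarrow> (\<forall>n. Ck_on n S f)"


section \<open>Smooth manifolds\<close>

text \<open>A chart is a pair of a domain and a coordinate map; the values of the coordinate map outside
  the domain are irrelevant. The model space \<open>'e\<close> is a finite-dimensional inner product space
  (class \<open>euclidean_space\<close> would rule out dimension \<open>0\<close>), and the atlas need not be maximal.\<close>

type_synonym ('m, 'e) chart = "'m set \<times> ('m \<Rightarrow> 'e)"
type_synonym ('m, 'e) atlas = "('m, 'e) chart set"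

definition chart_image :: "('m, 'e) chart \<Rightarrow> 'e set"
  where "chart_image c = snd c ` fst c"

definition chart_inv :: "('m, 'e) chart \<Rightarrow> 'e \<Rightarrow> 'm"
  where "chart_inv c = inv_into (fst c) (snd c)"

definition transition :: "('m, 'e) chart \<Rightarrow> ('m, 'e) chart \<Rightarrow> 'e \<Rightarrow> 'e"
  where "transition c d = (\<lambda>a. snd d (chart_inv c a))"

definition smooth_manifold ::
    "('m::{t2_space,second_countable_topology}, 'e::real_inner) atlas \<Rightarrow> bool"
  where "smooth_manifold A \<longleftrightarrow>
    (\<exists>B::'e set. finite B \<and> span B = UNIV) \<and>
    (\<forall>c\<in>A. open (fst c) \<and> open (chart_image c) \<and>
      (\<exists>h. homeomorphism (fst c) (chart_image c) (snd c) h)) \<and>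
    (\<Union>c\<in>A. fst c) = UNIV \<and>
    (\<forall>c\<in>A. \<forall>d\<in>A. smooth_on (snd c ` (fst c \<inter> fst d)) (transition c d))"


section \<open>Tangent spaces\<close>

text \<open>A tangent vector at \<open>m\<close> is the family of its coordinates in the charts around \<open>m\<close>
  (and \<open>0\<close> at the other indices); families are related by the derivatives of the chart
  transitions. For a chart \<open>c\<close> around \<open>m\<close>, \<open>\<lambda>v. v c\<close> is the linear isomorphism
  of the tangent space with \<open>'e\<close> induced by \<open>c\<close>, with inverse
  \<open>tangent_of_coord A c m\<close>.\<close>

type_synonym ('m, 'e) tangent = "('m, 'e) chart \<Rightarrow> 'e"

definition tangent_space :: "('m, 'e::real_normed_vector) atlas \<Rightarrow> 'm \<Rightarrow> ('m, 'e) tangent set"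
  where "tangent_space A m = {v.
    (\<forall>c. \<not> (c \<in> A \<and> m \<in> fst c) \<longrightarrow> v c = 0) \<and>
    (\<forall>c\<in>A. \<forall>d\<in>A. m \<in> fst c \<and> m \<in> fst d \<longrightarrow>
      v d = frechet_derivative (transition c d) (at (snd c m)) (v c))}"

definition tangent_of_coord ::
    "('m, 'e::real_normed_vector) atlas \<Rightarrow> ('m, 'e) chart \<Rightarrow> 'm \<Rightarrow> 'e \<Rightarrow> ('m, 'e) tangent"
  where "tangent_of_coord A c m e = (\<lambda>d.
    if d \<in> A \<and> m \<in> fst d then frechet_derivative (transition c d) (at (snd c m)) e else 0)"

text \<open>Smoothness of metrics, one-forms, logarithms, parallelisms and vector fields below is
  smoothness of their coordinate expressions in all charts of the atlas.\<close>

definition riemannian_metric ::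
    "('m, 'e::real_normed_vector) atlas
      \<Rightarrow> ('m \<Rightarrow> ('m, 'e) tangent \<Rightarrow> ('m, 'e) tangent \<Rightarrow> real) \<Rightarrow> bool"
  where "riemannian_metric A g \<longleftrightarrow>
    (\<forall>m. \<forall>v\<in>tangent_space A m. linear_map_on (tangent_space A m) (g m v)) \<and>
    (\<forall>m. \<forall>v\<in>tangent_space A m. \<forall>w\<in>tangent_space A m. g m v w = g m w v) \<and>
    (\<forall>m. \<forall>v\<in>tangent_space A m. v \<noteq> 0 \<longrightarrow> 0 < g m v v) \<and>
    (\<forall>c\<in>A. \<forall>e e'. smooth_on (chart_image c)
      (\<lambda>a. g (chart_inv c a) (tangent_of_coord A c (chart_inv c a) e)
                             (tangent_of_coord A c (chart_inv c a) e')))"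

definition tnorm ::
    "('m \<Rightarrow> ('m, 'e) tangent \<Rightarrow> ('m, 'e) tangent \<Rightarrow> real) \<Rightarrow> 'm \<Rightarrow> ('m, 'e) tangent \<Rightarrow> real"
  where "tnorm g m v = sqrt (g m v v)"

text \<open>Smooth one-forms with values in \<open>'v\<close>.\<close>

definition one_forms ::
    "('m, 'e::real_normed_vector) atlas \<Rightarrow> ('m \<Rightarrow> ('m, 'e) tangent \<Rightarrow> 'v::real_normed_vector) set"
  where "one_forms A = {\<alpha>.
    (\<forall>m. linear_map_on (tangent_space A m) (\<alpha> m)) \<and>
    (\<forall>c\<in>A. \<forall>e. smooth_on (chart_image c)
      (\<lambda>a. \<alpha> (chart_inv c a) (tangent_of_coord A c (chart_inv c a) e)))}"


section \<open>Gauges\<close>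

definition diagonal_domain :: "('m::topological_space \<times> 'm) set \<Rightarrow> bool"
  where "diagonal_domain D \<longleftrightarrow> open D \<and> (\<forall>m. (m, m) \<in> D)"

definition coord_domain ::
    "('m \<times> 'm) set \<Rightarrow> ('m, 'e) chart \<Rightarrow> ('m, 'e) chart \<Rightarrow> ('e \<times> 'e) set"
  where "coord_domain D c d =
    {(a, b). a \<in> chart_image c \<and> b \<in> chart_image d \<and> (chart_inv c a, chart_inv d b) \<in> D}"

text \<open>The last clause says that the differential of \<open>\<psi> m\<close> at \<open>m\<close> is the identity of the
  tangent space, read through a chart \<open>c\<close> on both sides.\<close>

definition logarithm ::
    "('m::topological_space, 'e::real_normed_vector) atlas \<Rightarrow> ('m \<times> 'm) set
      \<Rightarrow> ('m \<Rightarrow> 'm \<Rightarrow> ('m, 'e) tangent) \<Rightarrow> bool"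
  where "logarithm A D \<psi> \<longleftrightarrow> diagonal_domain D \<and>
    (\<forall>(m, n)\<in>D. \<psi> m n \<in> tangent_space A m) \<and>
    (\<forall>c\<in>A. \<forall>d\<in>A. smooth_on (coord_domain D c d)
      (\<lambda>(a, b). \<psi> (chart_inv c a) (chart_inv d b) c)) \<and>
    (\<forall>m. \<psi> m m = 0) \<and>
    (\<forall>c\<in>A. \<forall>m\<in>fst c. ((\<lambda>b. \<psi> m (chart_inv c b) c) has_derivative (\<lambda>e. e)) (at (snd c m)))"

text \<open>\<open>U n m\<close> maps the tangent space at \<open>m\<close> to the one at \<open>n\<close>.\<close>

definition parallelism ::
    "('m::topological_space, 'e::real_normed_vector) atlas \<Rightarrow> ('m \<times> 'm) set
      \<Rightarrow> ('m \<Rightarrow> 'm \<Rightarrow> ('m, 'e) tangent \<Rightarrow> ('m, 'e) tangent) \<Rightarrow> bool"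
  where "parallelism A D U \<longleftrightarrow> diagonal_domain D \<and>
    (\<forall>(n, m)\<in>D. linear_map_on (tangent_space A m) (U n m) \<and>
      U n m ` tangent_space A m \<subseteq> tangent_space A n) \<and>
    (\<forall>c\<in>A. \<forall>d\<in>A. \<forall>e. smooth_on (coord_domain D c d)
      (\<lambda>(a, b). U (chart_inv c a) (chart_inv d b) (tangent_of_coord A d (chart_inv d b) e) c)) \<and>
    (\<forall>m. \<forall>v\<in>tangent_space A m. U m m v = v)"

definition gauge_on ::
    "('m::topological_space, 'e::real_normed_vector) atlas \<Rightarrow> ('m \<times> 'm) set
      \<Rightarrow> ('m \<Rightarrow> 'm \<Rightarrow> ('m, 'e) tangent)
      \<Rightarrow> ('m \<Rightarrow> 'm \<Rightarrow> ('m, 'e) tangent \<Rightarrow> ('m, 'e) tangent) \<Rightarrow> bool"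
  where "gauge_on A D \<psi> U \<longleftrightarrow> logarithm A D \<psi> \<and> parallelism A D U"


section \<open>The covariant derivative of a parallelism\<close>

definition curve_with_velocity ::
    "('m::topological_space, 'e::real_normed_vector) atlas \<Rightarrow> 'm \<Rightarrow> ('m, 'e) tangent
      \<Rightarrow> (real \<Rightarrow> 'm) \<Rightarrow> bool"
  where "curve_with_velocity A m v \<sigma> \<longleftrightarrow> isCont \<sigma> 0 \<and> \<sigma> 0 = m \<and>
    (\<forall>c\<in>A. m \<in> fst c \<longrightarrow> ((\<lambda>t. snd c (\<sigma> t)) has_vector_derivative v c) (at 0))"

definition dir_deriv ::
    "('m::topological_space, 'e::real_normed_vector) atlas \<Rightarrow> 'm \<Rightarrow> ('m, 'e) tangent
      \<Rightarrow> ('m \<Rightarrow> 'b::real_normed_vector) \<Rightarrow> 'b"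
  where "dir_deriv A m v f = (THE z. \<forall>\<sigma>. curve_with_velocity A m v \<sigma> \<longrightarrow>
    ((\<lambda>t. f (\<sigma> t)) has_vector_derivative z) (at 0))"

definition vector_field_near ::
    "('m::topological_space, 'e::real_normed_vector) atlas \<Rightarrow> 'm \<Rightarrow> ('m \<Rightarrow> ('m, 'e) tangent) \<Rightarrow> bool"
  where "vector_field_near A m Y \<longleftrightarrow> (\<exists>N. open N \<and> m \<in> N \<and>
    (\<forall>n\<in>N. Y n \<in> tangent_space A n) \<and>
    (\<forall>c\<in>A. smooth_on (snd c ` (N \<inter> fst c)) (\<lambda>a. Y (chart_inv c a) c)))"

text \<open>The curve \<open>\<lambda>t. U m (\<sigma> t) (Y (\<sigma> t))\<close> lies in the fixed vector space
  \<open>tangent_space A m\<close> and is differentiated componentwise.\<close>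

definition cov_deriv ::
    "('m::topological_space, 'e::real_normed_vector) atlas
      \<Rightarrow> ('m \<Rightarrow> 'm \<Rightarrow> ('m, 'e) tangent \<Rightarrow> ('m, 'e) tangent)
      \<Rightarrow> 'm \<Rightarrow> ('m, 'e) tangent \<Rightarrow> ('m \<Rightarrow> ('m, 'e) tangent) \<Rightarrow> ('m, 'e) tangent"
  where "cov_deriv A U m v Y = (\<lambda>c.
    if c \<in> A \<and> m \<in> fst c then dir_deriv A m v (\<lambda>n. U m n (Y n) c) else 0)"

text \<open>The value at \<open>u\<close> of the covariant derivative of \<open>\<alpha>\<close>, as determined by the product
  rule for all vector fields extending \<open>u\<close>. The operator is local, so vector fields defined near
  \<open>m\<close> are used.\<close>

definition cov_deriv_form ::
    "('m::topological_space, 'e::real_normed_vector) atlas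
      \<Rightarrow> ('m \<Rightarrow> 'm \<Rightarrow> ('m, 'e) tangent \<Rightarrow> ('m, 'e) tangent)
      \<Rightarrow> ('m \<Rightarrow> ('m, 'e) tangent \<Rightarrow> 'v::real_normed_vector)
      \<Rightarrow> 'm \<Rightarrow> ('m, 'e) tangent \<Rightarrow> ('m, 'e) tangent \<Rightarrow> 'v"
  where "cov_deriv_form A U \<alpha> m v u = (THE z. \<forall>Y. vector_field_near A m Y \<and> Y m = u \<longrightarrow>
    dir_deriv A m v (\<lambda>n. \<alpha> n (Y n)) = z + \<alpha> m (cov_deriv A U m v Y))"


section \<open>Rough paths\<close>

definition simplex_on :: "real \<Rightarrow> (real \<times> real) set"
  where "simplex_on T = {(s, t). 0 \<le> s \<and> s \<le> t \<and> t \<le> T}"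

definition control :: "real \<Rightarrow> (real \<Rightarrow> real \<Rightarrow> real) \<Rightarrow> bool"
  where "control T \<omega> \<longleftrightarrow>
    continuous_on (simplex_on T) (\<lambda>(s, t). \<omega> s t) \<and>
    (\<forall>(s, t)\<in>simplex_on T. 0 \<le> \<omega> s t) \<and>
    (\<forall>s\<in>{0..T}. \<omega> s s = 0) \<and>
    (\<forall>s t u. 0 \<le> s \<and> s \<le> t \<and> t \<le> u \<and> u \<le> T \<longrightarrow> \<omega> s t + \<omega> t u \<le> \<omega> s u)"

text \<open>The tensor square of \<open>real^'k\<close> is the space of matrices, with the Frobenius norm.\<close>

definition tensor :: "real^'k \<Rightarrow> real^'k \<Rightarrow> real^'k^'k"
  where "tensor a b = (\<chi> i j. a $ i * b $ j)"

definition weak_geometric_rough_path ::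
    "real \<Rightarrow> real \<Rightarrow> (real \<Rightarrow> real \<Rightarrow> real) \<Rightarrow> (real \<Rightarrow> real^'k) \<Rightarrow> (real \<Rightarrow> real \<Rightarrow> real^'k^'k) \<Rightarrow> bool"
  where "weak_geometric_rough_path T p \<omega> x X \<longleftrightarrow>
    control T \<omega> \<and>
    continuous_on {0..T} x \<and>
    continuous_on (simplex_on T) (\<lambda>(s, t). X s t) \<and>
    (\<forall>s t u. 0 \<le> s \<and> s \<le> t \<and> t \<le> u \<and> u \<le> T \<longrightarrow>
      X s u = X s t + X t u + tensor (x t - x s) (x u - x t)) \<and>
    (\<forall>(s, t)\<in>simplex_on T.
      norm (x t - x s) \<le> \<omega> s t powr (1 / p) \<and>
      norm (X s t) \<le> \<omega> s t powr (2 / p) \<and>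
      (1 / 2) *\<^sub>R (X s t + transpose (X s t)) = (1 / 2) *\<^sub>R tensor (x t - x s) (x t - x s))"

text \<open>\<open>approx T \<omega> p i defd bnd\<close> stands for \<open>F \<approx>\<^sub>i G\<close>, where \<open>defd s t\<close> says
  that \<open>F s t\<close> and \<open>G s t\<close> are defined and \<open>bnd s t K\<close> says that the norm of
  \<open>F s t - G s t\<close> is at most \<open>K\<close>. For linear and bilinear maps, the bound on the operator
  norm is written out as a bound on all values.\<close>

definition approx ::
    "real \<Rightarrow> (real \<Rightarrow> real \<Rightarrow> real) \<Rightarrow> real \<Rightarrow> nat \<Rightarrow> (real \<Rightarrow> real \<Rightarrow> bool)
      \<Rightarrow> (real \<Rightarrow> real \<Rightarrow> real \<Rightarrow> bool) \<Rightarrow> bool"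
  where "approx T \<omega> p i defd bnd \<longleftrightarrow> (\<exists>C \<delta>. 0 < \<delta> \<and>
    (\<forall>s t. 0 \<le> s \<and> s \<le> t \<and> t \<le> T \<and> t - s \<le> \<delta> \<longrightarrow>
      defd s t \<and> bnd s t (C * \<omega> s t powr (real i / p))))"


section \<open>Controlled rough paths\<close>

text \<open>Only the values on \<open>{0..T}\<close> of the paths matter. Continuity of \<open>y\<dagger>\<close> as a path of
  linear maps into the tangent spaces along \<open>y\<close> is expressed in charts.\<close>

definition CRP ::
    "('m::topological_space, 'e::real_normed_vector) atlas
      \<Rightarrow> ('m \<Rightarrow> ('m, 'e) tangent \<Rightarrow> ('m, 'e) tangent \<Rightarrow> real)
      \<Rightarrow> real \<Rightarrow> real \<Rightarrow> (real \<Rightarrow> real \<Rightarrow> real) \<Rightarrow> (real \<Rightarrow> real^'k)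
      \<Rightarrow> ((real \<Rightarrow> 'm) \<times> (real \<Rightarrow> real^'k \<Rightarrow> ('m, 'e) tangent)) set"
  where "CRP A g T p \<omega> x = {(y, y').
    continuous_on {0..T} y \<and>
    (\<forall>s\<in>{0..T}. linear (y' s) \<and> range (y' s) \<subseteq> tangent_space A (y s)) \<and>
    (\<forall>c\<in>A. \<forall>w. continuous_on {s\<in>{0..T}. y s \<in> fst c} (\<lambda>s. y' s w c)) \<and>
    (\<exists>D \<psi> U. gauge_on A D \<psi> U \<and>
      approx T \<omega> p 2 (\<lambda>s t. (y s, y t) \<in> D)
        (\<lambda>s t K. tnorm g (y s) (\<psi> (y s) (y t) - y' s (x t - x s)) \<le> K) \<and>
      approx T \<omega> p 1 (\<lambda>s t. (y s, y t) \<in> D)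
        (\<lambda>s t K. \<forall>w. tnorm g (y s) (U (y s) (y t) (y' t w) - y' s w) \<le> K * norm w))}"

text \<open>A linear map on the tensor product of \<open>real^'k\<close> and \<open>tangent_space A (y s)\<close> is
  represented by the corresponding bilinear map \<open>\<alpha>' s\<close>.\<close>

definition CRP_form ::
    "('m::topological_space, 'e::real_normed_vector) atlas
      \<Rightarrow> ('m \<Rightarrow> ('m, 'e) tangent \<Rightarrow> ('m, 'e) tangent \<Rightarrow> real)
      \<Rightarrow> real \<Rightarrow> real \<Rightarrow> (real \<Rightarrow> real \<Rightarrow> real) \<Rightarrow> (real \<Rightarrow> real^'k) \<Rightarrow> (real \<Rightarrow> 'm)
      \<Rightarrow> ('m \<times> 'm) set \<Rightarrow> ('m \<Rightarrow> 'm \<Rightarrow> ('m, 'e) tangent \<Rightarrow> ('m, 'e) tangent)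
      \<Rightarrow> ((real \<Rightarrow> ('m, 'e) tangent \<Rightarrow> 'v::real_normed_vector)
          \<times> (real \<Rightarrow> real^'k \<Rightarrow> ('m, 'e) tangent \<Rightarrow> 'v)) set"
  where "CRP_form A g T p \<omega> x y D U = {(\<alpha>, \<alpha>').
    (\<forall>s\<in>{0..T}. linear_map_on (tangent_space A (y s)) (\<alpha> s) \<and>
      (\<forall>w. linear_map_on (tangent_space A (y s)) (\<alpha>' s w)) \<and>
      (\<forall>v\<in>tangent_space A (y s). linear (\<lambda>w. \<alpha>' s w v))) \<and>
    approx T \<omega> p 2 (\<lambda>s t. (y t, y s) \<in> D)
      (\<lambda>s t K. \<forall>v\<in>tangent_space A (y s).
        norm (\<alpha> t (U (y t) (y s) v) - \<alpha> s v - \<alpha>' s (x t - x s) v) \<le> K * tnorm g (y s) v) \<and>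
    approx T \<omega> p 1 (\<lambda>s t. (y t, y s) \<in> D)
      (\<lambda>s t K. \<forall>w. \<forall>v\<in>tangent_space A (y s).
        norm (\<alpha>' t w (U (y t) (y s) v) - \<alpha>' s w v) \<le> K * (norm w * tnorm g (y s) v))}"

end

theory Submission
  imports Defs
begin

text \<open>In a chart write \<open>a\<^sub>s\<close> for the coordinates of \<open>y\<^sub>s\<close> and consider the linear maps
  \<open>\<alpha>\<^sub>b \<circ> U(b, a)\<close>. Since \<open>U\<close> is the identity on the diagonal, the partial derivatives of \<open>U\<close>
  in its two arguments are opposite there, so the derivative of \<open>b \<mapsto> \<alpha>\<^sub>b \<circ> U(b, a)\<close> at
  \<open>b = a\<close> is exactly the covariant derivative of \<open>\<alpha>\<close>. The logarithm of the gauge agrees with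
  \<open>b - a\<close> up to a quadratic error; hence \<open>a\<^sub>t - a\<^sub>s = O(\<omega>^(1/p))\<close>, and this increment is the
  coordinate expression of \<open>y\<dagger>\<^sub>s x\<^sub>s\<^sub>,\<^sub>t\<close> up to \<open>O(\<omega>^(2/p))\<close>. A second order Taylor
  expansion gives the first estimate, and local Lipschitz continuity of the coefficients the second.
  All constants are local near a point of the path; compactness of \<open>[0,T]\<close> makes them uniform.\<close>

section \<open>Finite-dimensional inner product spaces\<close>

text \<open>\<open>CRP\<close> supplies its estimates through some gauge, unrelated to the
  parallelism \<open>U\<close> of the statement. Comparing two parallelisms is avoided: the gauge
  only serves to derive estimates for the chart coordinates of \<open>y\<close> and
  \<open>y'\<close>, and \<open>U\<close> enters afterwards. The metric norm measures the errors in
  the hypothesis and stands on the right in the conclusion, so the single inequality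
  \<open>norm (v c) \<le> K * tnorm g n v\<close> near a point passes between metric and chart in
  both places. Smoothness is formulated for one direction and one tangent argument at a time; bounds
  uniform in these are recovered by expansion in a finite orthonormal basis. Dimension 0 is allowed,
  so spheres and bases may be empty. Since \<open>dir_deriv\<close> and
  \<open>cov_deriv_form\<close> are definite descriptions, a chart formula for them requires
  existence and uniqueness of the described value: curves with given velocity and vector fields with
  given value must be exhibited.\<close>

text \<open>Unit vectors with this expansion property are automatically orthogonal.\<close>

definition orthonormal_basis :: "'a::real_inner set \<Rightarrow> bool"
  where "orthonormal_basis B \<longleftrightarrow>
    finite B \<and> (\<forall>b\<in>B. norm b = 1) \<and> (\<forall>v. (\<Sum>b\<in>B. (v \<bullet> b) *\<^sub>R b) = v)"

lemma orthonormal_basis_exists: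
  fixes B :: "'a::real_inner set"
  assumes "finite B" and "span B = UNIV"
  obtains C :: "'a set" where "orthonormal_basis C"
proof -
  obtain C where C: "finite C" "span C = (UNIV :: 'a set)" "pairwise orthogonal C"
    using basis_orthogonal[OF assms(1)] assms(2) by auto
  define N where "N = (\<lambda>x. x /\<^sub>R norm x) ` (C - {0})"
  have fin: "finite N" using C N_def by simp
  have nrm: "norm b = 1" if "b \<in> N" for b using that by (auto simp: N_def) (metis left_inverse norm_eq_zero)
  have orth: "b \<bullet> b' = (if b = b' then 1 else 0)" if "b \<in> N" "b' \<in> N" for b b'
  proof (cases "b = b'")
    case True
    then show ?thesis using nrm[OF that(1)] by (simp add: dot_square_norm)
  next
    case False
    obtain x x' where x: "x \<in> C" "b = x /\<^sub>R norm x" "x' \<in> C" "b' = x' /\<^sub>R norm x'"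
      using \<open>b \<in> N\<close> \<open>b' \<in> N\<close> by (auto simp: N_def)
    then have "x \<noteq> x'" using False by auto
    then have "orthogonal x x'" using C(3) x by (auto simp: pairwise_def)
    then show ?thesis using x False by (simp add: orthogonal_def)
  qed
  have "(\<Sum>b\<in>N. (v \<bullet> b) *\<^sub>R b) = v" for v
  proof -
    \<comment> \<open>\<open>w\<close> is orthogonal to \<open>N\<close>, hence to \<open>C\<close>
      and to the span of \<open>C\<close>; that span contains \<open>w\<close> itself, so
      \<open>w\<close> vanishes.\<close>
    define w where "w = v - (\<Sum>b\<in>N. (v \<bullet> b) *\<^sub>R b)"
    have wN: "w \<bullet> b = 0" if "b \<in> N" for b
    proof -
      have "(\<Sum>b'\<in>N. (v \<bullet> b') *\<^sub>R b') \<bullet> b = (\<Sum>b'\<in>N. if b' = b then v \<bullet> b' else 0)"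
        unfolding inner_sum_left by (rule sum.cong) (use orth that in auto)
      then show ?thesis using fin that by (simp add: w_def inner_diff_left)
    qed
    have "orthogonal w x" if "x \<in> C" for x
    proof (cases "x = 0")
      case False
      then have "w \<bullet> (x /\<^sub>R norm x) = 0" using that by (intro wN) (auto simp: N_def)
      then show ?thesis using False by (simp add: orthogonal_def)
    qed (simp add: orthogonal_def)
    then have "orthogonal w w" using C(2) orthogonal_to_span by blast
    then show ?thesis by (simp add: orthogonal_def w_def)
  qed
  then show thesis using that fin nrm unfolding orthonormal_basis_def by blast
qed

text \<open>Logarithms and parallelisms are functions of two points; their Taylor expansions live on
  the product of the model space with itself.\<close>

lemma orthonormal_basis_Times:
  fixes B :: "'a::real_inner set" and C :: "'b::real_inner set"
  assumes "orthonormal_basis B" and "orthonormal_basis C"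
  shows "orthonormal_basis ((\<lambda>b. (b, 0)) ` B \<union> (\<lambda>c. (0, c)) ` C)"
proof -
  have fin: "finite B" "finite C" and B1: "\<And>b. b \<in> B \<Longrightarrow> norm b = 1" and C1: "\<And>b. b \<in> C \<Longrightarrow> norm b = 1"
    and BC: "\<And>v. (\<Sum>b\<in>B. (v \<bullet> b) *\<^sub>R b) = v" "\<And>w. (\<Sum>b\<in>C. (w \<bullet> b) *\<^sub>R b) = w"
    using assms unfolding orthonormal_basis_def by auto
  have disj: "(\<lambda>b. (b, 0)) ` B \<inter> (\<lambda>c. (0, c)) ` C = {}"
    using B1 by force
  have inj: "inj_on (\<lambda>b. (b, 0::'b)) B" "inj_on (\<lambda>c. (0::'a, c)) C" by (auto intro: inj_onI)
  have "(\<Sum>b\<in>(\<lambda>b. (b, 0)) ` B \<union> (\<lambda>c. (0, c)) ` C. (v \<bullet> b) *\<^sub>R b) = v" for v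
    by (subst sum.union_disjoint)
       (use fin disj inj BC(1)[of "fst v"] BC(2)[of "snd v"] in
         \<open>auto simp: sum.reindex prod_eq_iff fst_sum snd_sum inner_prod_def\<close>)
  then show ?thesis using fin B1 C1 unfolding orthonormal_basis_def by auto
qed

lemma linear_basis_expansion:
  fixes B :: "'a::real_inner set" and f :: "'a \<Rightarrow> 'b::real_vector"
  assumes "orthonormal_basis B" and "linear f"
  shows "f v = (\<Sum>b\<in>B. (v \<bullet> b) *\<^sub>R f b)"
proof -
  have "f v = f (\<Sum>b\<in>B. (v \<bullet> b) *\<^sub>R b)" using assms(1) by (simp add: orthonormal_basis_def)
  then show ?thesis using assms(2) by (simp add: linear_sum linear_cmul)
qed

text \<open>Stands in for an operator norm: bounds at the finitely many basis vectors, which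
  smoothness in fixed directions provides, become bounds in all directions at the price of the
  factor \<open>card B\<close>.\<close>

lemma linear_bound_basis:
  fixes B :: "'a::real_inner set" and f :: "'a \<Rightarrow> 'b::real_normed_vector"
  assumes "orthonormal_basis B" and "linear f" and "\<And>b. b \<in> B \<Longrightarrow> norm (f b) \<le> C"
  shows "norm (f v) \<le> real (card B) * C * norm v"
proof -
  have "norm (f v) \<le> (\<Sum>b\<in>B. norm ((v \<bullet> b) *\<^sub>R f b))"
    using linear_basis_expansion[OF assms(1,2), of v] norm_sum by metis
  also have "\<dots> \<le> (\<Sum>b\<in>B. norm v * C)"
  proof (rule sum_mono)
    fix b assume b: "b \<in> B"
    have "\<bar>v \<bullet> b\<bar> \<le> norm v * norm b" by (rule Cauchy_Schwarz_ineq2)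
    then have "\<bar>v \<bullet> b\<bar> \<le> norm v" using b assms(1) by (simp add: orthonormal_basis_def)
    then show "norm ((v \<bullet> b) *\<^sub>R f b) \<le> norm v * C"
      using assms(3)[OF b] by (auto intro!: mult_mono)
  qed
  finally show ?thesis by (simp add: mult.commute mult.left_commute)
qed

lemma linear_imp_bounded_linear_basis:
  fixes B :: "'a::real_inner set" and f :: "'a \<Rightarrow> 'b::real_normed_vector"
  assumes "orthonormal_basis B" and "linear f"
  shows "bounded_linear f"
proof -
  have "norm (f b) \<le> (\<Sum>b\<in>B. norm (f b))" if "b \<in> B" for b
    using that assms(1) by (intro member_le_sum) (auto simp: orthonormal_basis_def)
  from linear_bound_basis[OF assms this] have "\<exists>K. \<forall>v. norm (f v) \<le> norm v * K"
    by (metis mult.commute)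
  then show ?thesis using assms(2)
    by (simp add: bounded_linear_def bounded_linear_axioms_def)
qed

text \<open>The library has compactness of spheres for \<open>euclidean_space\<close>, which excludes dimension \<open>0\<close>.\<close>

lemma compact_sphere_basis:
  assumes "orthonormal_basis (B :: 'a::real_inner set)"
  shows "compact {v :: 'a. norm v = 1}"
proof -
  \<comment> \<open>Combinations with coefficients in [-1, 1] form a finite sum of compact segments.
    The coefficients are functions bounded on the whole type, so that adding a vector to
    \<open>B'\<close> changes a single value of \<open>f\<close>.\<close>
  have "compact ((\<lambda>f. \<Sum>b\<in>B'. f b *\<^sub>R b) ` {f. \<forall>b::'a. \<bar>f b\<bar> \<le> (1::real)})" if "finite B'" for B' :: "'a set"
    using that
  proof (induction B')
    case empty
    have "(\<lambda>f. \<Sum>b\<in>{}. f b *\<^sub>R b) ` {f. \<forall>b::'a. \<bar>f b\<bar> \<le> (1::real)} = {0 :: 'a}"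
      by (auto intro!: image_eqI[where x = "\<lambda>_. 0"])
    then show ?case by simp
  next
    case (insert b B')
    have "compact ((\<lambda>r. r *\<^sub>R b) ` {-1..1::real})"
      by (intro compact_continuous_image continuous_intros) auto
    note c = compact_sums[OF this insert.IH]
    have "(\<lambda>f. \<Sum>b\<in>insert b B'. f b *\<^sub>R b) ` {f. \<forall>b::'a. \<bar>f b\<bar> \<le> (1::real)} =
      {x + y |x y. x \<in> (\<lambda>r. r *\<^sub>R b) ` {-1..1::real} \<and>
         y \<in> (\<lambda>f. \<Sum>b\<in>B'. f b *\<^sub>R b) ` {f. \<forall>b::'a. \<bar>f b\<bar> \<le> (1::real)}}" (is "?L = ?R")
    proof (intro equalityI subsetI)
      fix z assume "z \<in> ?L"
      then obtain f where f: "\<forall>b. \<bar>f b\<bar> \<le> (1::real)" "z = (\<Sum>b\<in>insert b B'. f b *\<^sub>R b)" by auto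
      then have "z = f b *\<^sub>R b + (\<Sum>b\<in>B'. f b *\<^sub>R b)" "f b \<in> {-1..1}"
        using insert by (auto simp: abs_le_iff minus_le_iff)
      then show "z \<in> ?R" using f(1) by blast
    next
      fix z assume "z \<in> ?R"
      then obtain r f where r: "r \<in> {-1..1::real}" and f: "\<forall>b. \<bar>f b\<bar> \<le> (1::real)"
        and z: "z = r *\<^sub>R b + (\<Sum>b\<in>B'. f b *\<^sub>R b)" by auto
      have "z = (\<Sum>c\<in>insert b B'. (f(b := r)) c *\<^sub>R c)"
        using z insert.hyps by (auto simp: intro!: sum.cong)
      moreover have "\<forall>c. \<bar>(f(b := r)) c\<bar> \<le> 1" using r f by auto
      ultimately show "z \<in> ?L" by blast
    qed
    then show ?case using c by simp
  qed
  then have c: "compact ((\<lambda>f. \<Sum>b\<in>B. f b *\<^sub>R b) ` {f. \<forall>b::'a. \<bar>f b\<bar> \<le> (1::real)})"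
    using assms by (simp add: orthonormal_basis_def)
  have cl: "closed {v :: 'a. norm v = 1}"
    by (intro closed_Collect_eq continuous_intros)
  have "v \<in> (\<lambda>f. \<Sum>b\<in>B. f b *\<^sub>R b) ` {f. \<forall>b::'a. \<bar>f b\<bar> \<le> (1::real)}" if "norm v = 1" for v
  proof
    let ?f = "\<lambda>b. if b \<in> B then v \<bullet> b else 0"
    show "v = (\<Sum>b\<in>B. ?f b *\<^sub>R b)"
      using assms by (simp add: orthonormal_basis_def)
    show "?f \<in> {f. \<forall>b::'a. \<bar>f b\<bar> \<le> (1::real)}"
      using assms that Cauchy_Schwarz_ineq2[of v] by (auto simp: orthonormal_basis_def) (metis mult_1)
  qed
  then have "(\<lambda>f. \<Sum>b\<in>B. f b *\<^sub>R b) ` {f. \<forall>b::'a. \<bar>f b\<bar> \<le> (1::real)} \<inter> {v. norm v = 1} = {v. norm v = 1}"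
    by blast
  then show ?thesis using compact_Int_closed[OF c cl] by simp
qed

text \<open>At \<open>a\<close> the unit sphere is compact and gives a positive minimum. Continuity
  in \<open>x\<close> holds only for fixed arguments of the form, so nearby points are reached
  through the finite matrix of its values on \<open>E\<close>; half of the minimum survives.\<close>

lemma posdef_lower_bound:
  fixes q :: "'a::real_normed_vector \<Rightarrow> 'e::real_inner \<Rightarrow> 'e \<Rightarrow> real"
  assumes E: "orthonormal_basis (E :: 'e set)" and S: "open S" "a \<in> S"
    and lin: "\<And>x e. x \<in> S \<Longrightarrow> linear (q x e)" "\<And>x e. x \<in> S \<Longrightarrow> linear (\<lambda>e'. q x e' e)"
    and cont: "\<And>e e'. continuous_on S (\<lambda>x. q x e e')"
    and pos: "\<And>e. e \<noteq> 0 \<Longrightarrow> 0 < q a e e"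
  shows "\<exists>\<epsilon>>0. \<exists>c>0. \<forall>x\<in>ball a \<epsilon>. x \<in> S \<and> (\<forall>e. c * (norm e)\<^sup>2 \<le> q x e e)"
proof -
  have exp: "q x e e' = (\<Sum>b\<in>E. \<Sum>b'\<in>E. (e \<bullet> b) * (e' \<bullet> b') * q x b b')" if "x \<in> S" for x e e'
  proof -
    have "q x e e' = (\<Sum>b\<in>E. (e \<bullet> b) * q x b e')"
      using linear_basis_expansion[OF E lin(2)[OF that], where v = e] by simp
    also have "\<dots> = (\<Sum>b\<in>E. (e \<bullet> b) * (\<Sum>b'\<in>E. (e' \<bullet> b') * q x b b'))"
      using linear_basis_expansion[OF E lin(1)[OF that], where v = e'] by simp
    finally show ?thesis by (simp add: sum_distrib_left mult.assoc)
  qed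
  have "\<exists>m>0. \<forall>e. norm e = 1 \<longrightarrow> m \<le> q a e e"
  \<comment> \<open>In dimension 0 the sphere is empty and has no minimiser; every positive
    \<open>m\<close> serves.\<close>
  proof (cases "{e :: 'e. norm e = 1} = {}")
    case True
    then show ?thesis by (intro exI[of _ 1]) auto
  next
    case False
    have "continuous_on {e. norm e = 1} (\<lambda>e. \<Sum>b\<in>E. \<Sum>b'\<in>E. (e \<bullet> b) * (e \<bullet> b') * q a b b')"
      by (intro continuous_intros)
    then have "continuous_on {e. norm e = 1} (\<lambda>e. q a e e)"
      by (rule continuous_on_eq) (rule exp[OF S(2), symmetric])
    then obtain e0 where e0: "norm e0 = 1" "\<And>e. norm e = 1 \<Longrightarrow> q a e0 e0 \<le> q a e e"
      using continuous_attains_inf[OF compact_sphere_basis[OF E] False] by blast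
    then have "0 < q a e0 e0" by (intro pos) auto
    then show ?thesis using e0 by blast
  qed
  then obtain m where m: "m > 0" "\<And>e. norm e = 1 \<Longrightarrow> m \<le> q a e e" by blast
  have qa: "m * (norm e)\<^sup>2 \<le> q a e e" for e
  proof (cases "e = 0")
    case True
    then show ?thesis using linear_0[OF lin(1)[OF S(2)]] by simp
  next
    case False
    have "q a (e /\<^sub>R norm e) (e /\<^sub>R norm e) = q a e e / (norm e)\<^sup>2"
      using linear_cmul[OF lin(1)[OF S(2)]] linear_cmul[OF lin(2)[OF S(2)]]
      by (simp add: power2_eq_square divide_simps)
    moreover have "m \<le> q a (e /\<^sub>R norm e) (e /\<^sub>R norm e)" using False by (intro m(2)) simp
    ultimately show ?thesis using False by (simp add: pos_le_divide_eq)
  qed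
  \<comment> \<open>The entrywise distance between the matrices at \<open>x\<close> and
    \<open>a\<close>; the quadratic forms differ by at most
    \<open>(norm e)\<^sup>2 * \<delta> x\<close>.\<close>
  define \<delta> where "\<delta> x = (\<Sum>b\<in>E. \<Sum>b'\<in>E. \<bar>q x b b' - q a b b'\<bar>)" for x
  have "continuous_on S \<delta>" unfolding \<delta>_def by (intro continuous_intros cont)
  then have "isCont \<delta> a" using S continuous_on_eq_continuous_at by blast
  then obtain d where d: "d > 0" "\<And>x. dist x a < d \<Longrightarrow> dist (\<delta> x) (\<delta> a) < m / 2"
    unfolding continuous_at_eps_delta using m(1) by (meson half_gt_zero)
  obtain d' where d': "d' > 0" "ball a d' \<subseteq> S" using S open_contains_ball by blast
  have "x \<in> S \<and> m / 2 * (norm e)\<^sup>2 \<le> q x e e" if "x \<in> ball a (min d d')" for x e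
  proof
    show x: "x \<in> S" using that d' by auto
    have "\<delta> a = 0" by (simp add: \<delta>_def)
    then have \<delta>: "\<delta> x < m / 2" using d(2)[of x] that by (simp add: dist_commute dist_real_def)
    have "\<bar>q x e e - q a e e\<bar> = \<bar>\<Sum>b\<in>E. \<Sum>b'\<in>E. (e \<bullet> b) * (e \<bullet> b') * (q x b b' - q a b b')\<bar>"
      unfolding exp[OF x, of e e] exp[OF S(2), of e e] by (simp add: sum_subtractf[symmetric] right_diff_distrib)
    also have "\<dots> \<le> (\<Sum>b\<in>E. \<Sum>b'\<in>E. (norm e)\<^sup>2 * \<bar>q x b b' - q a b b'\<bar>)"
    proof (intro order.trans[OF sum_abs] sum_mono)
      fix b b' assume "b \<in> E" "b' \<in> E"
      then have "\<bar>e \<bullet> b\<bar> \<le> norm e" "\<bar>e \<bullet> b'\<bar> \<le> norm e"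
        using Cauchy_Schwarz_ineq2[of e b] Cauchy_Schwarz_ineq2[of e b'] E
        by (auto simp: orthonormal_basis_def)
      then have "\<bar>e \<bullet> b\<bar> * \<bar>e \<bullet> b'\<bar> \<le> norm e * norm e" by (intro mult_mono) auto
      then show "\<bar>(e \<bullet> b) * (e \<bullet> b') * (q x b b' - q a b b')\<bar> \<le> (norm e)\<^sup>2 * \<bar>q x b b' - q a b b'\<bar>"
        unfolding abs_mult power2_eq_square by (rule mult_right_mono) simp
    qed
    also have "\<dots> = (norm e)\<^sup>2 * \<delta> x" by (simp add: \<delta>_def sum_distrib_left)
    also have "\<dots> \<le> (norm e)\<^sup>2 * (m / 2)" using \<delta> by (intro mult_left_mono) auto
    finally show "m / 2 * (norm e)\<^sup>2 \<le> q x e e" using qa[of e] by (auto simp: abs_if algebra_simps split: if_splits)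
  qed
  then show ?thesis using m(1) d(1) d'(1)
    by (intro exI[of _ "min d d'"] conjI exI[of _ "m / 2"]) auto
qed

section \<open>Maps of class C^k\<close>

text \<open>Since \<open>S\<close> is open, equality on \<open>S\<close> is equality near each of
  its points, so the derivatives agree as well and the induction can go on.\<close>

lemma Ck_on_cong:
  assumes "open S" and "\<And>x. x \<in> S \<Longrightarrow> f x = g x" and "Ck_on n S f"
  shows "Ck_on n S g"
  using assms(2,3)
proof (induction n arbitrary: f g)
  case 0
  then show ?case using continuous_on_cong by force
next
  case (Suc n)
  have der: "(g has_derivative frechet_derivative f (at x)) (at x)" if "x \<in> S" for x
  proof (rule has_derivative_transform_within_open[OF _ assms(1) that Suc.prems(1)])
    show "(f has_derivative frechet_derivative f (at x)) (at x)"
      using Suc.prems(2) that frechet_derivative_works by auto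
  qed
  have "Ck_on n S (\<lambda>x. frechet_derivative g (at x) v)" for v
  proof (rule Suc.IH)
    show "frechet_derivative f (at x) v = frechet_derivative g (at x) v" if "x \<in> S" for x
      using frechet_derivative_at[OF der[OF that]] by simp
    show "Ck_on n S (\<lambda>x. frechet_derivative f (at x) v)" using Suc.prems(2) by simp
  qed
  then show ?case using der by (auto simp: differentiable_def)
qed

lemma Ck_on_SucD: "Ck_on (Suc n) S f \<Longrightarrow> Ck_on n S f"
proof (induction n arbitrary: f)
  case 0
  then show ?case
    by (auto intro!: continuous_at_imp_continuous_on differentiable_imp_continuous_within)
next
  case (Suc n)
  then show ?case by (metis Ck_on.simps(2))
qed

lemma Ck_on_has_derivative:
  "Ck_on (Suc n) S f \<Longrightarrow> x \<in> S \<Longrightarrow> (f has_derivative frechet_derivative f (at x)) (at x)"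
  using frechet_derivative_works by auto

text \<open>\<open>Ck_on\<close> speaks of \<open>frechet_derivative\<close>; uniqueness of the
  derivative allows any explicit \<open>f'\<close> in its place.\<close>

lemma Ck_on_SucI:
  assumes "open S" and "\<And>x. x \<in> S \<Longrightarrow> (f has_derivative f' x) (at x)"
    and "\<And>v. Ck_on n S (\<lambda>x. f' x v)"
  shows "Ck_on (Suc n) S f"
proof -
  have "frechet_derivative f (at x) = f' x" if "x \<in> S" for x
    using frechet_derivative_at[OF assms(2)[OF that]] by simp
  then have "Ck_on n S (\<lambda>x. frechet_derivative f (at x) v)" for v
    by (intro Ck_on_cong[OF assms(1) _ assms(3)[of v]]) simp
  then show ?thesis using assms(2) by (auto simp: differentiable_def)
qed

lemma Ck_on_const: "open S \<Longrightarrow> Ck_on n S (\<lambda>x. c)"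
proof (induction n arbitrary: c)
  case (Suc n)
  then show ?case by (intro Ck_on_SucI[where f' = "\<lambda>_ _. 0"]) auto
qed simp

lemma Ck_on_add:
  "open S \<Longrightarrow> Ck_on n S f \<Longrightarrow> Ck_on n S g \<Longrightarrow> Ck_on n S (\<lambda>x. f x + g x)"
proof (induction n arbitrary: f g)
  case (Suc n)
  show ?case
  proof (rule Ck_on_SucI[OF Suc.prems(1)])
    fix x assume "x \<in> S"
    then show "((\<lambda>x. f x + g x) has_derivative
       (\<lambda>v. frechet_derivative f (at x) v + frechet_derivative g (at x) v)) (at x)"
      using Suc.prems Ck_on_has_derivative by (intro has_derivative_add) auto
  qed (use Suc in simp)
qed (simp add: continuous_on_add)

lemma Ck_on_sum:
  assumes "open S" and "\<And>i. i \<in> I \<Longrightarrow> Ck_on n S (f i)"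
  shows "Ck_on n S (\<lambda>x. \<Sum>i\<in>I. f i x)"
  using assms(2)
  by (induction I rule: infinite_finite_induct) (auto intro: Ck_on_const Ck_on_add assms(1))

lemma Ck_on_bounded_linear:
  assumes "bounded_linear L"
  shows "open S \<Longrightarrow> Ck_on n S f \<Longrightarrow> Ck_on n S (\<lambda>x. L (f x))"
proof (induction n arbitrary: f)
  case 0
  then show ?case using bounded_linear.continuous_on[OF assms] by simp
next
  case (Suc n)
  show ?case
  proof (rule Ck_on_SucI[OF Suc.prems(1)])
    fix x assume "x \<in> S"
    then show "((\<lambda>x. L (f x)) has_derivative (\<lambda>v. L (frechet_derivative f (at x) v))) (at x)"
      using Suc.prems Ck_on_has_derivative by (intro bounded_linear.has_derivative[OF assms]) auto
  qed (use Suc in simp)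
qed

lemma Ck_on_scaleR:
  "open S \<Longrightarrow> Ck_on n S f \<Longrightarrow> Ck_on n S g \<Longrightarrow> Ck_on n S (\<lambda>x. f x *\<^sub>R g x)"
proof (induction n arbitrary: f g)
  case (Suc n)
  show ?case
  proof (rule Ck_on_SucI[OF Suc.prems(1)])
    fix x assume x: "x \<in> S"
    show "((\<lambda>x. f x *\<^sub>R g x) has_derivative
       (\<lambda>v. f x *\<^sub>R frechet_derivative g (at x) v + frechet_derivative f (at x) v *\<^sub>R g x)) (at x)"
      using has_derivative_scaleR[OF Ck_on_has_derivative[OF Suc.prems(2) x]
        Ck_on_has_derivative[OF Suc.prems(3) x]] .
  next
    \<comment> \<open>The product rule keeps one factor undifferentiated, so \<open>f\<close> and
      \<open>g\<close> themselves are needed in class \<open>n\<close>.\<close>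
    have "Ck_on n S f" "Ck_on n S g" using Suc.prems Ck_on_SucD by blast+
    then show "Ck_on n S (\<lambda>x. f x *\<^sub>R frechet_derivative g (at x) v + frechet_derivative f (at x) v *\<^sub>R g x)" for v
      using Suc by (intro Ck_on_add) auto
  qed
qed (simp add: continuous_on_scaleR)

text \<open>By the chain rule the derivative of \<open>g\<close> is taken in the direction
  \<open>?f' x v\<close>, which moves with \<open>x\<close>, while the induction hypothesis covers
  fixed directions. Expanding this direction in \<open>B\<close> leaves sums of products that it
  does cover.\<close>

lemma Ck_on_compose:
  fixes f :: "'a::real_normed_vector \<Rightarrow> 'b::real_inner"
  assumes "orthonormal_basis (B :: 'b set)" and "open S" and "open R"
  shows "Ck_on n S f \<Longrightarrow> f ` S \<subseteq> R \<Longrightarrow> Ck_on n R g \<Longrightarrow> Ck_on n S (\<lambda>x. g (f x))"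
proof (induction n arbitrary: g)
  case 0
  then show ?case by (auto intro: continuous_on_compose2)
next
  case (Suc n)
  let ?f' = "\<lambda>x. frechet_derivative f (at x)" and ?g' = "\<lambda>x. frechet_derivative g (at x)"
  have g': "(g has_derivative ?g' (f x)) (at (f x))" if "x \<in> S" for x
    using Suc.prems that Ck_on_has_derivative by blast
  show ?case
  proof (rule Ck_on_SucI[OF assms(2)])
    fix x assume x: "x \<in> S"
    have "((\<lambda>x. g (f x)) has_derivative (\<lambda>v. ?g' (f x) (?f' x v))) (at x)"
      using has_derivative_compose[OF Ck_on_has_derivative[OF Suc.prems(1) x] g'[OF x]] .
    moreover have "(\<lambda>v. ?g' (f x) (?f' x v)) = (\<lambda>v. \<Sum>b\<in>B. (?f' x v \<bullet> b) *\<^sub>R ?g' (f x) b)"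
      by (rule ext) (rule linear_basis_expansion[OF assms(1) has_derivative_linear[OF g'[OF x]]])
    ultimately show "((\<lambda>x. g (f x)) has_derivative (\<lambda>v. \<Sum>b\<in>B. (?f' x v \<bullet> b) *\<^sub>R ?g' (f x) b)) (at x)"
      by (simp only:)
  next
    fix v
    have f: "Ck_on n S f" using Suc.prems Ck_on_SucD by blast
    show "Ck_on n S (\<lambda>x. \<Sum>b\<in>B. (?f' x v \<bullet> b) *\<^sub>R ?g' (f x) b)"
    proof (intro Ck_on_sum Ck_on_scaleR assms(2))
      fix b
      show "Ck_on n S (\<lambda>x. ?f' x v \<bullet> b)"
        using Suc.prems by (intro Ck_on_bounded_linear[OF bounded_linear_inner_left assms(2)]) auto
      show "Ck_on n S (\<lambda>x. ?g' (f x) b)"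
        using Suc.prems by (intro Suc.IH f) auto
    qed
  qed
qed

section \<open>Local estimates for smooth maps\<close>

text \<open>Merges the constants found for finitely many basis vectors: smallest radius, largest
  constant. The third assumption says that \<open>Q\<close> survives both changes.\<close>

lemma finite_ball_bound:
  assumes "finite I"
    and "\<And>i. i \<in> I \<Longrightarrow> \<exists>\<epsilon>>0. \<exists>C\<ge>0::real. Q i (\<epsilon>::real) C"
    and "\<And>i \<epsilon> C \<epsilon>' C'. i \<in> I \<Longrightarrow> Q i \<epsilon> C \<Longrightarrow> \<epsilon>' \<le> \<epsilon> \<Longrightarrow> C \<le> C' \<Longrightarrow> Q i \<epsilon>' C'"
  shows "\<exists>\<epsilon>>0. \<exists>C\<ge>0. \<forall>i\<in>I. Q i \<epsilon> C"
  using assms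
proof (induction I)
  case empty
  then show ?case by (intro exI[of _ 1]) auto
next
  case (insert i I)
  obtain \<epsilon> C where 1: "\<epsilon> > 0" "C \<ge> 0" "\<forall>i\<in>I. Q i \<epsilon> C" using insert.IH insert.prems by (metis insertCI)
  obtain \<epsilon>' C' where 2: "\<epsilon>' > 0" "C' \<ge> 0" "Q i \<epsilon>' C'" using insert.prems by blast
  have "\<forall>j\<in>insert i I. Q j (min \<epsilon> \<epsilon>') (max C C')"
  proof
    fix j assume j: "j \<in> insert i I"
    show "Q j (min \<epsilon> \<epsilon>') (max C C')"
    proof (cases "j = i")
      case True
      then show ?thesis using insert.prems(2)[OF j, of \<epsilon>' C' "min \<epsilon> \<epsilon>'" "max C C'"] 2(3) by simp
    next
      case False
      then show ?thesis using insert.prems(2)[OF j, of \<epsilon> C "min \<epsilon> \<epsilon>'" "max C C'"] 1(3) j by simp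
    qed
  qed
  then show ?case using 1 2 by (intro exI[of _ "min \<epsilon> \<epsilon>'"] conjI exI[of _ "max C C'"]) auto
qed

lemma locally_bounded:
  assumes "continuous_on S f" and "open S" and "a \<in> S"
  shows "\<exists>\<epsilon>>0. \<exists>C\<ge>0. \<forall>x\<in>ball a \<epsilon>. x \<in> S \<and> norm (f x) \<le> C"
proof -
  have "isCont f a" using assms continuous_on_eq_continuous_at by blast
  then obtain d where d: "d > 0" "\<And>x. dist a x < d \<Longrightarrow> dist (f x) (f a) < 1"
    unfolding continuous_at_eps_delta by (metis dist_commute zero_less_one)
  obtain e where e: "e > 0" "ball a e \<subseteq> S" using assms open_contains_ball by blast
  have "norm (f x) \<le> norm (f a) + 1" if "dist a x < d" for x
    using d(2)[OF that] norm_triangle_ineq2[of "f x" "f a"] by (simp add: dist_norm)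
  then show ?thesis using d(1) e
    by (intro exI[of _ "min d e"] conjI exI[of _ "norm (f a) + 1"]) auto
qed

text \<open>The derivative in each basis direction is continuous, hence locally bounded; linearity
  bounds the whole derivative, and the mean value inequality on the convex ball makes the bound a
  Lipschitz constant.\<close>

lemma C1_locally_lipschitz:
  fixes f :: "'a::real_inner \<Rightarrow> 'b::real_normed_vector"
  assumes B: "orthonormal_basis (B :: 'a set)" and S: "open S" "a \<in> S" and f: "Ck_on 1 S f"
  shows "\<exists>\<epsilon>>0. \<exists>C\<ge>0. \<forall>x\<in>ball a \<epsilon>. \<forall>y\<in>ball a \<epsilon>. x \<in> S \<and>
    norm (f x) \<le> C \<and> (\<forall>h. norm (frechet_derivative f (at x) h) \<le> C * norm h) \<and>
    norm (f y - f x) \<le> C * norm (y - x)"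
proof -
  let ?f' = "\<lambda>x. frechet_derivative f (at x)"
  have "\<exists>\<epsilon>>0. \<exists>C\<ge>0. \<forall>b\<in>B. \<forall>x\<in>ball a \<epsilon>. x \<in> S \<and> norm (?f' x b) \<le> C"
  proof (rule finite_ball_bound)
    show "finite B" using B by (simp add: orthonormal_basis_def)
    show "\<exists>\<epsilon>>0. \<exists>C\<ge>0. \<forall>x\<in>ball a \<epsilon>. x \<in> S \<and> norm (?f' x b) \<le> C" for b
      using locally_bounded[OF _ S, of "\<lambda>x. ?f' x b"] f by simp
  next
    fix i \<epsilon> C \<epsilon>' C'
    assume *: "\<forall>x\<in>ball a \<epsilon>. x \<in> S \<and> norm (?f' x i) \<le> C" "\<epsilon>' \<le> \<epsilon>" "C \<le> C'"
    show "\<forall>x\<in>ball a \<epsilon>'. x \<in> S \<and> norm (?f' x i) \<le> C'"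
    proof
      fix x assume "x \<in> ball a \<epsilon>'"
      then have "x \<in> S \<and> norm (?f' x i) \<le> C" using * by auto
      then show "x \<in> S \<and> norm (?f' x i) \<le> C'" using *(3) by linarith
    qed
  qed
  then obtain \<epsilon> C where \<epsilon>: "\<epsilon> > 0" "C \<ge> 0" "\<And>b x. b \<in> B \<Longrightarrow> x \<in> ball a \<epsilon> \<Longrightarrow> norm (?f' x b) \<le> C"
    by blast
  have "continuous_on S f" using f Ck_on_SucD[of 0 S f] by (simp add: One_nat_def)
  then obtain \<epsilon>' C' where \<epsilon>': "\<epsilon>' > 0" "C' \<ge> 0" "\<And>x. x \<in> ball a \<epsilon>' \<Longrightarrow> x \<in> S \<and> norm (f x) \<le> C'"
    using locally_bounded[OF _ S, of f] by blast
  define e K where "e = min \<epsilon> \<epsilon>'" and "K = max C' (real (card B) * C)"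
  have der: "(f has_derivative ?f' x) (at x)" if "x \<in> ball a e" for x
    using Ck_on_has_derivative[of 0 S f] f that \<epsilon>'(3) by (simp add: e_def One_nat_def)
  have bd: "norm (?f' x h) \<le> K * norm h" if "x \<in> ball a e" for x h
  proof -
    have "norm (?f' x h) \<le> real (card B) * C * norm h"
      using that by (intro linear_bound_basis[OF B has_derivative_linear[OF der[OF that]]] \<epsilon>(3)) (auto simp: e_def)
    also have "\<dots> \<le> K * norm h" by (intro mult_right_mono) (auto simp: K_def)
    finally show ?thesis .
  qed
  have "norm (f y - f x) \<le> K * norm (y - x)" if "x \<in> ball a e" "y \<in> ball a e" for x y
  proof (rule differentiable_bound[OF convex_ball _ _ that(2) that(1)])
    show "(f has_derivative ?f' x) (at x within ball a e)" if "x \<in> ball a e" for x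
      using der[OF that] has_derivative_at_withinI by blast
    show "onorm (?f' x) \<le> K" if "x \<in> ball a e" for x
      using bd[OF that] by (rule onorm_bound[rotated]) (simp add: K_def \<epsilon>'(2) le_max_iff_disj)
  qed
  moreover have "x \<in> S" "norm (f x) \<le> K" if "x \<in> ball a e" for x
    using \<epsilon>'(3)[of x] that by (auto simp: e_def K_def)
  ultimately show ?thesis using bd \<epsilon>(1) \<epsilon>'(1,2)
    by (intro exI[of _ e] conjI exI[of _ K]) (auto simp: e_def K_def)
qed

text \<open>\<open>C1_locally_lipschitz\<close> is applied to the directional derivatives; a
  Lipschitz derivative then gives the quadratic Taylor remainder.\<close>

lemma C2_local_estimates:
  fixes f :: "'a::real_inner \<Rightarrow> 'b::real_normed_vector"
  assumes B: "orthonormal_basis (B :: 'a set)" and S: "open S" "a \<in> S" and f: "Ck_on 2 S f"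
  shows "\<exists>\<epsilon>>0. \<exists>C\<ge>0. \<forall>x\<in>ball a \<epsilon>. \<forall>y\<in>ball a \<epsilon>. x \<in> S \<and>
    norm (f x) \<le> C \<and> norm (f y - f x) \<le> C * norm (y - x) \<and>
    (\<forall>h. norm (frechet_derivative f (at x) h) \<le> C * norm h) \<and>
    (\<forall>h. norm (frechet_derivative f (at y) h - frechet_derivative f (at x) h) \<le> C * norm (y - x) * norm h) \<and>
    norm (f y - f x - frechet_derivative f (at x) (y - x)) \<le> C * (norm (y - x))\<^sup>2"
proof -
  let ?f' = "\<lambda>x. frechet_derivative f (at x)"
  have f2: "Ck_on 1 S (\<lambda>x. ?f' x b)" for b using f by (simp add: numeral_2_eq_2 One_nat_def)
  have f1: "Ck_on 1 S f" using f Ck_on_SucD by (metis Suc_1)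
  have "\<exists>\<epsilon>>0. \<exists>C\<ge>0. \<forall>b\<in>B. \<forall>x\<in>ball a \<epsilon>. \<forall>y\<in>ball a \<epsilon>. norm (?f' y b - ?f' x b) \<le> C * norm (y - x)"
  proof (rule finite_ball_bound)
    show "finite B" using B by (simp add: orthonormal_basis_def)
    show "\<exists>\<epsilon>>0. \<exists>C\<ge>0. \<forall>x\<in>ball a \<epsilon>. \<forall>y\<in>ball a \<epsilon>. norm (?f' y b - ?f' x b) \<le> C * norm (y - x)" for b
      using C1_locally_lipschitz[OF B S f2[of b]] by blast
  next
    fix i \<epsilon> C \<epsilon>' C'
    assume *: "\<forall>x\<in>ball a \<epsilon>. \<forall>y\<in>ball a \<epsilon>. norm (?f' y i - ?f' x i) \<le> C * norm (y - x)"
      "\<epsilon>' \<le> \<epsilon>" "C \<le> C'"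
    show "\<forall>x\<in>ball a \<epsilon>'. \<forall>y\<in>ball a \<epsilon>'. norm (?f' y i - ?f' x i) \<le> C' * norm (y - x)"
    proof (intro ballI)
      fix x y assume "x \<in> ball a \<epsilon>'" "y \<in> ball a \<epsilon>'"
      then have "norm (?f' y i - ?f' x i) \<le> C * norm (y - x)" using * by auto
      also have "\<dots> \<le> C' * norm (y - x)" using * by (intro mult_right_mono) auto
      finally show "norm (?f' y i - ?f' x i) \<le> C' * norm (y - x)" .
    qed
  qed
  then obtain \<epsilon> C where \<epsilon>: "\<epsilon> > 0" "C \<ge> 0"
    "\<And>b x y. b \<in> B \<Longrightarrow> x \<in> ball a \<epsilon> \<Longrightarrow> y \<in> ball a \<epsilon> \<Longrightarrow> norm (?f' y b - ?f' x b) \<le> C * norm (y - x)"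
    by blast
  obtain \<epsilon>' C' where \<epsilon>': "\<epsilon>' > 0" "C' \<ge> 0" "\<And>x y. x \<in> ball a \<epsilon>' \<Longrightarrow> y \<in> ball a \<epsilon>' \<Longrightarrow> x \<in> S \<and>
      norm (f x) \<le> C' \<and> (\<forall>h. norm (?f' x h) \<le> C' * norm h) \<and>
      norm (f y - f x) \<le> C' * norm (y - x)"
    using C1_locally_lipschitz[OF B S f1] by blast
  define e K where "e = min \<epsilon> \<epsilon>'" and "K = max C' (real (card B) * C)"
  have K: "K \<ge> 0" "C' \<le> K" using \<epsilon>'(2) by (auto simp: K_def)
  have der: "(f has_derivative ?f' x) (at x)" if "x \<in> ball a e" for x
    using Ck_on_has_derivative[OF f1[unfolded One_nat_def], of x] that \<epsilon>'(3)[of x x] by (auto simp: e_def)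
  have lip: "norm (?f' y h - ?f' x h) \<le> K * norm (y - x) * norm h" if "x \<in> ball a e" "y \<in> ball a e" for x y h
  proof -
    have "linear (\<lambda>h. ?f' y h - ?f' x h)"
      using has_derivative_linear[OF der] that by (intro linear_compose_sub) auto
    from linear_bound_basis[OF B this, of "C * norm (y - x)"]
    have "norm (?f' y h - ?f' x h) \<le> real (card B) * (C * norm (y - x)) * norm h"
      using \<epsilon>(3) that by (auto simp: e_def)
    also have "\<dots> = (real (card B) * C) * norm (y - x) * norm h" by simp
    also have "\<dots> \<le> K * norm (y - x) * norm h" by (intro mult_right_mono) (auto simp: K_def)
    finally show ?thesis .
  qed
  have "norm (f y - f x - ?f' x (y - x)) \<le> K * (norm (y - x))\<^sup>2" if "x \<in> ball a e" "y \<in> ball a e" for x y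
  proof -
    \<comment> \<open>On the segment \<open>norm (z - x) \<le> norm (y - x)\<close>, so the
      derivative stays within \<open>K * norm (y - x)\<close> of its value at
      \<open>x\<close>.\<close>
    let ?L = "closed_segment x y"
    have sub: "?L \<subseteq> ball a e" using that by (simp add: closed_segment_subset)
    have "norm (f y - f x - ?f' x (y - x)) \<le> norm (y - x) * (K * norm (y - x))"
    proof (rule differentiable_bound_linearization[where S = ?L])
      show "x + t *\<^sub>R (y - x) \<in> ?L" if "t \<in> {0..1}" for t
        using that by (auto simp: in_segment algebra_simps intro!: exI[of _ t])
      show "(f has_derivative ?f' z) (at z within ?L)" if "z \<in> ?L" for z
        using der that sub has_derivative_at_withinI by blast
      show "onorm (?f' z - ?f' x) \<le> K * norm (y - x)" if "z \<in> ?L" for z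
      proof (rule onorm_bound)
        fix h
        have "norm (?f' z h - ?f' x h) \<le> K * norm (z - x) * norm h"
          using that sub \<open>x \<in> ball a e\<close> by (intro lip) auto
        also have "\<dots> \<le> K * norm (y - x) * norm h"
          using segment_bound1[OF that] K by (intro mult_right_mono mult_left_mono) auto
        finally show "norm ((?f' z - ?f' x) h) \<le> K * norm (y - x) * norm h" by simp
      qed (use K in auto)
    qed auto
    then show ?thesis by (simp add: power2_eq_square mult_ac)
  qed
  moreover have "norm (f x) \<le> K" "norm (?f' x h) \<le> K * norm h" "x \<in> S" if "x \<in> ball a e" for x h
    using \<epsilon>'(3)[of x x] that K mult_right_mono[OF K(2) norm_ge_zero, of h]
    by (auto simp: e_def intro: order.trans)
  moreover have "norm (f y - f x) \<le> K * norm (y - x)" if "x \<in> ball a e" "y \<in> ball a e" for x y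
    using \<epsilon>'(3)[of x y] that mult_right_mono[OF K(2) norm_ge_zero, of "y - x"] by (auto simp: e_def)
  ultimately show ?thesis using lip \<epsilon>(1) \<epsilon>'(1) K(1)
    by (intro exI[of _ e] conjI exI[of _ K]) (auto simp: e_def)
qed

section \<open>Families of linear maps depending on a point\<close>

lemma has_vector_derivative_chain_at:
  assumes "(\<zeta> has_vector_derivative h) (at t)" and "(f has_derivative f') (at (\<zeta> t))"
  shows "((\<lambda>t. f (\<zeta> t)) has_vector_derivative f' h) (at t)"
proof -
  have "((\<lambda>t. f (\<zeta> t)) has_derivative (\<lambda>r. f' (r *\<^sub>R h))) (at t)"
    using has_derivative_compose[OF assms(1)[unfolded has_vector_derivative_def] assms(2)] .
  then show ?thesis
    unfolding has_vector_derivative_def using has_derivative_linear[OF assms(2)] by (simp add: linear_cmul)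
qed

text \<open>Additivity and homogeneity of \<open>f z\<close> are identities between functions of
  \<open>z\<close> on the open set \<open>S\<close>; differentiating them gives linearity in
  \<open>e\<close>, so that bounds on derivatives at basis vectors extend to all
  \<open>e\<close>.\<close>

lemma linear_frechet_derivative_parameter:
  fixes f :: "'a::real_normed_vector \<Rightarrow> 'e::real_vector \<Rightarrow> 'b::real_normed_vector"
  assumes S: "open S" "x \<in> S" and lin: "\<And>z. z \<in> S \<Longrightarrow> linear (f z)"
    and f: "\<And>e. (\<lambda>z. f z e) differentiable (at x)"
  shows "linear (\<lambda>e. frechet_derivative (\<lambda>z. f z e) (at x) h)"
proof -
  let ?D = "\<lambda>e. frechet_derivative (\<lambda>z. f z e) (at x)"
  have D: "((\<lambda>z. f z e) has_derivative ?D e) (at x)" for e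
    using f frechet_derivative_works by blast
  have A: "((\<lambda>z. f z (e + e')) has_derivative (\<lambda>h. ?D e h + ?D e' h)) (at x)" for e e'
    by (rule has_derivative_transform_within_open[OF has_derivative_add[OF D D] S])
       (simp add: linear_add[OF lin])
  have add: "?D (e + e') h = ?D e h + ?D e' h" for e e'
    using fun_cong[OF frechet_derivative_at[OF A[of e e']], of h] by simp
  have M: "((\<lambda>z. f z (r *\<^sub>R e)) has_derivative (\<lambda>h. r *\<^sub>R ?D e h)) (at x)" for r e
    by (rule has_derivative_transform_within_open[OF has_derivative_scaleR_right[OF D] S])
       (simp add: linear_cmul[OF lin])
  have "?D (r *\<^sub>R e) h = r *\<^sub>R ?D e h" for r e
    using fun_cong[OF frechet_derivative_at[OF M[of r e]], of h] by simp
  with add show ?thesis by (intro linearI) auto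
qed

text \<open>The coordinate expressions of \<alpha> and \<open>U\<close> are such families, smooth in
  the point for each fixed \<open>e\<close>. The estimates of \<open>C2_local_estimates\<close> hold
  for every \<open>e\<close> in \<open>E\<close>; every quantity bounded here is linear in
  \<open>e\<close>, hence the factor \<open>norm e\<close>.\<close>

lemma C2_family_estimates:
  fixes f :: "'a::real_inner \<Rightarrow> 'e::real_inner \<Rightarrow> 'b::real_normed_vector"
  assumes B: "orthonormal_basis (B :: 'a set)" and E: "orthonormal_basis (E :: 'e set)"
    and S: "open S" "a \<in> S"
    and lin: "\<And>x. x \<in> S \<Longrightarrow> linear (f x)" and f: "\<And>e. Ck_on 2 S (\<lambda>x. f x e)"
  defines "D \<equiv> \<lambda>x e. frechet_derivative (\<lambda>z. f z e) (at x)"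
  shows "\<exists>\<epsilon>>0. \<exists>C\<ge>0. \<forall>x\<in>ball a \<epsilon>. \<forall>y\<in>ball a \<epsilon>. x \<in> S \<and>
    (\<forall>e. norm (f x e) \<le> C * norm e) \<and>
    (\<forall>e. norm (f y e - f x e) \<le> C * norm (y - x) * norm e) \<and>
    (\<forall>h e. norm (D x e h) \<le> C * norm h * norm e) \<and>
    (\<forall>h e. norm (D y e h - D x e h) \<le> C * norm (y - x) * norm h * norm e) \<and>
    (\<forall>e. norm (f y e - f x e - D x e (y - x)) \<le> C * (norm (y - x))\<^sup>2 * norm e)"
proof -
  have "\<exists>\<epsilon>>0. \<exists>C\<ge>0. \<forall>b\<in>E. \<forall>x\<in>ball a \<epsilon>. \<forall>y\<in>ball a \<epsilon>. x \<in> S \<and>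
    norm (f x b) \<le> C \<and> norm (f y b - f x b) \<le> C * norm (y - x) \<and>
    (\<forall>h. norm (D x b h) \<le> C * norm h) \<and>
    (\<forall>h. norm (D y b h - D x b h) \<le> C * norm (y - x) * norm h) \<and>
    norm (f y b - f x b - D x b (y - x)) \<le> C * (norm (y - x))\<^sup>2"
  proof (rule finite_ball_bound)
    show "finite E" using E by (simp add: orthonormal_basis_def)
  next
    fix b
    show "\<exists>\<epsilon>>0. \<exists>C\<ge>0. \<forall>x\<in>ball a \<epsilon>. \<forall>y\<in>ball a \<epsilon>. x \<in> S \<and>
      norm (f x b) \<le> C \<and> norm (f y b - f x b) \<le> C * norm (y - x) \<and>
      (\<forall>h. norm (D x b h) \<le> C * norm h) \<and>
      (\<forall>h. norm (D y b h - D x b h) \<le> C * norm (y - x) * norm h) \<and>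
      norm (f y b - f x b - D x b (y - x)) \<le> C * (norm (y - x))\<^sup>2"
      unfolding D_def using C2_local_estimates[OF B S f[of b]] by blast
  next
    fix b \<epsilon> C \<epsilon>' C'
    assume *: "\<forall>x\<in>ball a \<epsilon>. \<forall>y\<in>ball a \<epsilon>. x \<in> S \<and>
      norm (f x b) \<le> C \<and> norm (f y b - f x b) \<le> C * norm (y - x) \<and>
      (\<forall>h. norm (D x b h) \<le> C * norm h) \<and>
      (\<forall>h. norm (D y b h - D x b h) \<le> C * norm (y - x) * norm h) \<and>
      norm (f y b - f x b - D x b (y - x)) \<le> C * (norm (y - x))\<^sup>2"
      and \<epsilon>': "\<epsilon>' \<le> \<epsilon>" and C': "C \<le> C'"
    have m: "N \<le> C' * r" if "N \<le> C * r" "r \<ge> 0" for N r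
      using mult_right_mono[OF C' that(2)] that(1) by linarith
    have m2: "N \<le> C' * r * r'" if "N \<le> C * r * r'" "r \<ge> 0" "r' \<ge> 0" for N r r'
      using m[of N "r * r'"] that by (simp add: mult.assoc)
    show "\<forall>x\<in>ball a \<epsilon>'. \<forall>y\<in>ball a \<epsilon>'. x \<in> S \<and>
      norm (f x b) \<le> C' \<and> norm (f y b - f x b) \<le> C' * norm (y - x) \<and>
      (\<forall>h. norm (D x b h) \<le> C' * norm h) \<and>
      (\<forall>h. norm (D y b h - D x b h) \<le> C' * norm (y - x) * norm h) \<and>
      norm (f y b - f x b - D x b (y - x)) \<le> C' * (norm (y - x))\<^sup>2"
    proof (intro ballI)
      fix x y assume "x \<in> ball a \<epsilon>'" "y \<in> ball a \<epsilon>'"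
      then have "x \<in> ball a \<epsilon>" "y \<in> ball a \<epsilon>" using \<epsilon>' by auto
      then have **: "x \<in> S" "norm (f x b) \<le> C" "norm (f y b - f x b) \<le> C * norm (y - x)"
        "\<And>h. norm (D x b h) \<le> C * norm h"
        "\<And>h. norm (D y b h - D x b h) \<le> C * norm (y - x) * norm h"
        "norm (f y b - f x b - D x b (y - x)) \<le> C * (norm (y - x))\<^sup>2"
        using * by blast+
      show "x \<in> S \<and>
        norm (f x b) \<le> C' \<and> norm (f y b - f x b) \<le> C' * norm (y - x) \<and>
        (\<forall>h. norm (D x b h) \<le> C' * norm h) \<and>
        (\<forall>h. norm (D y b h - D x b h) \<le> C' * norm (y - x) * norm h) \<and>
        norm (f y b - f x b - D x b (y - x)) \<le> C' * (norm (y - x))\<^sup>2"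
        by (intro conjI allI m[OF **(3)] m[OF **(4)] m2[OF **(5)] m[OF **(6)] **(1)
            order.trans[OF **(2) C'] norm_ge_zero zero_le_power)
    qed
  qed
  then obtain \<epsilon> C where \<epsilon>: "\<epsilon> > 0" "C \<ge> 0" and bd: "\<forall>b\<in>E. \<forall>x\<in>ball a \<epsilon>. \<forall>y\<in>ball a \<epsilon>. x \<in> S \<and>
    norm (f x b) \<le> C \<and> norm (f y b - f x b) \<le> C * norm (y - x) \<and>
    (\<forall>h. norm (D x b h) \<le> C * norm h) \<and>
    (\<forall>h. norm (D y b h - D x b h) \<le> C * norm (y - x) * norm h) \<and>
    norm (f y b - f x b - D x b (y - x)) \<le> C * (norm (y - x))\<^sup>2"
    by blast
  \<comment> \<open>If \<open>E\<close> is empty then \<open>bd\<close> says nothing, so membership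
    in \<open>S\<close> comes from a separate ball.\<close>
  obtain d where d: "d > 0" "ball a d \<subseteq> S" using S open_contains_ball by blast
  define e K where "e = min \<epsilon> d" and "K = real (card E) * C"
  have "x \<in> S \<and>
    (\<forall>e. norm (f x e) \<le> K * norm e) \<and>
    (\<forall>e. norm (f y e - f x e) \<le> K * norm (y - x) * norm e) \<and>
    (\<forall>h e. norm (D x e h) \<le> K * norm h * norm e) \<and>
    (\<forall>h e. norm (D y e h - D x e h) \<le> K * norm (y - x) * norm h * norm e) \<and>
    (\<forall>e. norm (f y e - f x e - D x e (y - x)) \<le> K * (norm (y - x))\<^sup>2 * norm e)"
    if "x \<in> ball a e" "y \<in> ball a e" for x y
  proof -
    have xy: "x \<in> S" "y \<in> S" "x \<in> ball a \<epsilon>" "y \<in> ball a \<epsilon>" using that d by (auto simp: e_def)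
    have lf: "linear (f x)" "linear (f y)" using lin xy by auto
    have "(\<lambda>z. f z e) differentiable (at z)" if "z \<in> S" for z e
      using f[of e] that by (simp add: numeral_2_eq_2)
    then have lD: "linear (\<lambda>e. D z e h)" if "z \<in> S" for z h
      unfolding D_def using that lin by (intro linear_frechet_derivative_parameter[OF S(1)]) auto
    note lb = linear_bound_basis[OF E]
    have b: "norm (f x b) \<le> C" "norm (f y b - f x b) \<le> C * norm (y - x)"
      "norm (D x b h) \<le> C * norm h"
      "norm (D y b h - D x b h) \<le> C * norm (y - x) * norm h"
      "norm (f y b - f x b - D x b (y - x)) \<le> C * (norm (y - x))\<^sup>2" if "b \<in> E" for b h
      using bd that xy by blast+
    have 1: "norm (f x e) \<le> K * norm e" for e
      using lb[OF lf(1) b(1)] by (simp add: K_def)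
    have 2: "norm (f y e - f x e) \<le> K * norm (y - x) * norm e" for e
      using lb[OF linear_compose_sub[OF lf(2,1)] b(2)] by (simp add: K_def mult.assoc)
    have 3: "norm (D x e h) \<le> K * norm h * norm e" for h e
      using lb[OF lD[OF xy(1)] b(3)] by (simp add: K_def mult.assoc)
    have 4: "norm (D y e h - D x e h) \<le> K * norm (y - x) * norm h * norm e" for h e
      using lb[OF linear_compose_sub[OF lD[OF xy(2)] lD[OF xy(1)]] b(4)] by (simp add: K_def mult.assoc)
    have 5: "norm (f y e - f x e - D x e (y - x)) \<le> K * (norm (y - x))\<^sup>2 * norm e" for e
      using lb[OF linear_compose_sub[OF linear_compose_sub[OF lf(2,1)] lD[OF xy(1)]] b(5)]
      by (simp add: K_def mult.assoc)
    show ?thesis using xy(1) 1 2 3 4 5 by blast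
  qed
  moreover have "e > 0" "K \<ge> 0" using \<epsilon> d by (auto simp: e_def K_def)
  ultimately show ?thesis by blast
qed

text \<open>Product rule for a moving linear map evaluated at a moving vector. Writing
  \<open>\<eta>\<close> in the basis \<open>E\<close> reduces it to scalar curves times curves in
  the target, so that no norm on a space of linear maps is involved.\<close>

lemma has_vector_derivative_family:
  fixes f :: "'a::real_normed_vector \<Rightarrow> 'e::real_inner \<Rightarrow> 'b::real_normed_vector"
  assumes E: "orthonormal_basis (E :: 'e set)" and S: "open S" "\<zeta> t \<in> S"
    and lin: "\<And>x. x \<in> S \<Longrightarrow> linear (f x)"
    and f: "\<And>e. (\<lambda>x. f x e) differentiable (at (\<zeta> t))"
    and \<zeta>: "(\<zeta> has_vector_derivative h) (at t)" and \<eta>: "(\<eta> has_vector_derivative k) (at t)"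
  shows "((\<lambda>t. f (\<zeta> t) (\<eta> t)) has_vector_derivative
    frechet_derivative (\<lambda>x. f x (\<eta> t)) (at (\<zeta> t)) h + f (\<zeta> t) k) (at t)"
proof -
  let ?D = "\<lambda>e. frechet_derivative (\<lambda>x. f x e) (at (\<zeta> t))"
  \<comment> \<open>Linearity of \<open>f\<close> is known on \<open>S\<close> only; the basis
    expansion of the curve is therefore used for times in a neighbourhood \<open>N\<close>.\<close>
  have "isCont \<zeta> t" using \<zeta> has_vector_derivative_continuous by blast
  then obtain N where N: "open N" "t \<in> N" "\<And>s. s \<in> N \<Longrightarrow> \<zeta> s \<in> S"
    using S by (auto simp: continuous_at_open dest!: spec[of _ S])
  have D: "((\<lambda>x. f x e) has_derivative ?D e) (at (\<zeta> t))" for e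
    using f frechet_derivative_works by blast
  have inn: "((\<lambda>s. \<eta> s \<bullet> b) has_field_derivative k \<bullet> b) (at t)" for b
    using bounded_linear.has_vector_derivative[OF bounded_linear_inner_left \<eta>]
    by (simp add: has_real_derivative_iff_has_vector_derivative)
  have "((\<lambda>s. \<Sum>b\<in>E. (\<eta> s \<bullet> b) *\<^sub>R f (\<zeta> s) b) has_vector_derivative
      (\<Sum>b\<in>E. (\<eta> t \<bullet> b) *\<^sub>R ?D b h + (k \<bullet> b) *\<^sub>R f (\<zeta> t) b)) (at t)"
    by (intro has_vector_derivative_sum has_vector_derivative_scaleR inn
        has_vector_derivative_chain_at[OF \<zeta> D])
  also have "(\<Sum>b\<in>E. (\<eta> t \<bullet> b) *\<^sub>R ?D b h + (k \<bullet> b) *\<^sub>R f (\<zeta> t) b) = ?D (\<eta> t) h + f (\<zeta> t) k"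
    using linear_basis_expansion[OF E linear_frechet_derivative_parameter[OF S lin f, of h], where v = "\<eta> t"]
      linear_basis_expansion[OF E lin[OF S(2)], where v = k] by (simp add: sum.distrib)
  finally show ?thesis
    by (rule has_vector_derivative_transform_within_open[OF _ N(1,2)])
       (simp add: linear_basis_expansion[OF E lin[OF N(3)], symmetric])
qed

section \<open>Controls and uniform constants\<close>

lemma powr_two_divide: "a powr (2 / p) = (a powr (1 / p))\<^sup>2" for a p :: real
proof -
  have "2 / p = 1 / p + 1 / p" by simp
  then show ?thesis by (simp only: powr_add power2_eq_square)
qed

text \<open>Compactness of the interval turns constants around each \<open>s0\<close> into one
  constant and one mesh size; \<open>mono\<close> permits replacing a local constant by a larger
  one.\<close>

lemma approx_local:
  assumes local: "\<And>s0. s0 \<in> {0..T} \<Longrightarrow> \<exists>\<eta>>0. \<exists>C. \<forall>s t. 0 \<le> s \<and> s \<le> t \<and> t \<le> T \<and>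
      \<bar>s - s0\<bar> < \<eta> \<and> \<bar>t - s0\<bar> < \<eta> \<longrightarrow> defd s t \<and> bnd s t (C * \<omega> s t powr (real i / p))"
    and mono: "\<And>s t K K'. 0 \<le> s \<Longrightarrow> s \<le> t \<Longrightarrow> t \<le> T \<Longrightarrow> bnd s t K \<Longrightarrow> K \<le> K' \<Longrightarrow> bnd s t K'"
  shows "approx T \<omega> p i defd bnd"
proof -
  let ?P = "\<lambda>s0 \<eta> C. \<eta> > 0 \<and> (\<forall>s t. 0 \<le> s \<and> s \<le> t \<and> t \<le> T \<and>
      \<bar>s - s0\<bar> < \<eta> \<and> \<bar>t - s0\<bar> < \<eta> \<longrightarrow> defd s t \<and> bnd s t (C * \<omega> s t powr (real i / p)))"
  have "\<forall>s0\<in>{0..T}. \<exists>q. ?P s0 (fst q) (snd q)" 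
  proof
    fix s0 assume "s0 \<in> {0..T}"
    from local[OF this] obtain \<eta> C where "?P s0 \<eta> C" by blast
    then show "\<exists>q. ?P s0 (fst q) (snd q)" by (intro exI[of _ "(\<eta>, C)"]) simp
  qed
  from bchoice[OF this] obtain q where q: "\<forall>s0\<in>{0..T}. ?P s0 (fst (q s0)) (snd (q s0))" ..
  define \<eta> C where "\<eta> s = fst (q s)" and "C s = snd (q s)" for s
  have P: "?P s0 (\<eta> s0) (C s0)" if "s0 \<in> {0..T}" for s0 using q that by (simp add: \<eta>_def C_def)
  have "{0..T} \<subseteq> (\<Union>s\<in>{0..T}. ball s (\<eta> s))"
  proof
    fix s assume "s \<in> {0..T}"
    then show "s \<in> (\<Union>s\<in>{0..T}. ball s (\<eta> s))" using P[of s] by (intro UN_I[of s]) auto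
  qed
  then obtain F where F: "F \<subseteq> {0..T}" "finite F" "{0..T} \<subseteq> (\<Union>s\<in>F. ball s (\<eta> s))"
    using compactE_image[of "{0..T}" "{0..T}" "\<lambda>s. ball s (\<eta> s)"] by auto
  \<comment> \<open>A Lebesgue number of the finite cover: times closer than \<epsilon> share one
    neighbourhood. Half of it is used below, because \<open>approx\<close> admits equality in
    \<open>t - s \<le> \<delta>\<close> and balls are open.\<close>
  obtain \<epsilon> where \<epsilon>: "\<epsilon> > 0"
    "\<And>s. s \<in> {0..T} \<Longrightarrow> \<exists>G\<in>(\<lambda>s. ball s (\<eta> s)) ` F. ball s \<epsilon> \<subseteq> G"
    using Heine_Borel_lemma[of "{0..T}" "(\<lambda>s. ball s (\<eta> s)) ` F"] F(3) by auto
  have "defd s t \<and> bnd s t ((\<Sum>s\<in>F. \<bar>C s\<bar>) * \<omega> s t powr (real i / p))"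
    if st: "0 \<le> s" "s \<le> t" "t \<le> T" "t - s \<le> \<epsilon> / 2" for s t
  proof -
    obtain s0 where s0: "s0 \<in> F" "ball s \<epsilon> \<subseteq> ball s0 (\<eta> s0)" using \<epsilon>(2)[of s] st by auto
    have "s \<in> ball s \<epsilon>" "t \<in> ball s \<epsilon>" using st \<epsilon>(1) by (auto simp: dist_real_def)
    then have "s \<in> ball s0 (\<eta> s0)" "t \<in> ball s0 (\<eta> s0)" using s0(2) by blast+
    then have near: "\<bar>s - s0\<bar> < \<eta> s0" "\<bar>t - s0\<bar> < \<eta> s0" by (auto simp: dist_real_def abs_minus_commute)
    have "s0 \<in> {0..T}" using s0 F by auto
    then have 1: "defd s t" "bnd s t (C s0 * \<omega> s t powr (real i / p))"
      using P[of s0] near st by blast+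
    \<comment> \<open>Local constants may be negative; with absolute values the finite sum dominates
      each of them.\<close>
    have "C s0 \<le> \<bar>C s0\<bar>" by simp
    also have "\<dots> \<le> (\<Sum>s\<in>F. \<bar>C s\<bar>)" using s0 F by (intro member_le_sum) auto
    finally have "C s0 * \<omega> s t powr (real i / p) \<le> (\<Sum>s\<in>F. \<bar>C s\<bar>) * \<omega> s t powr (real i / p)"
      by (intro mult_right_mono) auto
    from mono[OF st(1-3) 1(2) this] show ?thesis using 1(1) by simp
  qed
  moreover have "0 < \<epsilon> / 2" using \<epsilon>(1) by simp
  ultimately show ?thesis unfolding approx_def by blast
qed

text \<open>Superadditivity and nonnegativity make \<open>\<omega> 0 T\<close> a bound on the whole
  simplex, which later lets squares of \<omega>^(1/p) be traded for first powers.\<close>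

lemma control_mono:
  assumes "control T \<omega>" "0 \<le> s" "s \<le> t" "t \<le> T"
  shows "0 \<le> \<omega> s t" and "\<omega> s t \<le> \<omega> 0 T"
proof -
  have nn: "0 \<le> \<omega> a b" if "0 \<le> a" "a \<le> b" "b \<le> T" for a b
    using assms(1) that unfolding control_def simplex_on_def by blast
  have add: "\<omega> a b + \<omega> b d \<le> \<omega> a d" if "0 \<le> a" "a \<le> b" "b \<le> d" "d \<le> T" for a b d
    using assms(1) that unfolding control_def by blast
  show "0 \<le> \<omega> s t" using nn assms by simp
  show "\<omega> s t \<le> \<omega> 0 T"
    using add[of 0 s t] add[of 0 t T] nn[of 0 s] nn[of t T] assms(2-4) by simp
qed

lemma orthonormal_basis_Basis: "orthonormal_basis (Basis :: 'a::euclidean_space set)"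
  by (simp add: orthonormal_basis_def euclidean_representation)

text \<open>Here \<open>h\<close> is the coordinate increment of the path, \<open>\<Psi>\<close> its
  logarithm, \<open>P\<close> the controlled term, and \<open>r\<close> stands for \<omega>^(1/p).
  The logarithm error is itself quadratic in \<open>h\<close>; \<open>small\<close> makes it at most
  half of \<open>norm h\<close>, which is absorbed on the left and produces the factor 2. Since
  \<open>r \<le> R\<close>, the term \<open>K * r\<^sup>2\<close> is at most
  \<open>K * R * r\<close>. The bound on \<open>h\<close> then feeds the second estimate.\<close>

lemma increment_from_logarithm:
  fixes h P \<Psi> :: "'a::real_normed_vector"
  assumes log: "norm (\<Psi> - h) \<le> C * (norm h)\<^sup>2" and ctrl: "norm (\<Psi> - P) \<le> K * r\<^sup>2"
    and P: "norm P \<le> L * r" and small: "C * norm h \<le> 1 / 2"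
    and r: "0 \<le> r" "r \<le> R" and nn: "0 \<le> C" "0 \<le> K" "0 \<le> L"
  shows "norm h \<le> 2 * (L + K * R) * r"
    and "norm (h - P) \<le> (C * (2 * (L + K * R))\<^sup>2 + K) * r\<^sup>2"
proof -
  have "r\<^sup>2 \<le> R * r" using r by (simp add: power2_eq_square mult_right_mono)
  then have "K * r\<^sup>2 \<le> K * (R * r)" using nn by (intro mult_left_mono)
  moreover have "norm h \<le> norm \<Psi> + norm (\<Psi> - h)" using norm_triangle_ineq4[of \<Psi> "\<Psi> - h"] by simp
  moreover have "norm \<Psi> \<le> norm P + norm (\<Psi> - P)" using norm_triangle_ineq[of P "\<Psi> - P"] by simp
  moreover have "C * (norm h)\<^sup>2 \<le> 1 / 2 * norm h"
    using mult_right_mono[OF small norm_ge_zero, of h] by (simp add: power2_eq_square)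
  ultimately show h: "norm h \<le> 2 * (L + K * R) * r"
    using log ctrl P by (simp add: algebra_simps)
  have "(norm h)\<^sup>2 \<le> (2 * (L + K * R) * r)\<^sup>2" using h by (intro power_mono) auto
  then have "C * (norm h)\<^sup>2 \<le> C * ((2 * (L + K * R))\<^sup>2 * r\<^sup>2)"
    using nn by (intro mult_left_mono) (auto simp: power_mult_distrib)
  moreover have "norm (h - P) \<le> norm (\<Psi> - h) + norm (\<Psi> - P)"
    using norm_triangle_ineq4[of "\<Psi> - P" "\<Psi> - h"] by simp
  ultimately show "norm (h - P) \<le> (C * (2 * (L + K * R))\<^sup>2 + K) * r\<^sup>2"
    using log ctrl by (simp add: algebra_simps)
qed

section \<open>Charts and tangent vectors\<close>

locale smooth_atlas =
  fixes A :: "('m::{t2_space,second_countable_topology}, 'e::real_inner) atlas"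
  assumes smooth_manifold: "smooth_manifold A"
begin

abbreviation toc where "toc \<equiv> tangent_of_coord A"
abbreviation TM where "TM \<equiv> tangent_space A"

abbreviation dtrans :: "('m, 'e) chart \<Rightarrow> ('m, 'e) chart \<Rightarrow> 'm \<Rightarrow> 'e \<Rightarrow> 'e"
  where "dtrans c d m \<equiv> frechet_derivative (transition c d) (at (snd c m))"

lemma model_basis: obtains E :: "'e set" where "orthonormal_basis E"
  using smooth_manifold orthonormal_basis_exists unfolding smooth_manifold_def by blast

lemma ex_chart: obtains c where "c \<in> A" "m \<in> fst c"
  using smooth_manifold unfolding smooth_manifold_def by blast

lemma open_chart: "c \<in> A \<Longrightarrow> open (fst c)" and open_chart_image: "c \<in> A \<Longrightarrow> open (chart_image c)"
  using smooth_manifold unfolding smooth_manifold_def by auto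

text \<open>\<open>smooth_manifold\<close> asserts that some continuous inverse exists; by
  injectivity it agrees with \<open>chart_inv c\<close> on the image.\<close>

lemma chart_homeomorphism:
  assumes c: "c \<in> A"
  shows "homeomorphism (fst c) (chart_image c) (snd c) (chart_inv c)"
proof -
  obtain h where h: "homeomorphism (fst c) (chart_image c) (snd c) h"
    using smooth_manifold c unfolding smooth_manifold_def by blast
  have "inj_on (snd c) (fst c)"
    using homeomorphism_apply1[OF h] by (rule inj_on_inverseI)
  then have eq: "chart_inv c a = h a" if "a \<in> chart_image c" for a
    using that homeomorphism_apply1[OF h] by (auto simp: chart_inv_def chart_image_def)
  have "continuous_on (chart_image c) h" using h by (simp add: homeomorphism_def)
  then have "continuous_on (chart_image c) (chart_inv c)"
    by (rule continuous_on_eq) (simp add: eq)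
  moreover have "chart_inv c ` chart_image c = h ` chart_image c"
    by (rule image_cong) (auto simp: eq)
  moreover have "chart_inv c (snd c m) = h (snd c m)" if "m \<in> fst c" for m
    using that by (intro eq) (simp add: chart_image_def)
  ultimately show ?thesis using h by (simp add: homeomorphism_def eq)
qed

lemma
  assumes "c \<in> A"
  shows chart_inv_chart: "m \<in> fst c \<Longrightarrow> chart_inv c (snd c m) = m"
    and chart_inv_in: "a \<in> chart_image c \<Longrightarrow> chart_inv c a \<in> fst c"
    and chart_chart_inv: "a \<in> chart_image c \<Longrightarrow> snd c (chart_inv c a) = a"
    and chart_in_image: "m \<in> fst c \<Longrightarrow> snd c m \<in> chart_image c"
    and continuous_on_chart: "continuous_on (fst c) (snd c)"
    and continuous_on_chart_inv: "continuous_on (chart_image c) (chart_inv c)"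
  using chart_homeomorphism[OF assms] by (auto simp: homeomorphism_def)

lemma open_chart_image_of:
  assumes c: "c \<in> A" and N: "open N" "N \<subseteq> fst c"
  shows "open (snd c ` N)"
proof -
  have "snd c ` N = chart_inv c -` N \<inter> chart_image c"
    using N(2) chart_inv_chart[OF c] chart_chart_inv[OF c] chart_in_image[OF c] by force
  then show ?thesis
    using continuous_on_open_vimage[OF open_chart_image[OF c], of "chart_inv c"]
      continuous_on_chart_inv[OF c] N(1) by simp
qed

lemma open_overlap: "c \<in> A \<Longrightarrow> d \<in> A \<Longrightarrow> open (snd c ` (fst c \<inter> fst d))"
  by (intro open_chart_image_of open_Int open_chart) auto

lemma transition_chart: "c \<in> A \<Longrightarrow> m \<in> fst c \<Longrightarrow> transition c d (snd c m) = snd d m"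
  by (simp add: transition_def chart_inv_chart)

lemma transition_Ck:
  "c \<in> A \<Longrightarrow> d \<in> A \<Longrightarrow> Ck_on n (snd c ` (fst c \<inter> fst d)) (transition c d)"
  using smooth_manifold unfolding smooth_manifold_def smooth_on_def by blast

section \<open>Change of coordinates for tangent vectors\<close>

lemma transition_has_derivative:
  assumes "c \<in> A" "d \<in> A" "m \<in> fst c" "m \<in> fst d"
  shows "(transition c d has_derivative dtrans c d m) (at (snd c m))"
  using Ck_on_has_derivative[OF transition_Ck[OF assms(1,2), of "Suc 0"]] assms by blast

text \<open>The composed transition equals the direct one on the image of the overlap, an open set,
  which is enough for the derivatives. This cocycle identity is what places
  \<open>tangent_of_coord\<close> in the tangent space.\<close>

lemma dtrans_trans:
  assumes c: "c \<in> A" "m \<in> fst c" and d: "d \<in> A" "m \<in> fst d" and d': "d' \<in> A" "m \<in> fst d'"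
  shows "dtrans d d' m (dtrans c d m v) = dtrans c d' m v"
proof -
  have "((\<lambda>a. transition d d' (transition c d a)) has_derivative
      (\<lambda>v. dtrans d d' m (dtrans c d m v))) (at (snd c m))"
    using has_derivative_compose[OF transition_has_derivative[OF c(1) d(1) c(2) d(2)]]
      transition_has_derivative[OF d(1) d'(1) d(2) d'(2)] transition_chart[OF c] by simp
  then have "(transition c d' has_derivative (\<lambda>v. dtrans d d' m (dtrans c d m v))) (at (snd c m))"
  proof (rule has_derivative_transform_within_open)
    show "open (snd c ` (fst c \<inter> fst d))" using open_overlap c d by blast
    show "snd c m \<in> snd c ` (fst c \<inter> fst d)" using c d by blast
    show "transition d d' (transition c d a) = transition c d' a" if "a \<in> snd c ` (fst c \<inter> fst d)" for a
      using that c(1) d(1) by (auto simp: transition_chart)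
  qed
  from fun_cong[OF frechet_derivative_at[OF this], of v] show ?thesis .
qed

lemma dtrans_self:
  assumes c: "c \<in> A" "m \<in> fst c"
  shows "dtrans c c m v = v"
proof -
  have "(transition c c has_derivative (\<lambda>v. v)) (at (snd c m))"
    by (rule has_derivative_transform_within_open[OF has_derivative_ident open_chart_image[OF c(1)]])
       (auto simp: transition_def chart_chart_inv chart_in_image c)
  from fun_cong[OF frechet_derivative_at[OF this], of v] show ?thesis by simp
qed

lemma linear_dtrans: "c \<in> A \<Longrightarrow> d \<in> A \<Longrightarrow> m \<in> fst c \<Longrightarrow> m \<in> fst d \<Longrightarrow> linear (dtrans c d m)"
  using transition_has_derivative has_derivative_linear by blast

lemma tangent_of_coord_in: "c \<in> A \<Longrightarrow> m \<in> fst c \<Longrightarrow> toc c m e \<in> TM m"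
  by (auto simp: tangent_space_def tangent_of_coord_def dtrans_trans)

lemma tangent_of_coord_self: "c \<in> A \<Longrightarrow> m \<in> fst c \<Longrightarrow> toc c m e c = e"
  by (simp add: tangent_of_coord_def dtrans_self)

lemma tangent_of_coord_coord: "c \<in> A \<Longrightarrow> m \<in> fst c \<Longrightarrow> v \<in> TM m \<Longrightarrow> toc c m (v c) = v"
proof (rule ext)
  fix d
  assume c: "c \<in> A" "m \<in> fst c" and v: "v \<in> TM m"
  have "v d = dtrans c d m (v c)" if "d \<in> A" "m \<in> fst d"
    using v c that unfolding tangent_space_def by blast
  moreover have "v d = 0" if "\<not> (d \<in> A \<and> m \<in> fst d)"
    using v that unfolding tangent_space_def by blast
  ultimately show "toc c m (v c) d = v d" unfolding tangent_of_coord_def by metis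
qed

lemma tangent_of_coord_add:
  "c \<in> A \<Longrightarrow> m \<in> fst c \<Longrightarrow> toc c m (e + e') = toc c m e + toc c m e'"
  by (auto simp: tangent_of_coord_def fun_eq_iff linear_add[OF linear_dtrans])

lemma tangent_of_coord_scaleR:
  "c \<in> A \<Longrightarrow> m \<in> fst c \<Longrightarrow> toc c m (r *\<^sub>R e) = r *\<^sub>R toc c m e"
  by (auto simp: tangent_of_coord_def fun_eq_iff scaleR_fun_def linear_cmul[OF linear_dtrans])

lemma tangent_space_add: "v \<in> TM m \<Longrightarrow> w \<in> TM m \<Longrightarrow> v + w \<in> TM m"
proof -
  assume vw: "v \<in> TM m" "w \<in> TM m"
  obtain c where c: "c \<in> A" "m \<in> fst c" using ex_chart .
  then have "v + w = toc c m (v c + w c)"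
    using vw by (simp add: tangent_of_coord_add tangent_of_coord_coord)
  then show ?thesis using tangent_of_coord_in[OF c] by simp
qed

lemma tangent_space_scaleR: "v \<in> TM m \<Longrightarrow> r *\<^sub>R v \<in> TM m"
proof -
  assume v: "v \<in> TM m"
  obtain c where c: "c \<in> A" "m \<in> fst c" using ex_chart .
  then have "r *\<^sub>R v = toc c m (r *\<^sub>R v c)"
    using v by (simp add: tangent_of_coord_scaleR tangent_of_coord_coord)
  then show ?thesis using tangent_of_coord_in[OF c] by simp
qed

lemma tangent_space_diff: "v \<in> TM m \<Longrightarrow> w \<in> TM m \<Longrightarrow> v - w \<in> TM m"
  using tangent_space_add[of v m "(-1) *\<^sub>R w"] tangent_space_scaleR[of w m "-1"] by simp

lemma linear_map_on_coord:
  assumes "c \<in> A" "m \<in> fst c" "linear_map_on (TM m) f"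
  shows "linear (\<lambda>e. f (toc c m e))"
  using assms tangent_of_coord_in[OF assms(1,2)]
  by (intro linearI) (auto simp: linear_map_on_def tangent_of_coord_add tangent_of_coord_scaleR)

text \<open>Smoothness is required in all charts, which is what needs the chain rule for \<open>Ck_on\<close>; the
  product rule defining \<open>cov_deriv_form\<close> determines its value only because such a field exists.\<close>

lemma vector_field_near_const:
  assumes c: "c \<in> A" "m \<in> fst c"
  shows "vector_field_near A m (\<lambda>n. toc c n e)"
  unfolding vector_field_near_def
proof (intro exI[of _ "fst c"] conjI ballI)
  show "open (fst c)" "m \<in> fst c" using c open_chart by auto
  show "toc c n e \<in> TM n" if "n \<in> fst c" for n using tangent_of_coord_in c that by blast
next
  fix d assume d: "d \<in> A"
  obtain E :: "'e set" where E: "orthonormal_basis E" using model_basis .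
  let ?S = "snd d ` (fst c \<inter> fst d)" and ?R = "snd c ` (fst c \<inter> fst d)"
  have S: "open ?S" "open ?R" using open_overlap[OF d c(1)] open_overlap[OF c(1) d] by (auto simp: Int_commute)
  show "smooth_on ?S (\<lambda>a. toc c (chart_inv d a) e d)"
    unfolding smooth_on_def
  proof
    fix n
    have "Ck_on n ?S (\<lambda>a. frechet_derivative (transition c d) (at (transition d c a)) e)"
    proof (rule Ck_on_compose[OF E S, where f = "transition d c"
          and g = "\<lambda>x. frechet_derivative (transition c d) (at x) e"])
      show "Ck_on n ?S (transition d c)" using transition_Ck[OF d c(1)] by (simp add: Int_commute)
      show "transition d c ` ?S \<subseteq> ?R" using transition_chart[OF d, of _ c] by auto
      show "Ck_on n ?R (\<lambda>x. frechet_derivative (transition c d) (at x) e)"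
        using transition_Ck[OF c(1) d, of "Suc n"] by simp
    qed
    then show "Ck_on n ?S (\<lambda>a. toc c (chart_inv d a) e d)"
      by (rule Ck_on_cong[OF S(1), rotated])
         (auto simp: tangent_of_coord_def d chart_inv_chart transition_chart)
  qed
qed

section \<open>Curves through a point and directional derivatives\<close>

lemma curve_exists:
  assumes v: "v \<in> TM m"
  shows "\<exists>\<sigma>. curve_with_velocity A m v \<sigma>"
proof -
  obtain c where c: "c \<in> A" "m \<in> fst c" using ex_chart .
  \<comment> \<open>A straight line in one chart; its velocity in the other charts is right because
    the coordinates of \<open>v\<close> are related by the derivatives of the transitions.\<close>
  let ?\<zeta> = "\<lambda>t. snd c m + t *\<^sub>R v c"
  let ?\<sigma> = "\<lambda>t. chart_inv c (?\<zeta> t)"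
  have \<zeta>: "(?\<zeta> has_vector_derivative v c) (at 0)" by (auto intro!: derivative_eq_intros)
  have "isCont (chart_inv c) (snd c m)"
    using continuous_on_chart_inv[OF c(1)] open_chart_image[OF c(1)] chart_in_image[OF c]
      continuous_on_eq_continuous_at by blast
  then have "isCont ?\<sigma> 0"
    using isCont_o2[of 0 ?\<zeta> "chart_inv c"] has_vector_derivative_continuous[OF \<zeta>] by simp
  moreover have "((\<lambda>t. snd d (?\<sigma> t)) has_vector_derivative v d) (at 0)" if d: "d \<in> A" "m \<in> fst d" for d
  proof -
    have "((\<lambda>t. transition c d (?\<zeta> t)) has_vector_derivative dtrans c d m (v c)) (at 0)"
      using transition_has_derivative[OF c(1) d(1) c(2) d(2)]
      by (intro has_vector_derivative_chain_at[OF \<zeta>]) simp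
    moreover have "v d = dtrans c d m (v c)"
      using v c d unfolding tangent_space_def by blast
    ultimately show ?thesis by (simp only: transition_def)
  qed
  ultimately show ?thesis
    unfolding curve_with_velocity_def using c chart_inv_chart by (intro exI[of _ ?\<sigma>]) auto
qed

text \<open>\<open>dir_deriv\<close> describes a value by a condition on all curves, which would
  single out nothing if there were no curve; \<open>curve_exists\<close> makes \<open>z\<close>
  unique.\<close>

lemma dir_deriv_eqI:
  assumes "v \<in> TM m"
    and "\<And>\<sigma>. curve_with_velocity A m v \<sigma> \<Longrightarrow> ((\<lambda>t. f (\<sigma> t)) has_vector_derivative z) (at 0)"
  shows "dir_deriv A m v f = z"
  unfolding dir_deriv_def
proof (rule the_equality)
  fix z' assume "\<forall>\<sigma>. curve_with_velocity A m v \<sigma> \<longrightarrow> ((\<lambda>t. f (\<sigma> t)) has_vector_derivative z') (at 0)"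
  then show "z' = z"
    using curve_exists[OF assms(1)] assms(2) vector_derivative_at by blast
qed (use assms(2) in blast)

lemma curve_near:
  assumes "curve_with_velocity A m v \<sigma>" and "open N" and "m \<in> N"
  obtains W where "open W" "0 \<in> W" "\<And>t. t \<in> W \<Longrightarrow> \<sigma> t \<in> N"
proof -
  have "isCont \<sigma> 0" "\<sigma> 0 = m" using assms(1) by (auto simp: curve_with_velocity_def)
  then have "\<exists>W. open W \<and> 0 \<in> W \<and> (\<forall>t\<in>W. \<sigma> t \<in> N)"
    using assms(2,3) by (auto simp: continuous_at_open)
  then show thesis using that by blast
qed

section \<open>The covariant derivative in a chart\<close>

definition form_coord :: "('m \<Rightarrow> ('m, 'e) tangent \<Rightarrow> 'v::real_normed_vector) \<Rightarrow> ('m, 'e) chart \<Rightarrow> 'e \<Rightarrow> 'e \<Rightarrow> 'v"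
  where "form_coord \<alpha> c a e = \<alpha> (chart_inv c a) (toc c (chart_inv c a) e)"

text \<open>The two points form one variable, so that Taylor estimates on the product apply; as in
  \<open>U\<close>, the target point comes first and the source second.\<close>

definition par_coord :: "('m \<Rightarrow> 'm \<Rightarrow> ('m, 'e) tangent \<Rightarrow> ('m, 'e) tangent) \<Rightarrow> ('m, 'e) chart \<Rightarrow> 'e \<times> 'e \<Rightarrow> 'e \<Rightarrow> 'e"
  where "par_coord U c z e =
    U (chart_inv c (fst z)) (chart_inv c (snd z)) (toc c (chart_inv c (snd z)) e) c"

lemma form_coord_linear:
  assumes \<alpha>: "\<alpha> \<in> one_forms A" and c: "c \<in> A" "a \<in> chart_image c"
  shows "linear (form_coord \<alpha> c a)"
proof -
  have "linear_map_on (TM (chart_inv c a)) (\<alpha> (chart_inv c a))" using \<alpha> by (auto simp: one_forms_def)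
  then show ?thesis
    unfolding form_coord_def using linear_map_on_coord chart_inv_in c by blast
qed

lemma form_coord_Ck:
  assumes "\<alpha> \<in> one_forms A" and "c \<in> A"
  shows "Ck_on n (chart_image c) (\<lambda>a. form_coord \<alpha> c a e)"
  using assms unfolding one_forms_def smooth_on_def form_coord_def by blast

lemma form_coord:
  assumes "c \<in> A" "n \<in> fst c" "v \<in> TM n"
  shows "\<alpha> n v = form_coord \<alpha> c (snd c n) (v c)"
  using assms by (simp add: form_coord_def chart_inv_chart tangent_of_coord_coord)

lemma open_coord_domain:
  assumes c: "c \<in> A" and D: "open D"
  shows "open (coord_domain D c c)"
proof -
  let ?I = "chart_image c \<times> chart_image c" and ?f = "\<lambda>z. (chart_inv c (fst z), chart_inv c (snd z))"
  have I: "open ?I" using open_chart_image[OF c] by (simp add: open_Times)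
  have "continuous_on ?I ?f"
    by (intro continuous_on_Pair continuous_on_compose2[OF continuous_on_chart_inv[OF c]] continuous_intros) auto
  then have "open (?f -` D \<inter> ?I)" using continuous_on_open_vimage[OF I] D by blast
  moreover have "coord_domain D c c = ?f -` D \<inter> ?I" by (auto simp: coord_domain_def)
  ultimately show ?thesis by simp
qed

lemma coord_domain_diag:
  assumes "diagonal_domain D" and "a \<in> chart_image c"
  shows "(a, a) \<in> coord_domain D c c"
  using assms by (simp add: coord_domain_def diagonal_domain_def)

lemma par_coord_open: "parallelism A D U \<Longrightarrow> c \<in> A \<Longrightarrow> open (coord_domain D c c)"
  by (intro open_coord_domain) (auto simp: parallelism_def diagonal_domain_def)

lemma par_coord_linear:
  assumes U: "parallelism A D U" and c: "c \<in> A" and z: "z \<in> coord_domain D c c"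
  shows "linear (par_coord U c z)"
proof -
  let ?n = "chart_inv c (fst z)" and ?m = "chart_inv c (snd z)"
  have m: "?m \<in> fst c" and "(?n, ?m) \<in> D"
    using z chart_inv_in[OF c] by (auto simp: coord_domain_def)
  then have "linear_map_on (TM ?m) (U ?n ?m)" using U unfolding parallelism_def by blast
  then have "linear_map_on (TM ?m) (\<lambda>v. U ?n ?m v c)"
    by (auto simp: linear_map_on_def scaleR_fun_def)
  from linear_map_on_coord[OF c m this] show ?thesis unfolding par_coord_def by simp
qed

lemma par_coord_Ck:
  assumes "parallelism A D U" and "c \<in> A"
  shows "Ck_on n (coord_domain D c c) (\<lambda>z. par_coord U c z e)"
  using assms unfolding parallelism_def smooth_on_def par_coord_def case_prod_unfold by blast

lemma par_coord:
  assumes U: "parallelism A D U" and D: "(n, m) \<in> D" and c: "c \<in> A" "n \<in> fst c" "m \<in> fst c" and v: "v \<in> TM m"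
  shows "U n m v c = par_coord U c (snd c n, snd c m) (v c)" and "U n m v \<in> TM n"
    and "(snd c n, snd c m) \<in> coord_domain D c c"
proof -
  show "U n m v c = par_coord U c (snd c n, snd c m) (v c)"
    using c v by (simp add: par_coord_def chart_inv_chart tangent_of_coord_coord)
  show "U n m v \<in> TM n" using U D v unfolding parallelism_def by blast
  show "(snd c n, snd c m) \<in> coord_domain D c c"
    using c D by (simp add: coord_domain_def chart_inv_chart chart_in_image)
qed

lemma par_coord_diag:
  assumes U: "parallelism A D U" and c: "c \<in> A" "a \<in> chart_image c"
  shows "par_coord U c (a, a) e = e"
proof -
  have "U (chart_inv c a) (chart_inv c a) (toc c (chart_inv c a) e) = toc c (chart_inv c a) e"
    using U tangent_of_coord_in[OF c(1) chart_inv_in[OF c]] unfolding parallelism_def by blast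
  then show ?thesis
    using tangent_of_coord_self[OF c(1) chart_inv_in[OF c]] by (simp add: par_coord_def)
qed

abbreviation dform where "dform \<alpha> c a e \<equiv> frechet_derivative (\<lambda>b. form_coord \<alpha> c b e) (at a)"
abbreviation dpar where "dpar U c z e \<equiv> frechet_derivative (\<lambda>z. par_coord U c z e) (at z)"

lemma form_coord_differentiable:
  "\<alpha> \<in> one_forms A \<Longrightarrow> c \<in> A \<Longrightarrow> a \<in> chart_image c \<Longrightarrow> (\<lambda>b. form_coord \<alpha> c b e) differentiable (at a)"
  using form_coord_Ck[of \<alpha> c "Suc 0" e] by simp

lemma par_coord_has_derivative:
  "parallelism A D U \<Longrightarrow> c \<in> A \<Longrightarrow> z \<in> coord_domain D c c \<Longrightarrow>
    ((\<lambda>z. par_coord U c z e) has_derivative dpar U c z e) (at z)"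
  using Ck_on_has_derivative par_coord_Ck by blast

text \<open>\<open>par_coord U c (b, b)\<close> is the identity for all \<open>b\<close>, so the
  derivative vanishes on \<open>(k, k)\<close>; subtracting this vector from \<open>(h, k)\<close>
  leaves \<open>(h - k, 0)\<close>.\<close>

lemma dpar_diag:
  assumes U: "parallelism A D U" and c: "c \<in> A" "a \<in> chart_image c"
  shows "dpar U c (a, a) e (h, k) = dpar U c (a, a) e (h - k, 0)"
proof -
  have D: "diagonal_domain D" using U by (simp add: parallelism_def)
  have der: "((\<lambda>z. par_coord U c z e) has_derivative dpar U c (a, a) e) (at (a, a))"
    by (rule par_coord_has_derivative[OF U c(1) coord_domain_diag[OF D c(2)]])
  have "((\<lambda>b. (b, b)) has_derivative (\<lambda>h. (h, h))) (at a)" by (auto intro!: derivative_eq_intros)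
  from has_derivative_compose[OF this der]
  have H: "((\<lambda>b. e) has_derivative (\<lambda>h. dpar U c (a, a) e (h, h))) (at a)"
    by (rule has_derivative_transform_within_open[OF _ open_chart_image[OF c(1)] c(2)])
       (rule par_coord_diag[OF U c(1)])
  have 0: "dpar U c (a, a) e (k, k) = 0"
    using fun_cong[OF has_derivative_unique[OF H has_derivative_const], of k] .
  have "dpar U c (a, a) e ((h - k, 0) + (k, k)) = dpar U c (a, a) e (h - k, 0) + dpar U c (a, a) e (k, k)"
    by (rule linear_add[OF has_derivative_linear[OF der]])
  then show ?thesis using 0 by simp
qed

text \<open>For a field \<open>Y\<close> extending \<open>u\<close>, differentiating \<alpha>(Y) and
  differentiating the transported \<open>Y\<close> both produce the derivative \<open>k\<close> of
  the coordinates of \<open>Y\<close>. By linearity of \<alpha> it cancels in the product rule, and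
  what remains depends on \<open>u\<close> alone: this is the existence half of the description. The
  field with constant coordinates gives uniqueness.\<close>

lemma cov_deriv_form_coord:
  assumes \<alpha>: "\<alpha> \<in> one_forms A" and U: "parallelism A D U" and c: "c \<in> A" "m \<in> fst c"
    and v: "v \<in> TM m" and u: "u \<in> TM m"
  shows "cov_deriv_form A U \<alpha> m v u = dform \<alpha> c (snd c m) (u c) (v c)
    - form_coord \<alpha> c (snd c m) (dpar U c (snd c m, snd c m) (u c) (0, v c))"
proof -
  obtain E :: "'e set" where E: "orthonormal_basis E" using model_basis .
  let ?a = "snd c m"
  let ?z = "dform \<alpha> c ?a (u c) (v c) - form_coord \<alpha> c ?a (dpar U c (?a, ?a) (u c) (0, v c))"
  have a: "?a \<in> chart_image c" using chart_in_image c by blast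
  have D: "diagonal_domain D" "open D" "(m, m) \<in> D" using U by (auto simp: parallelism_def diagonal_domain_def)
  have aa: "(?a, ?a) \<in> coord_domain D c c" by (rule coord_domain_diag[OF D(1) a])
  have *: "dir_deriv A m v (\<lambda>n. \<alpha> n (Y n)) = ?z + \<alpha> m (cov_deriv A U m v Y)"
    if Y: "vector_field_near A m Y" and Yu: "Y m = u" for Y
  proof -
    obtain N where N: "open N" "m \<in> N" and YN: "\<And>n. n \<in> N \<Longrightarrow> Y n \<in> TM n"
      and Ysm: "\<forall>c\<in>A. smooth_on (snd c ` (N \<inter> fst c)) (\<lambda>a. Y (chart_inv c a) c)"
      using Y unfolding vector_field_near_def by blast
    define Yc where "Yc a = Y (chart_inv c a) c" for a
    have "Ck_on (Suc 0) (snd c ` (N \<inter> fst c)) Yc"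
      using Ysm c(1) unfolding smooth_on_def Yc_def by blast
    from Ck_on_has_derivative[OF this]
    have dY: "(Yc has_derivative frechet_derivative Yc (at ?a)) (at ?a)"
      using N c(2) by blast
    define k where "k = frechet_derivative Yc (at ?a) (v c)"
    have Yca: "Yc ?a = u c" using Yu c by (simp add: Yc_def chart_inv_chart)
    have curve: "\<exists>W. open W \<and> 0 \<in> W \<and> (\<forall>t\<in>W. \<sigma> t \<in> N \<and> \<sigma> t \<in> fst c \<and> (m, \<sigma> t) \<in> D)"
      and \<zeta>: "((\<lambda>t. snd c (\<sigma> t)) has_vector_derivative v c) (at 0)"
      and \<eta>: "((\<lambda>t. Yc (snd c (\<sigma> t))) has_vector_derivative k) (at 0)"
      and \<sigma>0: "\<sigma> 0 = m"
      if \<sigma>: "curve_with_velocity A m v \<sigma>" for \<sigma>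
    proof -
      \<comment> \<open>Near time 0 the curve has to stay where \<open>Y\<close> is tangent, where
        the chart is defined and where \<open>U m\<close> is specified.\<close>
      have "open {n. (m, n) \<in> D}" using open_vimage[OF D(2), of "Pair m"]
        by (simp add: vimage_def continuous_on_Pair continuous_on_const continuous_on_id)
      then have "open (N \<inter> fst c \<inter> {n. (m, n) \<in> D})" using N open_chart[OF c(1)] by auto
      then obtain W where "open W" "0 \<in> W" "\<And>t. t \<in> W \<Longrightarrow> \<sigma> t \<in> N \<inter> fst c \<inter> {n. (m, n) \<in> D}"
        using curve_near[OF \<sigma>, of "N \<inter> fst c \<inter> {n. (m, n) \<in> D}"] N(2) c(2) D(3) by blast
      then show "\<exists>W. open W \<and> 0 \<in> W \<and> (\<forall>t\<in>W. \<sigma> t \<in> N \<and> \<sigma> t \<in> fst c \<and> (m, \<sigma> t) \<in> D)"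
        by blast
      show \<zeta>: "((\<lambda>t. snd c (\<sigma> t)) has_vector_derivative v c) (at 0)" and \<sigma>0: "\<sigma> 0 = m"
        using \<sigma> c by (auto simp: curve_with_velocity_def)
      show "((\<lambda>t. Yc (snd c (\<sigma> t))) has_vector_derivative k) (at 0)"
        unfolding k_def using dY \<sigma>0 by (intro has_vector_derivative_chain_at[OF \<zeta>]) simp
    qed
    have 1: "dir_deriv A m v (\<lambda>n. \<alpha> n (Y n)) = dform \<alpha> c ?a (u c) (v c) + form_coord \<alpha> c ?a k"
    proof (rule dir_deriv_eqI[OF v])
      fix \<sigma> assume \<sigma>: "curve_with_velocity A m v \<sigma>"
      obtain W where W: "open W" "0 \<in> W" "\<And>t. t \<in> W \<Longrightarrow> \<sigma> t \<in> N \<and> \<sigma> t \<in> fst c"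
        using curve[OF \<sigma>] by blast
      have "((\<lambda>t. form_coord \<alpha> c (snd c (\<sigma> t)) (Yc (snd c (\<sigma> t)))) has_vector_derivative
          dform \<alpha> c (snd c (\<sigma> 0)) (Yc (snd c (\<sigma> 0))) (v c) + form_coord \<alpha> c (snd c (\<sigma> 0)) k) (at 0)"
        using a \<sigma>0[OF \<sigma>]
        by (intro has_vector_derivative_family[OF E open_chart_image[OF c(1)] _ _ _ \<zeta>[OF \<sigma>] \<eta>[OF \<sigma>]]
            form_coord_linear[OF \<alpha> c(1)] form_coord_differentiable[OF \<alpha> c(1)]) auto
      then have "((\<lambda>t. form_coord \<alpha> c (snd c (\<sigma> t)) (Yc (snd c (\<sigma> t)))) has_vector_derivative
          dform \<alpha> c ?a (u c) (v c) + form_coord \<alpha> c ?a k) (at 0)"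
        by (simp add: \<sigma>0[OF \<sigma>] Yca)
      then show "((\<lambda>t. \<alpha> (\<sigma> t) (Y (\<sigma> t))) has_vector_derivative
          dform \<alpha> c ?a (u c) (v c) + form_coord \<alpha> c ?a k) (at 0)"
      proof (rule has_vector_derivative_transform_within_open[OF _ W(1,2)])
        fix t assume "t \<in> W"
        then show "form_coord \<alpha> c (snd c (\<sigma> t)) (Yc (snd c (\<sigma> t))) = \<alpha> (\<sigma> t) (Y (\<sigma> t))"
          using W(3)[of t] form_coord[OF c(1), of "\<sigma> t" "Y (\<sigma> t)" \<alpha>] YN
          by (simp add: Yc_def chart_inv_chart[OF c(1)])
      qed
    qed
    let ?P = "dpar U c (?a, ?a) (u c) (0, v c)"
    have 2: "cov_deriv A U m v Y = toc c m (?P + k)"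
    proof
      fix d
      show "cov_deriv A U m v Y d = toc c m (?P + k) d"
      proof (cases "d \<in> A \<and> m \<in> fst d")
        case True
        let ?S = "{b. (?a, b) \<in> coord_domain D c c}"
        have S: "open ?S" using open_vimage[OF par_coord_open[OF U c(1)], of "Pair ?a"]
          by (simp add: vimage_def continuous_on_Pair continuous_on_const continuous_on_id)
        have der: "((\<lambda>b. par_coord U c (?a, b) e) has_derivative (\<lambda>h. dpar U c (?a, ?a) e (0, h))) (at ?a)" for e
        proof -
          have "((\<lambda>b. (?a, b)) has_derivative (\<lambda>h. (0, h))) (at ?a)" by (auto intro!: derivative_eq_intros)
          from has_derivative_compose[OF this par_coord_has_derivative[OF U c(1) aa]] show ?thesis .
        qed
        \<comment> \<open>All transported vectors lie in \<open>TM m\<close>, so their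
          \<open>d\<close>-coordinates are the image of their \<open>c\<close>-coordinates under the
          fixed linear map \<open>dtrans c d m\<close>; the derivative is computed in
          \<open>c\<close> and then mapped.\<close>
        have "dir_deriv A m v (\<lambda>n. U m n (Y n) d) = dtrans c d m (?P + k)"
        proof (rule dir_deriv_eqI[OF v])
          fix \<sigma> assume \<sigma>: "curve_with_velocity A m v \<sigma>"
          obtain W where W: "open W" "0 \<in> W"
            "\<And>t. t \<in> W \<Longrightarrow> \<sigma> t \<in> N \<and> \<sigma> t \<in> fst c \<and> (m, \<sigma> t) \<in> D"
            using curve[OF \<sigma>] by blast
          have "((\<lambda>t. par_coord U c (?a, snd c (\<sigma> t)) (Yc (snd c (\<sigma> t)))) has_vector_derivative
            frechet_derivative (\<lambda>b. par_coord U c (?a, b) (Yc (snd c (\<sigma> 0)))) (at (snd c (\<sigma> 0))) (v c)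
              + par_coord U c (?a, snd c (\<sigma> 0)) k) (at 0)"
            using aa \<sigma>0[OF \<sigma>] par_coord_linear[OF U c(1)] der
            by (intro has_vector_derivative_family[OF E S _ _ _ \<zeta>[OF \<sigma>] \<eta>[OF \<sigma>]])
               (auto simp: differentiable_def)
          then have "((\<lambda>t. par_coord U c (?a, snd c (\<sigma> t)) (Yc (snd c (\<sigma> t)))) has_vector_derivative ?P + k) (at 0)"
            using fun_cong[OF frechet_derivative_at[OF der[of "u c"]], of "v c"]
            by (simp add: \<sigma>0[OF \<sigma>] Yca par_coord_diag[OF U c(1) a])
          then have "((\<lambda>t. dtrans c d m (par_coord U c (?a, snd c (\<sigma> t)) (Yc (snd c (\<sigma> t)))))
              has_vector_derivative dtrans c d m (?P + k)) (at 0)"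
            by (rule bounded_linear.has_vector_derivative[OF
                linear_imp_bounded_linear_basis[OF E linear_dtrans], rotated 4]) (use c True in auto)
          then show "((\<lambda>t. U m (\<sigma> t) (Y (\<sigma> t)) d) has_vector_derivative dtrans c d m (?P + k)) (at 0)"
          proof (rule has_vector_derivative_transform_within_open[OF _ W(1,2)])
            fix t assume t: "t \<in> W"
            have n: "(m, \<sigma> t) \<in> D" "\<sigma> t \<in> fst c" "Y (\<sigma> t) \<in> TM (\<sigma> t)" using W(3)[OF t] YN by auto
            note p = par_coord[OF U n(1) c n(2,3)]
            have "toc c m (U m (\<sigma> t) (Y (\<sigma> t)) c) d = U m (\<sigma> t) (Y (\<sigma> t)) d"
              by (simp only: tangent_of_coord_coord[OF c p(2)])
            then show "dtrans c d m (par_coord U c (?a, snd c (\<sigma> t)) (Yc (snd c (\<sigma> t)))) = U m (\<sigma> t) (Y (\<sigma> t)) d"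
              using True by (simp add: p(1) tangent_of_coord_def Yc_def chart_inv_chart[OF c(1) n(2)])
          qed
        qed
        then show ?thesis using True by (simp add: cov_deriv_def tangent_of_coord_def)
      qed (simp only: cov_deriv_def tangent_of_coord_def if_False)
    qed
    have "\<alpha> m (cov_deriv A U m v Y) = form_coord \<alpha> c ?a (?P + k)"
      using form_coord[OF c tangent_of_coord_in[OF c], of \<alpha>] 2 by (simp add: tangent_of_coord_self[OF c])
    then show ?thesis using 1 linear_add[OF form_coord_linear[OF \<alpha> c(1) a]] by simp
  qed
  show ?thesis unfolding cov_deriv_form_def
  proof (rule the_equality)
    fix z assume z: "\<forall>Y. vector_field_near A m Y \<and> Y m = u \<longrightarrow>
      dir_deriv A m v (\<lambda>n. \<alpha> n (Y n)) = z + \<alpha> m (cov_deriv A U m v Y)"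
    have Y: "vector_field_near A m (\<lambda>n. toc c n (u c))" "toc c m (u c) = u"
      using vector_field_near_const[OF c] tangent_of_coord_coord[OF c u] by auto
    show "z = ?z" using *[OF Y] z[rule_format, OF conjI[OF Y]] by simp
  qed (use * in blast)
qed

text \<open>The direction \<open>f\<close> comes first, the argument \<open>e\<close> second. The
  derivative of \<open>U\<close> in its source point, taken on the diagonal, is the Christoffel
  term.\<close>

definition cov_coord where
  "cov_coord U \<alpha> c a f e = dform \<alpha> c a e f - form_coord \<alpha> c a (dpar U c (a, a) e (0, f))"

lemma linear_cov_coord:
  assumes \<alpha>: "\<alpha> \<in> one_forms A" and U: "parallelism A D U" and c: "c \<in> A" "a \<in> chart_image c"
  shows "linear (cov_coord U \<alpha> c a f)" and "linear (\<lambda>f. cov_coord U \<alpha> c a f e)"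
proof -
  have "diagonal_domain D" using U by (simp add: parallelism_def)
  then have aa: "(a, a) \<in> coord_domain D c c" using c(2) by (rule coord_domain_diag)
  note F = form_coord_linear[OF \<alpha> c]
  have par_diff: "(\<lambda>z. par_coord U c z e) differentiable (at (a, a))" for e
    using par_coord_has_derivative[OF U c(1) aa] by (auto simp: differentiable_def)
  have "linear (\<lambda>e. dpar U c (a, a) e (0, f))"
    by (rule linear_frechet_derivative_parameter[OF par_coord_open[OF U c(1)] aa par_coord_linear[OF U c(1)] par_diff])
  from linear_compose[OF this F]
  have "linear (\<lambda>e. form_coord \<alpha> c a (dpar U c (a, a) e (0, f)))" by (simp add: o_def)
  moreover have "linear (\<lambda>e. dform \<alpha> c a e f)"
    by (rule linear_frechet_derivative_parameter[OF open_chart_image[OF c(1)] c(2)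
          form_coord_linear[OF \<alpha> c(1)] form_coord_differentiable[OF \<alpha> c]])
  ultimately show "linear (cov_coord U \<alpha> c a f)"
    unfolding cov_coord_def by (intro linear_compose_sub)
  have "linear (\<lambda>f :: 'e. (0 :: 'e, f))" by (intro linearI) auto
  from linear_compose[OF linear_compose[OF this linear_frechet_derivative[OF par_diff]] F]
  have "linear (\<lambda>f. form_coord \<alpha> c a (dpar U c (a, a) e (0, f)))" by (simp add: o_def)
  then show "linear (\<lambda>f. cov_coord U \<alpha> c a f e)"
    unfolding cov_coord_def
    by (intro linear_compose_sub linear_frechet_derivative form_coord_differentiable[OF \<alpha> c])
qed

lemma cov_deriv_form_eq_cov_coord:
  assumes "\<alpha> \<in> one_forms A" "parallelism A D U" "c \<in> A" "m \<in> fst c" "v \<in> TM m" "u \<in> TM m"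
  shows "cov_deriv_form A U \<alpha> m v u = cov_coord U \<alpha> c (snd c m) (v c) (u c)"
  unfolding cov_coord_def by (rule cov_deriv_form_coord[OF assms])

text \<open>A definite description shows no linearity by itself; it is read off the coordinate
  formula in any chart around \<open>m\<close>.\<close>

lemma linear_cov_deriv_form:
  assumes \<alpha>: "\<alpha> \<in> one_forms A" and U: "parallelism A D U"
  shows "v \<in> TM m \<Longrightarrow> linear_map_on (TM m) (cov_deriv_form A U \<alpha> m v)"
    and "u \<in> TM m \<Longrightarrow> linear_map_on (TM m) (\<lambda>v. cov_deriv_form A U \<alpha> m v u)"
proof -
  obtain c where c: "c \<in> A" "m \<in> fst c" using ex_chart .
  note eq = cov_deriv_form_eq_cov_coord[OF \<alpha> U c]
  note lin = linear_cov_coord[OF \<alpha> U c(1) chart_in_image[OF c]]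
  have scaleR_apply: "(r *\<^sub>R w) d = r *\<^sub>R w d" for r d and w :: "('m, 'e) tangent"
    by (simp add: scaleR_fun_def)
  show "linear_map_on (TM m) (cov_deriv_form A U \<alpha> m v)" if "v \<in> TM m"
    unfolding linear_map_on_def
    by (simp add: eq that tangent_space_add tangent_space_scaleR scaleR_apply
        linear_add[OF lin(1)] linear_cmul[OF lin(1)])
  show "linear_map_on (TM m) (\<lambda>v. cov_deriv_form A U \<alpha> m v u)" if "u \<in> TM m"
    unfolding linear_map_on_def
    by (simp add: eq that tangent_space_add tangent_space_scaleR scaleR_apply
        linear_add[OF lin(2)] linear_cmul[OF lin(2)])
qed

section \<open>Estimates in a chart\<close>

text \<open>\<open>sqrt\<close> is negative at negative arguments, so positivity of the metric is
  needed; the zero vector, left out by strict positivity, is settled by linearity.\<close>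

lemma tnorm_nonneg:
  assumes "riemannian_metric A g" "v \<in> TM m"
  shows "0 \<le> tnorm g m v"
proof -
  have lin: "linear_map_on (TM m) (g m v)" and "v \<noteq> 0 \<Longrightarrow> 0 < g m v v"
    using assms unfolding riemannian_metric_def by blast+
  moreover have "g m v (0 *\<^sub>R v) = 0 *\<^sub>R g m v v"
    using lin assms(2) unfolding linear_map_on_def by blast
  then have "v = 0 \<Longrightarrow> g m v v = 0" by (simp add: scaleR_fun_def zero_fun_def)
  ultimately show ?thesis unfolding tnorm_def by fastforce
qed

text \<open>In coordinates the metric is a continuous family of positive definite forms; a lower
  bound \<open>k\<close> on it, uniform near the point, yields the constant
  \<open>1 / sqrt k\<close>.\<close>

lemma coord_le_tnorm:
  assumes g: "riemannian_metric A g" and c: "c \<in> A" "m \<in> fst c"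
  shows "\<exists>\<epsilon>>0. \<exists>K\<ge>0. \<forall>n\<in>fst c. snd c n \<in> ball (snd c m) \<epsilon> \<longrightarrow>
    (\<forall>v\<in>TM n. norm (v c) \<le> K * tnorm g n v)"
proof -
  obtain E :: "'e set" where E: "orthonormal_basis E" using model_basis .
  let ?toc = "\<lambda>a. toc c (chart_inv c a)"
  define q where "q a e e' = g (chart_inv c a) (?toc a e) (?toc a e')" for a e e'
  have tin: "?toc a e \<in> TM (chart_inv c a)" if "a \<in> chart_image c" for a e
    using tangent_of_coord_in[OF c(1) chart_inv_in[OF c(1) that]] .
  have lin: "linear (q a e)" if "a \<in> chart_image c" for a e
  proof -
    have "linear_map_on (TM (chart_inv c a)) (g (chart_inv c a) (?toc a e))"
      using g tin[OF that] unfolding riemannian_metric_def by blast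
    from linear_map_on_coord[OF c(1) chart_inv_in[OF c(1) that] this]
    show ?thesis unfolding q_def .
  qed
  have sym: "q a e e' = q a e' e" if "a \<in> chart_image c" for a e e'
    using g tin[OF that] unfolding riemannian_metric_def q_def by blast
  have "\<exists>\<epsilon>>0. \<exists>k>0. \<forall>a\<in>ball (snd c m) \<epsilon>. a \<in> chart_image c \<and> (\<forall>e. k * (norm e)\<^sup>2 \<le> q a e e)"
  proof (rule posdef_lower_bound[OF E open_chart_image[OF c(1)] chart_in_image[OF c] lin])
    show "linear (\<lambda>e'. q a e' e)" if "a \<in> chart_image c" for a e
      using lin[OF that, of e] sym[OF that, of _ e] by simp
    have "Ck_on 0 (chart_image c) (\<lambda>a. q a e e')" for e e'
      using g c(1) unfolding riemannian_metric_def smooth_on_def q_def by blast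
    then show "continuous_on (chart_image c) (\<lambda>a. q a e e')" for e e' by simp
    fix e :: 'e assume e: "e \<noteq> 0"
    let ?a = "snd c m"
    have "?toc ?a e \<noteq> 0"
    proof
      assume "?toc ?a e = 0"
      then have "?toc ?a e c = 0" by simp
      then show False using e tangent_of_coord_self[OF c] by (simp add: chart_inv_chart c)
    qed
    then show "0 < q ?a e e"
      using g tin[OF chart_in_image[OF c]] unfolding riemannian_metric_def q_def by blast
  qed
  then obtain \<epsilon> k where \<epsilon>: "\<epsilon> > 0" "k > 0"
    "\<And>a e. a \<in> ball (snd c m) \<epsilon> \<Longrightarrow> k * (norm e)\<^sup>2 \<le> q a e e" by blast
  have "norm (v c) \<le> 1 / sqrt k * tnorm g n v"
    if n: "n \<in> fst c" "snd c n \<in> ball (snd c m) \<epsilon>" and v: "v \<in> TM n" for n v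
  proof -
    have "k * (norm (v c))\<^sup>2 \<le> g n v v"
      using \<epsilon>(3)[OF n(2), of "v c"] n v c
      by (simp add: q_def chart_inv_chart tangent_of_coord_coord)
    then have "sqrt (k * (norm (v c))\<^sup>2) \<le> tnorm g n v" unfolding tnorm_def by (rule real_sqrt_le_mono)
    then show ?thesis using \<epsilon>(2) by (simp add: real_sqrt_mult field_simps)
  qed
  then show ?thesis using \<epsilon>(1,2) by (intro exI[of _ \<epsilon>] conjI exI[of _ "1 / sqrt k"]) auto
qed

text \<open>In the second estimate the derivative in the first argument of \<open>U\<close> has been replaced by
  minus the one in the second, by \<open>dpar_diag\<close>.\<close>

lemma par_coord_estimates:
  assumes U: "parallelism A D U" and c: "c \<in> A" "a0 \<in> chart_image c"
  shows "\<exists>\<epsilon>>0. \<exists>C\<ge>0. \<forall>a\<in>ball a0 \<epsilon>. \<forall>b\<in>ball a0 \<epsilon>. (a, b) \<in> coord_domain D c c \<and>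
    (\<forall>e. norm (par_coord U c (b, a) e - e) \<le> C * norm (b - a) * norm e) \<and>
    (\<forall>e. norm (par_coord U c (b, a) e - e + dpar U c (a, a) e (0, b - a)) \<le> C * (norm (b - a))\<^sup>2 * norm e) \<and>
    (\<forall>h e. norm (dpar U c (a, a) e (0, h)) \<le> C * norm h * norm e) \<and>
    (\<forall>h e. norm (dpar U c (b, b) e (0, h) - dpar U c (a, a) e (0, h)) \<le> C * norm (b - a) * norm h * norm e)"
proof -
  obtain E :: "'e set" where E: "orthonormal_basis E" using model_basis .
  have D: "diagonal_domain D" using U by (simp add: parallelism_def)
  let ?f = "par_coord U c" and ?D = "\<lambda>z e. dpar U c z e"
  obtain \<epsilon> C where \<epsilon>: "\<epsilon> > 0" "C \<ge> 0" and
    est: "\<forall>x\<in>ball (a0, a0) \<epsilon>. \<forall>y\<in>ball (a0, a0) \<epsilon>. x \<in> coord_domain D c c \<and>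
      (\<forall>e. norm (?f x e) \<le> C * norm e) \<and>
      (\<forall>e. norm (?f y e - ?f x e) \<le> C * norm (y - x) * norm e) \<and>
      (\<forall>h e. norm (?D x e h) \<le> C * norm h * norm e) \<and>
      (\<forall>h e. norm (?D y e h - ?D x e h) \<le> C * norm (y - x) * norm h * norm e) \<and>
      (\<forall>e. norm (?f y e - ?f x e - ?D x e (y - x)) \<le> C * (norm (y - x))\<^sup>2 * norm e)"
    using C2_family_estimates[OF orthonormal_basis_Times[OF E E] E par_coord_open[OF U c(1)]
        coord_domain_diag[OF D c(2)] par_coord_linear[OF U c(1)] par_coord_Ck[OF U c(1)]] by blast
  have "(a, b) \<in> coord_domain D c c \<and>
    (\<forall>e. norm (?f (b, a) e - e) \<le> 2 * C * norm (b - a) * norm e) \<and>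
    (\<forall>e. norm (?f (b, a) e - e + ?D (a, a) e (0, b - a)) \<le> 2 * C * (norm (b - a))\<^sup>2 * norm e) \<and>
    (\<forall>h e. norm (?D (a, a) e (0, h)) \<le> 2 * C * norm h * norm e) \<and>
    (\<forall>h e. norm (?D (b, b) e (0, h) - ?D (a, a) e (0, h)) \<le> 2 * C * norm (b - a) * norm h * norm e)"
    if ab: "a \<in> ball a0 (\<epsilon> / 2)" "b \<in> ball a0 (\<epsilon> / 2)" for a b
  proof -
    \<comment> \<open>Half the radius suffices because the product norm is at most the sum of the
      norms of the two components.\<close>
    have inball: "(a1, a2) \<in> ball (a0, a0) \<epsilon>" if "a1 \<in> ball a0 (\<epsilon> / 2)" "a2 \<in> ball a0 (\<epsilon> / 2)" for a1 a2
    proof -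
      have "dist (a0, a0) (a1, a2) \<le> dist a0 a1 + dist a0 a2"
        using norm_Pair_le[of "a0 - a1" "a0 - a2"] by (simp add: dist_norm)
      then show ?thesis using that by auto
    qed
    note in1 = inball[OF ab(1) ab(1)] and in2 = inball[OF ab(1) ab(2)]
      and in3 = inball[OF ab(2) ab(1)] and in4 = inball[OF ab(2) ab(2)]
    have "(a, a) \<in> coord_domain D c c" using est in1 by blast
    then have ai: "a \<in> chart_image c" by (simp add: coord_domain_def)
    have fa: "?f (a, a) e = e" for e using par_coord_diag[OF U c(1) ai] .
    have n1: "norm ((b, a) - (a, a)) = norm (b - a)" by (simp add: norm_Pair)
    \<comment> \<open>Moving both points at once can double the step; this is the origin of the
      constant \<open>2 * C\<close>, to which the other estimates are weakened.\<close>
    have n2: "norm ((b, b) - (a, a)) \<le> 2 * norm (b - a)"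
      using norm_Pair_le[of "b - a" "b - a"] by simp
    have n3: "norm (0 :: 'e, h) = norm h" for h :: 'e by (simp add: norm_Pair)
    have "C \<le> 2 * C" using \<epsilon>(2) by simp
    then have weaken: "N \<le> 2 * C * r * r'" if "N \<le> C * r * r'" "0 \<le> r" "0 \<le> r'" for N r r'
    proof -
      have "C * r * r' \<le> 2 * C * r * r'" using \<open>C \<le> 2 * C\<close> that by (intro mult_right_mono)
      then show ?thesis using that(1) by linarith
    qed
    have "?D (a, a) e (0, b - a) = ?D (a, a) e (- (b - a), 0)" for e
      using dpar_diag[OF U c(1) ai, of e 0 "b - a"] by simp
    moreover have linD: "linear (?D (a, a) e)" for e
      using has_derivative_linear[OF par_coord_has_derivative[OF U c(1)]] est in1 by blast
    ultimately have neg: "?D (a, a) e (0, b - a) = - ?D (a, a) e (b - a, 0)" for e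
      using linear_neg[OF linD, of e "(b - a, 0)"] by simp
    have 0: "(a, b) \<in> coord_domain D c c" using est in2 by blast
    have 1: "norm (?f (b, a) e - e) \<le> C * norm (b - a) * norm e" for e
    proof -
      have "norm (?f (b, a) e - ?f (a, a) e) \<le> C * norm ((b, a) - (a, a)) * norm e"
        using est in1 in3 by blast
      then show ?thesis by (simp only: fa n1)
    qed
    have 2: "norm (?f (b, a) e - e + ?D (a, a) e (0, b - a)) \<le> C * (norm (b - a))\<^sup>2 * norm e" for e
    proof -
      have "norm (?f (b, a) e - ?f (a, a) e - ?D (a, a) e ((b, a) - (a, a))) \<le> C * (norm ((b, a) - (a, a)))\<^sup>2 * norm e"
        using est in1 in3 by blast
      then have "norm (?f (b, a) e - e - ?D (a, a) e ((b, a) - (a, a))) \<le> C * (norm (b - a))\<^sup>2 * norm e"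
        by (simp only: fa n1)
      then show ?thesis by (simp add: neg)
    qed
    have 3: "norm (?D (a, a) e (0, h)) \<le> C * norm h * norm e" for h e
    proof -
      have "norm (?D (a, a) e (0, h)) \<le> C * norm (0 :: 'e, h) * norm e" using est in1 by blast
      then show ?thesis by (simp only: n3)
    qed
    have 4: "norm (?D (b, b) e (0, h) - ?D (a, a) e (0, h)) \<le> 2 * C * norm (b - a) * norm h * norm e" for h e
    proof -
      have "norm (?D (b, b) e (0, h) - ?D (a, a) e (0, h)) \<le> C * norm ((b, b) - (a, a)) * norm (0 :: 'e, h) * norm e"
        using est in1 in4 by blast
      also have "\<dots> \<le> C * (2 * norm (b - a)) * norm (0 :: 'e, h) * norm e"
        by (intro mult_right_mono mult_left_mono n2 \<epsilon>(2) norm_ge_zero)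
      finally show ?thesis by (simp add: n3)
    qed
    show ?thesis
      by (intro conjI allI 0 4 weaken[OF 1] weaken[OF 2] weaken[OF 3] norm_ge_zero zero_le_power)
  qed
  then show ?thesis using \<epsilon> by (intro exI[of _ "\<epsilon> / 2"] conjI exI[of _ "2 * C"]) auto
qed

text \<open>Taylor expansion of \<open>\<psi>\<close> as a function of both points, so that the
  constant is uniform in the base point. At \<open>(a, a)\<close> the value is 0 and the derivative
  in the second point is the identity, which leaves \<open>b - a\<close>.\<close>

lemma logarithm_estimate:
  assumes \<psi>: "logarithm A D \<psi>" and c: "c \<in> A" "a0 \<in> chart_image c"
  shows "\<exists>\<epsilon>>0. \<exists>C\<ge>0. \<forall>a\<in>ball a0 \<epsilon>. \<forall>b\<in>ball a0 \<epsilon>.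
    norm (\<psi> (chart_inv c a) (chart_inv c b) c - (b - a)) \<le> C * (norm (b - a))\<^sup>2"
proof -
  obtain E :: "'e set" where E: "orthonormal_basis E" using model_basis .
  define f where "f z = \<psi> (chart_inv c (fst z)) (chart_inv c (snd z)) c" for z
  let ?S = "coord_domain D c c" and ?f' = "\<lambda>z. frechet_derivative f (at z)"
  have D: "diagonal_domain D" using \<psi> by (simp add: logarithm_def)
  then have S: "open ?S" "(a0, a0) \<in> ?S"
    using open_coord_domain[OF c(1)] coord_domain_diag[OF _ c(2)] by (auto simp: diagonal_domain_def)
  have Ck: "Ck_on n ?S f" for n
    using \<psi> c(1) unfolding logarithm_def smooth_on_def f_def case_prod_unfold by blast
  obtain \<epsilon> C where \<epsilon>: "\<epsilon> > 0" "C \<ge> 0" and est: "\<forall>x\<in>ball (a0, a0) \<epsilon>. \<forall>y\<in>ball (a0, a0) \<epsilon>. x \<in> ?S \<and>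
    norm (f y - f x - ?f' x (y - x)) \<le> C * (norm (y - x))\<^sup>2"
    using C2_local_estimates[OF orthonormal_basis_Times[OF E E] S Ck] by blast
  have "norm (f (a, b) - (b - a)) \<le> C * (norm (b - a))\<^sup>2"
    if ab: "a \<in> ball a0 (\<epsilon> / 2)" "b \<in> ball a0 (\<epsilon> / 2)" for a b
  proof -
    have inball: "(a1, a2) \<in> ball (a0, a0) \<epsilon>" if "a1 \<in> ball a0 (\<epsilon> / 2)" "a2 \<in> ball a0 (\<epsilon> / 2)" for a1 a2
    proof -
      have "dist (a0, a0) (a1, a2) \<le> dist a0 a1 + dist a0 a2"
        using norm_Pair_le[of "a0 - a1" "a0 - a2"] by (simp add: dist_norm)
      then show ?thesis using that by auto
    qed
    note in1 = inball[OF ab(1) ab(1)] and in2 = inball[OF ab(1) ab(2)]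
    have aS: "(a, a) \<in> ?S" using est in1 by blast
    then have a: "a \<in> chart_image c" by (simp add: coord_domain_def)
    have f0: "f (a, a) = 0" using \<psi> by (simp add: f_def logarithm_def)
    have "((\<lambda>b. (a, b)) has_derivative (\<lambda>h. (0, h))) (at a)" by (auto intro!: derivative_eq_intros)
    from has_derivative_compose[OF this Ck_on_has_derivative[OF Ck aS]]
    have d1: "((\<lambda>b. f (a, b)) has_derivative (\<lambda>h. ?f' (a, a) (0, h))) (at a)" .
    have "((\<lambda>b. \<psi> (chart_inv c a) (chart_inv c b) c) has_derivative (\<lambda>e. e)) (at (snd c (chart_inv c a)))"
      using \<psi> c(1) chart_inv_in[OF c(1) a] unfolding logarithm_def by blast
    then have d2: "((\<lambda>b. f (a, b)) has_derivative (\<lambda>e. e)) (at a)"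
      by (simp add: f_def chart_chart_inv[OF c(1) a])
    have f': "?f' (a, a) (0, h) = h" for h using fun_cong[OF has_derivative_unique[OF d1 d2], of h] .
    have "norm (f (a, b) - f (a, a) - ?f' (a, a) ((a, b) - (a, a))) \<le> C * (norm ((a, b) - (a, a)))\<^sup>2"
      using est in1 in2 by blast
    then show ?thesis by (simp add: f0 f' norm_Pair)
  qed
  then show ?thesis using \<epsilon> unfolding f_def by (intro exI[of _ "\<epsilon> / 2"] conjI exI[of _ C]) auto
qed

text \<open>\<open>P\<close>, \<open>f\<close> and \<open>f'\<close> are free: along the path they
  become the coordinates of \<open>y' s (x t - x s)\<close>, \<open>y' s w\<close> and
  \<open>y' t w\<close>. The analysis of \<alpha> and \<open>U\<close> is thereby kept apart from
  the path, which enters only through the sizes of \<open>b - a\<close>, \<open>b - a - P\<close>,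
  \<open>f\<close>, \<open>f'\<close> and \<open>f' - f\<close>.\<close>

lemma form_local_estimates:
  fixes \<alpha> :: "'m \<Rightarrow> ('m, 'e) tangent \<Rightarrow> 'v::real_normed_vector"
  assumes \<alpha>: "\<alpha> \<in> one_forms A" and U: "parallelism A D U" and c: "c \<in> A" "a0 \<in> chart_image c"
  shows "\<exists>\<epsilon>>0. \<exists>C\<ge>0. \<forall>a\<in>ball a0 \<epsilon>. \<forall>b\<in>ball a0 \<epsilon>. (b, a) \<in> coord_domain D c c \<and>
    (\<forall>P e. norm (form_coord \<alpha> c b (par_coord U c (b, a) e) - form_coord \<alpha> c a e - cov_coord U \<alpha> c a P e)
        \<le> C * ((norm (b - a))\<^sup>2 + norm (b - a - P)) * norm e) \<and>
    (\<forall>f f' e. norm (cov_coord U \<alpha> c b f' (par_coord U c (b, a) e) - cov_coord U \<alpha> c a f e)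
        \<le> C * (norm (b - a) * (norm f + norm f') + norm (f' - f)) * norm e)"
proof -
  obtain E :: "'e set" where E: "orthonormal_basis E" using model_basis .
  let ?F = "form_coord \<alpha> c" and ?D = "\<lambda>a e f. dform \<alpha> c a e f" and ?Q = "\<lambda>a e f. dpar U c (a, a) e (0, f)"
  let ?N = "cov_coord U \<alpha> c" and ?p = "\<lambda>a b e. par_coord U c (b, a) e"
  obtain \<epsilon>1 C where \<epsilon>1: "\<epsilon>1 > 0" "C \<ge> 0" and F: "\<forall>a\<in>ball a0 \<epsilon>1. \<forall>b\<in>ball a0 \<epsilon>1. a \<in> chart_image c \<and>
    (\<forall>e. norm (?F a e) \<le> C * norm e) \<and>
    (\<forall>e. norm (?F b e - ?F a e) \<le> C * norm (b - a) * norm e) \<and>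
    (\<forall>h e. norm (?D a e h) \<le> C * norm h * norm e) \<and>
    (\<forall>h e. norm (?D b e h - ?D a e h) \<le> C * norm (b - a) * norm h * norm e) \<and>
    (\<forall>e. norm (?F b e - ?F a e - ?D a e (b - a)) \<le> C * (norm (b - a))\<^sup>2 * norm e)"
    using C2_family_estimates[OF E E open_chart_image[OF c(1)] c(2) form_coord_linear[OF \<alpha> c(1)]
        form_coord_Ck[OF \<alpha> c(1)]] by blast
  obtain \<epsilon>2 K where \<epsilon>2: "\<epsilon>2 > 0" "K \<ge> 0" and P: "\<forall>a\<in>ball a0 \<epsilon>2. \<forall>b\<in>ball a0 \<epsilon>2. (a, b) \<in> coord_domain D c c \<and>
    (\<forall>e. norm (?p a b e - e) \<le> K * norm (b - a) * norm e) \<and>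
    (\<forall>e. norm (?p a b e - e + ?Q a e (b - a)) \<le> K * (norm (b - a))\<^sup>2 * norm e) \<and>
    (\<forall>h e. norm (?Q a e h) \<le> K * norm h * norm e) \<and>
    (\<forall>h e. norm (?Q b e h - ?Q a e h) \<le> K * norm (b - a) * norm h * norm e)"
    using par_coord_estimates[OF U c] by blast
  define \<epsilon> where "\<epsilon> = min \<epsilon>1 \<epsilon>2"
  \<comment> \<open>\<open>C * (1 + K)\<close> bounds the bilinear map \<open>?N\<close>; the factor
    \<open>2 + K\<close> makes all coefficients nonnegative in the differences that conclude the two
    estimates.\<close>
  define M where "M = C * (1 + K) * (2 + K)"
  have CK: "0 \<le> C * K" "0 \<le> C * K * K" using \<epsilon>1 \<epsilon>2 by simp_all
  have main: "(b, a) \<in> coord_domain D c c"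
      "norm (?F b (?p a b e) - ?F a e - ?N a P e) \<le> M * ((norm (b - a))\<^sup>2 + norm (b - a - P)) * norm e"
      "norm (?N b f' (?p a b e) - ?N a f e) \<le> M * (norm (b - a) * (norm f + norm f') + norm (f' - f)) * norm e"
    if "a \<in> ball a0 \<epsilon>" "b \<in> ball a0 \<epsilon>" for a b P e f f'
  proof -
    have in1: "a \<in> ball a0 \<epsilon>1" "b \<in> ball a0 \<epsilon>1" and in2: "a \<in> ball a0 \<epsilon>2" "b \<in> ball a0 \<epsilon>2"
      using that by (auto simp: \<epsilon>_def)
    have ai: "a \<in> chart_image c" and bi: "b \<in> chart_image c" using F in1 by blast+
    note lF = form_coord_linear[OF \<alpha> c(1)] and lN = linear_cov_coord[OF \<alpha> U c(1)]
    show "(b, a) \<in> coord_domain D c c" using P in2 by blast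
    define h where "h = b - a"
    define d where "d = ?p a b e - e"
    have F1: "norm (?F a e) \<le> C * norm e" "norm (?F b e) \<le> C * norm e" for e using F in1 by blast+
    have F2: "norm (?F b e - ?F a e) \<le> C * norm h * norm e" for e using F in1 unfolding h_def by blast
    have F3: "norm (?D a e x) \<le> C * norm x * norm e" "norm (?D b e x) \<le> C * norm x * norm e" for e x using F in1 by blast+
    have F4: "norm (?D b e x - ?D a e x) \<le> C * norm h * norm x * norm e" for e x using F in1 unfolding h_def by blast
    have F5: "norm (?F b e - ?F a e - ?D a e h) \<le> C * (norm h)\<^sup>2 * norm e" for e using F in1 unfolding h_def by blast
    have P1: "norm d \<le> K * norm h * norm e" using P in2 unfolding d_def h_def by blast
    have P2: "norm (d + ?Q a e h) \<le> K * (norm h)\<^sup>2 * norm e" using P in2 unfolding d_def h_def by blast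
    have P3: "norm (?Q a e x) \<le> K * norm x * norm e" "norm (?Q b e x) \<le> K * norm x * norm e" for e x using P in2 by blast+
    have P4: "norm (?Q b e x - ?Q a e x) \<le> K * norm h * norm x * norm e" for e x using P in2 unfolding h_def by blast
    have FQ: "norm (?F a u) \<le> C * r" "norm (?F b u) \<le> C * r" if "norm u \<le> r" for u r
      using F1[of u] mult_left_mono[OF that \<epsilon>1(2)] by linarith+
    have FQ': "norm (?F b u - ?F a u) \<le> C * norm h * r" if "norm u \<le> r" for u r
      using F2[of u] mult_left_mono[OF that, of "C * norm h"] \<epsilon>1(2) by simp
    have dlin: "?D a e (h - P) = ?D a e h - ?D a e P"
      by (rule linear_diff[OF linear_frechet_derivative[OF form_coord_differentiable[OF \<alpha> c(1) ai]]])
    have Nlin: "?N a (h - P) e = ?N a h e - ?N a P e" by (rule linear_diff[OF lN(2)[OF ai]])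
    have Nbd: "norm (?N b x u) \<le> C * (1 + K) * norm x * norm u" "norm (?N a x u) \<le> C * (1 + K) * norm x * norm u" for x u
      unfolding cov_coord_def
      using norm_triangle_ineq4[of "?D b u x" "?F b (?Q b u x)"] F3(2)[of u x] FQ(2)[OF P3(2)[of u x]]
        norm_triangle_ineq4[of "?D a u x" "?F a (?Q a u x)"] F3(1)[of u x] FQ(1)[OF P3(1)[of u x]]
      by (simp_all add: algebra_simps)
    \<comment> \<open>Four errors: the Taylor remainder of the form, its variation acting on the
      small vector \<open>d\<close>, the second order error of the parallelism, and the replacement
      of \<open>h\<close> by \<open>P\<close>. The first order terms recombine to
      \<open>?N a h e\<close>.\<close>
    have "?F b (?p a b e) = ?F b e + ?F b d"
      using linear_add[OF lF[OF bi], of e d] by (simp add: d_def)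
    moreover have "?F a (d + ?Q a e h) = ?F a d + ?F a (?Q a e h)" by (rule linear_add[OF lF[OF ai]])
    ultimately have "?F b (?p a b e) - ?F a e - ?N a P e =
        (?F b e - ?F a e - ?D a e h) + (?F b d - ?F a d) + ?F a (d + ?Q a e h) + ?N a (h - P) e"
      unfolding Nlin unfolding cov_coord_def by simp
    also have "norm \<dots> \<le> C * (norm h)\<^sup>2 * norm e + C * norm h * (K * norm h * norm e)
        + C * (K * (norm h)\<^sup>2 * norm e) + C * (1 + K) * norm (h - P) * norm e"
      by (intro norm_triangle_mono F5 FQ'[OF P1] FQ(1)[OF P2] Nbd)
    also have "\<dots> \<le> M * ((norm h)\<^sup>2 + norm (h - P)) * norm e"
    proof -
      have "M * ((norm h)\<^sup>2 + norm (h - P)) * norm e - (C * (norm h)\<^sup>2 * norm e + C * norm h * (K * norm h * norm e)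
        + C * (K * (norm h)\<^sup>2 * norm e) + C * (1 + K) * norm (h - P) * norm e) =
        (C + C * K + C * K * K) * (norm h)\<^sup>2 * norm e + (C + 2 * (C * K) + C * K * K) * norm (h - P) * norm e"
        by (simp add: M_def algebra_simps power2_eq_square)
      also have "\<dots> \<ge> 0" using CK \<epsilon>1(2) by simp
      finally show ?thesis by simp
    qed
    finally show "norm (?F b (?p a b e) - ?F a e - ?N a P e) \<le> M * ((norm (b - a))\<^sup>2 + norm (b - a - P)) * norm e"
      unfolding h_def .
    have "norm (?F b (?Q b e f) - ?F a (?Q a e f)) \<le> C * norm h * (K * norm f * norm e) + C * (K * norm h * norm f * norm e)"
    proof -
      have "?F b (?Q b e f) - ?F a (?Q a e f) = (?F b (?Q b e f) - ?F a (?Q b e f)) + ?F a (?Q b e f - ?Q a e f)"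
        by (simp add: linear_diff[OF lF[OF ai]])
      also have "norm \<dots> \<le> C * norm h * (K * norm f * norm e) + C * (K * norm h * norm f * norm e)"
        by (intro norm_triangle_mono FQ'[OF P3(2)] FQ(1)[OF P4])
      finally show ?thesis .
    qed
    note FQd = this
    have "?N b f e - ?N a f e = (?D b e f - ?D a e f) - (?F b (?Q b e f) - ?F a (?Q a e f))"
      by (simp add: cov_coord_def)
    then have Nd: "norm (?N b f e - ?N a f e) \<le> C * norm h * norm f * norm e
        + (C * norm h * (K * norm f * norm e) + C * (K * norm h * norm f * norm e))"
      using norm_triangle_ineq4[of "?D b e f - ?D a e f" "?F b (?Q b e f) - ?F a (?Q a e f)"] FQd F4[of e f] by simp
    \<comment> \<open>Three changes in turn: of the argument by \<open>d\<close>, of the direction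
      by \<open>f' - f\<close>, and of the base point.\<close>
    have "?N b f' (?p a b e) = ?N b f' e + ?N b f' d"
      using linear_add[OF lN(1)[OF bi], of f' e d] by (simp add: d_def)
    then have "?N b f' (?p a b e) - ?N a f e = ?N b f' d + ?N b (f' - f) e + (?N b f e - ?N a f e)"
      by (simp add: linear_diff[OF lN(2)[OF bi]])
    also have "norm \<dots> \<le> C * (1 + K) * norm f' * (K * norm h * norm e) + C * (1 + K) * norm (f' - f) * norm e +
        (C * norm h * norm f * norm e + (C * norm h * (K * norm f * norm e) + C * (K * norm h * norm f * norm e)))"
    proof (intro norm_triangle_mono Nd Nbd)
      have "C * (1 + K) * norm f' * norm d \<le> C * (1 + K) * norm f' * (K * norm h * norm e)"
        using P1 \<epsilon>1(2) \<epsilon>2(2) by (intro mult_left_mono) auto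
      then show "norm (?N b f' d) \<le> C * (1 + K) * norm f' * (K * norm h * norm e)"
        using Nbd(1)[of f' d] by linarith
    qed
    also have "\<dots> \<le> M * (norm h * (norm f + norm f') + norm (f' - f)) * norm e"
    proof -
      have "M * (norm h * (norm f + norm f') + norm (f' - f)) * norm e -
        (C * (1 + K) * norm f' * (K * norm h * norm e) + C * (1 + K) * norm (f' - f) * norm e +
        (C * norm h * norm f * norm e + (C * norm h * (K * norm f * norm e) + C * (K * norm h * norm f * norm e)))) =
        (C + C * K + C * K * K) * (norm h * norm f * norm e) + (2 * C + 2 * (C * K)) * (norm h * norm f' * norm e)
          + (C + 2 * (C * K) + C * K * K) * (norm (f' - f) * norm e)"
        by (simp add: M_def algebra_simps)
      also have "\<dots> \<ge> 0" using CK \<epsilon>1(2) by simp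
      finally show ?thesis by simp
    qed
    finally show "norm (?N b f' (?p a b e) - ?N a f e) \<le> M * (norm (b - a) * (norm f + norm f') + norm (f' - f)) * norm e"
      unfolding h_def .
  qed
  moreover have "\<epsilon> > 0" "M \<ge> 0" using \<epsilon>1 \<epsilon>2 by (auto simp: \<epsilon>_def M_def)
  ultimately show ?thesis by blast
qed

section \<open>Controlled paths in a chart\<close>

text \<open>Continuity of \<open>y'\<close> is known for each \<open>w\<close> separately, and at
  times when the path is in the chart; the standard basis gives a bound uniform in
  \<open>w\<close>.\<close>

lemma path_in_chart:
  fixes y' :: "real \<Rightarrow> 'w::euclidean_space \<Rightarrow> ('m, 'e) tangent"
  assumes y: "continuous_on {0..T} y" and c: "c \<in> A" "y s0 \<in> fst c" and s0: "s0 \<in> {0..T}"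
    and lin: "\<And>s. s \<in> {0..T} \<Longrightarrow> linear (y' s)"
    and y': "\<And>w. continuous_on {s\<in>{0..T}. y s \<in> fst c} (\<lambda>s. y' s w c)" and \<epsilon>: "\<epsilon> > 0"
  shows "\<exists>\<eta>>0. \<exists>L\<ge>0. \<forall>s\<in>{0..T}. \<bar>s - s0\<bar> < \<eta> \<longrightarrow> y s \<in> fst c \<and>
    snd c (y s) \<in> ball (snd c (y s0)) \<epsilon> \<and> (\<forall>w. norm (y' s w c) \<le> L * norm w)"
proof -
  let ?G = "snd c -` ball (snd c (y s0)) \<epsilon> \<inter> fst c"
  have "open ?G" using continuous_on_open_vimage[OF open_chart[OF c(1)]] continuous_on_chart[OF c(1)] by blast
  moreover have "y s0 \<in> ?G" using c(2) \<epsilon> by simp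
  ultimately obtain B where B: "open B" "s0 \<in> B" "\<forall>s\<in>{0..T}. s \<in> B \<longrightarrow> y s \<in> ?G"
    using y s0 unfolding continuous_on_topological by meson
  then obtain \<eta>1 where \<eta>1: "\<eta>1 > 0" "ball s0 \<eta>1 \<subseteq> B" using open_contains_ball by blast
  have "\<exists>\<eta>>0. \<exists>L\<ge>0. \<forall>b\<in>Basis. \<forall>s\<in>{0..T}. \<bar>s - s0\<bar> < \<eta> \<and> y s \<in> fst c \<longrightarrow> norm (y' s b c) \<le> L"
  proof (rule finite_ball_bound)
    show "finite (Basis :: 'w set)" by simp
  next
    fix b :: 'w
    have "s0 \<in> {s\<in>{0..T}. y s \<in> fst c}" using s0 c by simp
    then obtain \<eta> where \<eta>: "\<eta> > 0"
      "\<forall>s\<in>{s\<in>{0..T}. y s \<in> fst c}. dist s s0 < \<eta> \<longrightarrow> dist (y' s b c) (y' s0 b c) < 1"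
      using y'[of b] unfolding continuous_on_iff by (meson zero_less_one)
    have "norm (y' s b c) \<le> norm (y' s0 b c) + 1"
      if "s \<in> {0..T}" "\<bar>s - s0\<bar> < \<eta> \<and> y s \<in> fst c" for s
    proof -
      have "dist (y' s b c) (y' s0 b c) < 1" using \<eta>(2) that by (auto simp: dist_real_def)
      then show ?thesis using norm_triangle_ineq2[of "y' s b c" "y' s0 b c"] by (simp add: dist_norm)
    qed
    then show "\<exists>\<eta>>0. \<exists>L\<ge>0. \<forall>s\<in>{0..T}. \<bar>s - s0\<bar> < \<eta> \<and> y s \<in> fst c \<longrightarrow> norm (y' s b c) \<le> L"
      using \<eta>(1) by (intro exI[of _ \<eta>] conjI exI[of _ "norm (y' s0 b c) + 1"]) auto
  next
    fix b :: 'w and \<eta> L \<eta>' L' :: real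
    assume *: "\<forall>s\<in>{0..T}. \<bar>s - s0\<bar> < \<eta> \<and> y s \<in> fst c \<longrightarrow> norm (y' s b c) \<le> L" "\<eta>' \<le> \<eta>" "L \<le> L'"
    show "\<forall>s\<in>{0..T}. \<bar>s - s0\<bar> < \<eta>' \<and> y s \<in> fst c \<longrightarrow> norm (y' s b c) \<le> L'"
    proof (intro ballI impI)
      fix s assume "s \<in> {0..T}" "\<bar>s - s0\<bar> < \<eta>' \<and> y s \<in> fst c"
      then have "norm (y' s b c) \<le> L" using * by auto
      then show "norm (y' s b c) \<le> L'" using *(3) by linarith
    qed
  qed
  then obtain \<eta>2 L where \<eta>2: "\<eta>2 > 0" "L \<ge> 0"
    "\<And>b s. b \<in> Basis \<Longrightarrow> s \<in> {0..T} \<Longrightarrow> \<bar>s - s0\<bar> < \<eta>2 \<Longrightarrow> y s \<in> fst c \<Longrightarrow> norm (y' s b c) \<le> L" by blast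
  have "y s \<in> fst c \<and> snd c (y s) \<in> ball (snd c (y s0)) \<epsilon> \<and>
      (\<forall>w. norm (y' s w c) \<le> real (card (Basis :: 'w set)) * L * norm w)"
    if s: "s \<in> {0..T}" "\<bar>s - s0\<bar> < min \<eta>1 \<eta>2" for s
  proof -
    have "s \<in> ball s0 \<eta>1" using s by (auto simp: dist_real_def)
    then have G: "y s \<in> fst c" "snd c (y s) \<in> ball (snd c (y s0)) \<epsilon>" using B(3) \<eta>1(2) s(1) by blast+
    have "linear (\<lambda>w. y' s w c)"
      by (intro linearI) (simp_all add: linear_add[OF lin[OF s(1)]] linear_cmul[OF lin[OF s(1)]] scaleR_fun_def)
    from linear_bound_basis[OF orthonormal_basis_Basis this, of L] show ?thesis
      using \<eta>2(3) s G by auto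
  qed
  moreover have "min \<eta>1 \<eta>2 > 0" "real (card (Basis :: 'w set)) * L \<ge> 0" using \<eta>1 \<eta>2 by auto
  ultimately show ?thesis by blast
qed

lemma CRP_D:
  assumes "(y, y') \<in> CRP A g T p \<omega> x"
  shows "continuous_on {0..T} y"
    and "s \<in> {0..T} \<Longrightarrow> linear (y' s)"
    and "s \<in> {0..T} \<Longrightarrow> y' s w \<in> TM (y s)"
    and "c \<in> A \<Longrightarrow> continuous_on {s\<in>{0..T}. y s \<in> fst c} (\<lambda>s. y' s w c)"
  using assms unfolding CRP_def by blast+

text \<open>Translates membership in \<open>CRP\<close>, with its unspecified gauge, into coordinate
  estimates from which the gauge has disappeared. The logarithm governs \<open>y\<close>; the
  parallelism of the gauge, which in coordinates differs from the identity by
  \<open>O(norm (b - a))\<close>, governs \<open>y'\<close>.\<close>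

lemma controlled_path_local_estimates:
  fixes x :: "real \<Rightarrow> real^'k"
  assumes g: "riemannian_metric A g" and p: "1 \<le> p" and \<omega>: "control T \<omega>"
    and x: "\<forall>s t. 0 \<le> s \<and> s \<le> t \<and> t \<le> T \<longrightarrow> norm (x t - x s) \<le> \<omega> s t powr (1 / p)"
    and crp: "(y, y') \<in> CRP A g T p \<omega> x"
    and s0: "s0 \<in> {0..T}" and c: "c \<in> A" "y s0 \<in> fst c" and \<epsilon>0: "\<epsilon>0 > 0"
  shows "\<exists>\<eta>>0. \<exists>K\<ge>0. \<forall>s t. 0 \<le> s \<and> s \<le> t \<and> t \<le> T \<and> \<bar>s - s0\<bar> < \<eta> \<and> \<bar>t - s0\<bar> < \<eta> \<longrightarrow>
    y s \<in> fst c \<and> y t \<in> fst c \<and>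
    snd c (y s) \<in> ball (snd c (y s0)) \<epsilon>0 \<and> snd c (y t) \<in> ball (snd c (y s0)) \<epsilon>0 \<and>
    norm (snd c (y t) - snd c (y s)) \<le> K * \<omega> s t powr (1 / p) \<and>
    norm (snd c (y t) - snd c (y s) - y' s (x t - x s) c) \<le> K * \<omega> s t powr (2 / p) \<and>
    (\<forall>w. norm (y' s w c) \<le> K * norm w \<and> norm (y' t w c) \<le> K * norm w \<and>
      norm (y' t w c - y' s w c) \<le> K * \<omega> s t powr (1 / p) * norm w) \<and>
    (\<forall>v\<in>TM (y s). norm (v c) \<le> K * tnorm g (y s) v)"
proof -
  let ?a0 = "snd c (y s0)"
  have a0: "?a0 \<in> chart_image c" by (rule chart_in_image[OF c])
  note y = CRP_D(1)[OF crp] and lin = CRP_D(2)[OF crp] and y'T = CRP_D(3)[OF crp]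
    and y' = CRP_D(4)[OF crp c(1)]
  obtain D \<psi> U where gauge: "gauge_on A D \<psi> U"
    and ap2: "approx T \<omega> p 2 (\<lambda>s t. (y s, y t) \<in> D)
        (\<lambda>s t K. tnorm g (y s) (\<psi> (y s) (y t) - y' s (x t - x s)) \<le> K)"
    and ap1: "approx T \<omega> p 1 (\<lambda>s t. (y s, y t) \<in> D)
        (\<lambda>s t K. \<forall>w. tnorm g (y s) (U (y s) (y t) (y' t w) - y' s w) \<le> K * norm w)"
    using crp unfolding CRP_def by blast
  have \<psi>: "logarithm A D \<psi>" and U: "parallelism A D U" using gauge by (auto simp: gauge_on_def)
  obtain C2 \<delta>2 where \<delta>2: "\<delta>2 > 0" and C2: "\<And>s t. 0 \<le> s \<Longrightarrow> s \<le> t \<Longrightarrow> t \<le> T \<Longrightarrow> t - s \<le> \<delta>2 \<Longrightarrow>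
      (y s, y t) \<in> D \<and> tnorm g (y s) (\<psi> (y s) (y t) - y' s (x t - x s)) \<le> C2 * \<omega> s t powr (real 2 / p)"
    using ap2 unfolding approx_def by blast
  obtain C1 \<delta>1 where \<delta>1: "\<delta>1 > 0" and C1: "\<And>s t w. 0 \<le> s \<Longrightarrow> s \<le> t \<Longrightarrow> t \<le> T \<Longrightarrow> t - s \<le> \<delta>1 \<Longrightarrow>
      tnorm g (y s) (U (y s) (y t) (y' t w) - y' s w) \<le> C1 * \<omega> s t powr (real 1 / p) * norm w"
    using ap1 unfolding approx_def by blast
  obtain \<epsilon>1 Kg where \<epsilon>1: "\<epsilon>1 > 0" "Kg \<ge> 0" and Kg: "\<And>n v. n \<in> fst c \<Longrightarrow> snd c n \<in> ball ?a0 \<epsilon>1 \<Longrightarrow>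
      v \<in> TM n \<Longrightarrow> norm (v c) \<le> Kg * tnorm g n v"
    using coord_le_tnorm[OF g c] by blast
  obtain \<epsilon>2 Cp where \<epsilon>2: "\<epsilon>2 > 0" "Cp \<ge> 0" and Cp: "\<And>a b. a \<in> ball ?a0 \<epsilon>2 \<Longrightarrow> b \<in> ball ?a0 \<epsilon>2 \<Longrightarrow>
      norm (\<psi> (chart_inv c a) (chart_inv c b) c - (b - a)) \<le> Cp * (norm (b - a))\<^sup>2"
    using logarithm_estimate[OF \<psi> c(1) a0] by blast
  obtain \<epsilon>3 Cu where \<epsilon>3: "\<epsilon>3 > 0" "Cu \<ge> 0" and Cu: "\<And>a b e. a \<in> ball ?a0 \<epsilon>3 \<Longrightarrow> b \<in> ball ?a0 \<epsilon>3 \<Longrightarrow>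
      norm (par_coord U c (b, a) e - e) \<le> Cu * norm (b - a) * norm e"
    using par_coord_estimates[OF U c(1) a0] by blast
  \<comment> \<open>The last bound keeps \<open>Cp * norm h\<close> at most 1/2, as
    \<open>norm h\<close> is at most \<open>2 * \<epsilon>\<close>; the summand 1 keeps the
    denominator positive when \<open>Cp = 0\<close>.\<close>
  define \<epsilon> where "\<epsilon> = Min {\<epsilon>0, \<epsilon>1, \<epsilon>2, \<epsilon>3, 1 / (4 * (Cp + 1))}"
  have \<epsilon>: "\<epsilon> > 0" "\<epsilon> \<le> \<epsilon>0" "\<epsilon> \<le> \<epsilon>1" "\<epsilon> \<le> \<epsilon>2" "\<epsilon> \<le> \<epsilon>3" "\<epsilon> \<le> 1 / (4 * (Cp + 1))"
    using \<epsilon>0 \<epsilon>1 \<epsilon>2 \<epsilon>3 by (auto simp: \<epsilon>_def)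
  obtain \<eta>1 L where \<eta>1: "\<eta>1 > 0" "L \<ge> 0" and near: "\<And>s. s \<in> {0..T} \<Longrightarrow> \<bar>s - s0\<bar> < \<eta>1 \<Longrightarrow> y s \<in> fst c \<and>
    snd c (y s) \<in> ball ?a0 \<epsilon> \<and> (\<forall>w. norm (y' s w c) \<le> L * norm w)"
    using path_in_chart[OF y c s0 lin y' \<epsilon>(1)] by blast
  \<comment> \<open>Halves, because \<open>t - s\<close> is bounded through the two distances to
    \<open>s0\<close>.\<close>
  define \<eta> where "\<eta> = min \<eta>1 (min (\<delta>1 / 2) (\<delta>2 / 2))"
  \<comment> \<open>\<open>R\<close> bounds \<open>\<omega> s t powr (1 / p)\<close> on the whole
    simplex. \<open>H1\<close> and \<open>H2\<close> are the constants of
    \<open>increment_from_logarithm\<close>, \<open>H3\<close> is that of \<open>lip\<close>;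
    constants taken from \<open>approx\<close> may be negative, hence the absolute values.\<close>
  define R where "R = \<omega> 0 T powr (1 / p)"
  define H1 where "H1 = 2 * (L + Kg * \<bar>C2\<bar> * R)"
  define H2 where "H2 = Cp * H1\<^sup>2 + Kg * \<bar>C2\<bar>"
  define H3 where "H3 = Kg * \<bar>C1\<bar> + Cu * H1 * L"
  define K where "K = H1 + H2 + H3 + L + Kg"
  have nn: "0 \<le> R" "0 \<le> H1" "0 \<le> H2" "0 \<le> H3"
    using \<eta>1 \<epsilon>1 \<epsilon>2 \<epsilon>3 by (auto simp: R_def H1_def H2_def H3_def)
  have KK: "H1 \<le> K" "H2 \<le> K" "H3 \<le> K" "L \<le> K" "Kg \<le> K" "0 \<le> K"
    using nn \<eta>1 \<epsilon>1 by (auto simp: K_def)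
  have "y s \<in> fst c \<and> y t \<in> fst c \<and>
      snd c (y s) \<in> ball ?a0 \<epsilon>0 \<and> snd c (y t) \<in> ball ?a0 \<epsilon>0 \<and>
      norm (snd c (y t) - snd c (y s)) \<le> K * \<omega> s t powr (1 / p) \<and>
      norm (snd c (y t) - snd c (y s) - y' s (x t - x s) c) \<le> K * \<omega> s t powr (2 / p) \<and>
      (\<forall>w. norm (y' s w c) \<le> K * norm w \<and> norm (y' t w c) \<le> K * norm w \<and>
        norm (y' t w c - y' s w c) \<le> K * \<omega> s t powr (1 / p) * norm w) \<and>
      (\<forall>v\<in>TM (y s). norm (v c) \<le> K * tnorm g (y s) v)"
    if st: "0 \<le> s" "s \<le> t" "t \<le> T" and close: "\<bar>s - s0\<bar> < \<eta>" "\<bar>t - s0\<bar> < \<eta>" for s t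
  proof -
    define a b h r where "a = snd c (y s)" and "b = snd c (y t)" and "h = b - a" and "r = \<omega> s t powr (1 / p)"
    have sT: "s \<in> {0..T}" "t \<in> {0..T}" using st by auto
    have "\<bar>s - s0\<bar> < \<delta>1 / 2" "\<bar>t - s0\<bar> < \<delta>1 / 2" "\<bar>s - s0\<bar> < \<delta>2 / 2" "\<bar>t - s0\<bar> < \<delta>2 / 2"
      using close by (auto simp: \<eta>_def)
    then have ts: "t - s \<le> \<delta>1" "t - s \<le> \<delta>2" by linarith+
    have yc: "y s \<in> fst c" "y t \<in> fst c" and ab: "a \<in> ball ?a0 \<epsilon>" "b \<in> ball ?a0 \<epsilon>"
      and L: "\<And>w. norm (y' s w c) \<le> L * norm w" "\<And>w. norm (y' t w c) \<le> L * norm w"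
      using near[OF sT(1)] near[OF sT(2)] close by (auto simp: a_def b_def \<eta>_def)
    have inv: "chart_inv c a = y s" "chart_inv c b = y t" using chart_inv_chart[OF c(1)] yc by (auto simp: a_def b_def)
    have r2: "\<omega> s t powr (2 / p) = r\<^sup>2" unfolding r_def by (rule powr_two_divide)
    have r: "0 \<le> r" "r \<le> R"
      using control_mono[OF \<omega> st] p by (auto simp: r_def R_def intro: powr_mono2)
    have D: "(y s, y t) \<in> D" using C2[OF st ts(2)] by blast
    have met: "norm (v c) \<le> Kg * tnorm g (y s) v" if "v \<in> TM (y s)" for v
      using Kg[OF yc(1) _ that] ab(1) \<epsilon>(3) by (auto simp: a_def)
    have small: "Cp * norm h \<le> 1 / 2"
    proof -
      have "norm h \<le> dist ?a0 a + dist ?a0 b"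
        unfolding h_def using dist_triangle2[of a b ?a0] by (simp add: dist_norm norm_minus_commute)
      also have "\<dots> \<le> 2 * (1 / (4 * (Cp + 1)))" using ab \<epsilon>(6) by auto
      also have "\<dots> = 1 / (2 * (Cp + 1))" using \<epsilon>2(2) by (simp add: field_simps)
      finally have "norm h \<le> 1 / (2 * (Cp + 1))" .
      then have "Cp * norm h \<le> Cp * (1 / (2 * (Cp + 1)))" using \<epsilon>2(2) by (intro mult_left_mono)
      also have "\<dots> \<le> 1 / 2" using \<epsilon>2(2) by (simp add: field_simps)
      finally show ?thesis .
    qed
    define P where "P = y' s (x t - x s) c"
    have log: "norm (\<psi> (y s) (y t) c - h) \<le> Cp * (norm h)\<^sup>2"
      using Cp[of a b] ab \<epsilon>(4) by (simp add: inv h_def)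
    have ctrl: "norm (\<psi> (y s) (y t) c - P) \<le> Kg * \<bar>C2\<bar> * r\<^sup>2"
    proof -
      have "\<psi> (y s) (y t) - y' s (x t - x s) \<in> TM (y s)"
        using \<psi> D y'T[OF sT(1)] unfolding logarithm_def by (intro tangent_space_diff) auto
      from met[OF this]
      have "norm (\<psi> (y s) (y t) c - P) \<le> Kg * tnorm g (y s) (\<psi> (y s) (y t) - y' s (x t - x s))"
        by (simp add: P_def)
      also have "\<dots> \<le> Kg * (\<bar>C2\<bar> * r\<^sup>2)"
      proof (intro mult_left_mono \<epsilon>1(2))
        have "tnorm g (y s) (\<psi> (y s) (y t) - y' s (x t - x s)) \<le> C2 * r\<^sup>2"
          using C2[OF st ts(2)] by (simp add: r2)
        also have "\<dots> \<le> \<bar>C2\<bar> * r\<^sup>2" by (intro mult_right_mono) auto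
        finally show "tnorm g (y s) (\<psi> (y s) (y t) - y' s (x t - x s)) \<le> \<bar>C2\<bar> * r\<^sup>2" .
      qed
      finally show ?thesis by (simp add: mult.assoc)
    qed
    have P: "norm P \<le> L * r"
      using L(1)[of "x t - x s"] mult_left_mono[OF x[rule_format, OF conjI[OF st(1) conjI[OF st(2,3)]]] \<eta>1(2)] unfolding P_def r_def by linarith
    have "0 \<le> Kg * \<bar>C2\<bar>" using \<epsilon>1 by simp
    note inc = increment_from_logarithm[OF log ctrl P small r \<epsilon>2(2) this \<eta>1(2), folded H1_def H2_def]
    have lip: "norm (y' t w c - y' s w c) \<le> H3 * r * norm w" for w
    proof -
      \<comment> \<open>Transported to \<open>y s\<close>, the vector \<open>y' t w\<close> is close
        to \<open>y' s w\<close> by assumption; undoing the transport in coordinates costs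
        \<open>Cu * norm (a - b)\<close> times its size, which \<open>inc(1)\<close> and
        \<open>L(2)\<close> bound.\<close>
      let ?u = "U (y s) (y t) (y' t w)"
      note pc = par_coord[OF U D c(1) yc y'T[OF sT(2)]]
      have "norm (?u c - y' s w c) \<le> Kg * tnorm g (y s) (?u - y' s w)"
        using met[OF tangent_space_diff[OF pc(2) y'T[OF sT(1)]]] by simp
      also have "\<dots> \<le> Kg * (\<bar>C1\<bar> * r * norm w)"
      proof (intro mult_left_mono \<epsilon>1(2))
        have "tnorm g (y s) (?u - y' s w) \<le> C1 * r * norm w"
          using C1[OF st ts(1)] by (simp add: r_def)
        also have "\<dots> \<le> \<bar>C1\<bar> * r * norm w" using r(1) by (intro mult_right_mono) auto
        finally show "tnorm g (y s) (?u - y' s w) \<le> \<bar>C1\<bar> * r * norm w" .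
      qed
      finally have 1: "norm (?u c - y' s w c) \<le> Kg * \<bar>C1\<bar> * r * norm w" by (simp add: mult.assoc)
      have "norm (?u c - y' t w c) \<le> Cu * norm (a - b) * norm (y' t w c)"
        using Cu[of b a "y' t w c"] ab \<epsilon>(5) by (simp add: pc(1) a_def b_def)
      also have "\<dots> \<le> Cu * (H1 * r) * (L * norm w)"
        using inc(1) L(2) \<epsilon>3(2) nn r(1)
        by (intro mult_mono mult_left_mono) (auto simp: h_def norm_minus_commute)
      finally have 2: "norm (?u c - y' t w c) \<le> Cu * H1 * L * r * norm w" by (simp add: mult_ac)
      have "norm (y' t w c - y' s w c) \<le> norm (?u c - y' s w c) + norm (?u c - y' t w c)"
        using norm_triangle_ineq4[of "?u c - y' s w c" "?u c - y' t w c"] by simp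
      then show ?thesis using 1 2 by (simp add: H3_def algebra_simps)
    qed
    have grow: "N \<le> K * q" if "N \<le> k * q" "k \<le> K" "0 \<le> q" for N k q
      using that mult_right_mono[OF that(2,3)] by linarith
    have "norm h \<le> K * r" using grow[OF inc(1) KK(1) r(1)] .
    moreover have "norm (h - P) \<le> K * r\<^sup>2" using grow[OF inc(2) KK(2)] by simp
    moreover have "norm (y' s w c) \<le> K * norm w" "norm (y' t w c) \<le> K * norm w" for w
      using grow[OF L(1) KK(4)] grow[OF L(2) KK(4)] by auto
    moreover have "norm (y' t w c - y' s w c) \<le> K * r * norm w" for w
      using grow[of _ H3 "r * norm w"] lip[of w] KK(3) r(1) by (simp add: mult.assoc)
    moreover have "norm (v c) \<le> K * tnorm g (y s) v" if "v \<in> TM (y s)" for v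
      using grow[OF met[OF that] KK(5) tnorm_nonneg[OF g that]] .
    moreover have "a \<in> ball ?a0 \<epsilon>0" "b \<in> ball ?a0 \<epsilon>0" using ab \<epsilon>(2) by auto
    ultimately show ?thesis
      using yc by (simp add: r2 h_def a_def b_def P_def flip: r_def)
  qed
  moreover have "\<eta> > 0" using \<eta>1 \<delta>1 \<delta>2 by (simp add: \<eta>_def)
  ultimately show ?thesis using KK(6) by blast
qed

text \<open>The local analysis of the form is evaluated at the coordinates of the path in one chart
  around \<open>y s0\<close>, so a single radius and constant serve both estimates. Membership in
  \<open>D\<close> belongs to the conclusion because \<open>U\<close> is specified only
  there.\<close>

lemma form_along_path_local_estimates:
  fixes x :: "real \<Rightarrow> real^'k" and \<alpha> :: "'m \<Rightarrow> ('m, 'e) tangent \<Rightarrow> 'v::real_normed_vector"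
  assumes g: "riemannian_metric A g" and p: "1 \<le> p" and \<omega>: "control T \<omega>"
    and x: "\<forall>s t. 0 \<le> s \<and> s \<le> t \<and> t \<le> T \<longrightarrow> norm (x t - x s) \<le> \<omega> s t powr (1 / p)"
    and crp: "(y, y') \<in> CRP A g T p \<omega> x"
    and \<alpha>: "\<alpha> \<in> one_forms A" and U: "parallelism A D U" and s0: "s0 \<in> {0..T}"
  shows "\<exists>\<eta>>0. \<exists>C. \<forall>s t. 0 \<le> s \<and> s \<le> t \<and> t \<le> T \<and> \<bar>s - s0\<bar> < \<eta> \<and> \<bar>t - s0\<bar> < \<eta> \<longrightarrow>
    (y t, y s) \<in> D \<and> (\<forall>v\<in>TM (y s).
      norm (\<alpha> (y t) (U (y t) (y s) v) - \<alpha> (y s) v - cov_deriv_form A U \<alpha> (y s) (y' s (x t - x s)) v)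
        \<le> C * \<omega> s t powr (2 / p) * tnorm g (y s) v \<and>
      (\<forall>w. norm (cov_deriv_form A U \<alpha> (y t) (y' t w) (U (y t) (y s) v) - cov_deriv_form A U \<alpha> (y s) (y' s w) v)
        \<le> C * \<omega> s t powr (1 / p) * (norm w * tnorm g (y s) v)))"
proof -
  obtain c where c: "c \<in> A" "y s0 \<in> fst c" using ex_chart .
  let ?a0 = "snd c (y s0)" and ?N = "cov_coord U \<alpha> c"
  note y'T = CRP_D(3)[OF crp]
  obtain \<epsilon> C where \<epsilon>: "\<epsilon> > 0" "C \<ge> 0" and loc: "\<And>a b. a \<in> ball ?a0 \<epsilon> \<Longrightarrow> b \<in> ball ?a0 \<epsilon> \<Longrightarrow>
    (b, a) \<in> coord_domain D c c \<and>
    (\<forall>P e. norm (form_coord \<alpha> c b (par_coord U c (b, a) e) - form_coord \<alpha> c a e - ?N a P e)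
        \<le> C * ((norm (b - a))\<^sup>2 + norm (b - a - P)) * norm e) \<and>
    (\<forall>f f' e. norm (?N b f' (par_coord U c (b, a) e) - ?N a f e)
        \<le> C * (norm (b - a) * (norm f + norm f') + norm (f' - f)) * norm e)"
    using form_local_estimates[OF \<alpha> U c(1) chart_in_image[OF c]] by blast
  obtain \<eta> K where \<eta>: "\<eta> > 0" "K \<ge> 0" and path: "\<And>s t. 0 \<le> s \<Longrightarrow> s \<le> t \<Longrightarrow> t \<le> T \<Longrightarrow>
      \<bar>s - s0\<bar> < \<eta> \<Longrightarrow> \<bar>t - s0\<bar> < \<eta> \<Longrightarrow>
    y s \<in> fst c \<and> y t \<in> fst c \<and>
    snd c (y s) \<in> ball ?a0 \<epsilon> \<and> snd c (y t) \<in> ball ?a0 \<epsilon> \<and>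
    norm (snd c (y t) - snd c (y s)) \<le> K * \<omega> s t powr (1 / p) \<and>
    norm (snd c (y t) - snd c (y s) - y' s (x t - x s) c) \<le> K * \<omega> s t powr (2 / p) \<and>
    (\<forall>w. norm (y' s w c) \<le> K * norm w \<and> norm (y' t w c) \<le> K * norm w \<and>
      norm (y' t w c - y' s w c) \<le> K * \<omega> s t powr (1 / p) * norm w) \<and>
    (\<forall>v\<in>TM (y s). norm (v c) \<le> K * tnorm g (y s) v)"
    using controlled_path_local_estimates[OF g p \<omega> x crp s0 c \<epsilon>(1)] by blast
  \<comment> \<open>Dictated by the second estimate: \<open>2 * K\<^sup>2 + K\<close> collects the
    effects of \<open>norm h\<close> and of the change of direction, and the last \<open>K\<close>
    passes from \<open>norm e\<close> to \<open>tnorm\<close>. In the first estimate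
    \<open>K\<^sup>2 + K\<close> takes its place.\<close>
  define M where "M = C * (2 * K\<^sup>2 + K) * K"
  have "(y t, y s) \<in> D \<and> (\<forall>v\<in>TM (y s).
      norm (\<alpha> (y t) (U (y t) (y s) v) - \<alpha> (y s) v - cov_deriv_form A U \<alpha> (y s) (y' s (x t - x s)) v)
        \<le> M * \<omega> s t powr (2 / p) * tnorm g (y s) v \<and>
      (\<forall>w. norm (cov_deriv_form A U \<alpha> (y t) (y' t w) (U (y t) (y s) v) - cov_deriv_form A U \<alpha> (y s) (y' s w) v)
        \<le> M * \<omega> s t powr (1 / p) * (norm w * tnorm g (y s) v)))"
    if st: "0 \<le> s" "s \<le> t" "t \<le> T" and close: "\<bar>s - s0\<bar> < \<eta>" "\<bar>t - s0\<bar> < \<eta>" for s t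
  proof -
    define a b h r where "a = snd c (y s)" and "b = snd c (y t)" and "h = b - a" and "r = \<omega> s t powr (1 / p)"
    have r2: "\<omega> s t powr (2 / p) = r\<^sup>2" unfolding r_def by (rule powr_two_divide)
    have r: "0 \<le> r" by (simp add: r_def)
    note path = path[OF st close]
    have yc: "y s \<in> fst c" "y t \<in> fst c" and ab: "a \<in> ball ?a0 \<epsilon>" "b \<in> ball ?a0 \<epsilon>"
      and h: "norm h \<le> K * r" and hP: "norm (h - y' s (x t - x s) c) \<le> K * r\<^sup>2"
      and f: "\<And>w. norm (y' s w c) \<le> K * norm w" "\<And>w. norm (y' t w c) \<le> K * norm w"
        "\<And>w. norm (y' t w c - y' s w c) \<le> K * r * norm w"
      and met: "\<And>v. v \<in> TM (y s) \<Longrightarrow> norm (v c) \<le> K * tnorm g (y s) v"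
      using path unfolding a_def b_def h_def r2 r_def by blast+
    note loc = loc[OF ab]
    have sT: "s \<in> {0..T}" "t \<in> {0..T}" using st by auto
    have D: "(y t, y s) \<in> D"
      using loc chart_inv_chart[OF c(1)] yc by (auto simp: coord_domain_def a_def b_def)
    have "norm (\<alpha> (y t) (U (y t) (y s) v) - \<alpha> (y s) v - cov_deriv_form A U \<alpha> (y s) (y' s (x t - x s)) v)
        \<le> M * r\<^sup>2 * tnorm g (y s) v"
      and "norm (cov_deriv_form A U \<alpha> (y t) (y' t w) (U (y t) (y s) v) - cov_deriv_form A U \<alpha> (y s) (y' s w) v)
        \<le> M * r * (norm w * tnorm g (y s) v)"
      if v: "v \<in> TM (y s)" for v w
    proof -
      define e where "e = v c"
      note pc = par_coord[OF U D c(1) yc(2,1) v, folded a_def b_def e_def]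
      have cov: "cov_deriv_form A U \<alpha> (y s) (y' s w) v = ?N a (y' s w c) e"
        "cov_deriv_form A U \<alpha> (y t) (y' t w) (U (y t) (y s) v) = ?N b (y' t w c) (par_coord U c (b, a) e)" for w
        using cov_deriv_form_eq_cov_coord[OF \<alpha> U c(1) yc(1) y'T[OF sT(1)] v]
          cov_deriv_form_eq_cov_coord[OF \<alpha> U c(1) yc(2) y'T[OF sT(2)] pc(2)]
        by (simp_all add: pc(1) a_def b_def e_def)
      have form: "\<alpha> (y s) v = form_coord \<alpha> c a e"
        "\<alpha> (y t) (U (y t) (y s) v) = form_coord \<alpha> c b (par_coord U c (b, a) e)"
        using form_coord[OF c(1) yc(1) v, of \<alpha>] form_coord[OF c(1) yc(2) pc(2), of \<alpha>]
        by (simp_all add: pc(1) a_def b_def e_def)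
      have e: "norm e \<le> K * tnorm g (y s) v" using met[OF v] by (simp add: e_def)
      have tn: "0 \<le> tnorm g (y s) v" by (rule tnorm_nonneg[OF g v])
      have "norm (form_coord \<alpha> c b (par_coord U c (b, a) e) - form_coord \<alpha> c a e - ?N a (y' s (x t - x s) c) e)
          \<le> C * ((norm h)\<^sup>2 + norm (h - y' s (x t - x s) c)) * norm e"
        using loc unfolding h_def by blast
      also have "\<dots> \<le> C * ((K * r)\<^sup>2 + K * r\<^sup>2) * (K * tnorm g (y s) v)"
        using \<epsilon>(2) \<eta>(2) r h hP e tn
        by (intro mult_mono mult_left_mono add_mono power_mono) auto
      also have "\<dots> = C * (K\<^sup>2 + K) * K * r\<^sup>2 * tnorm g (y s) v"
        by (simp add: power_mult_distrib algebra_simps)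
      also have "\<dots> \<le> M * r\<^sup>2 * tnorm g (y s) v"
        unfolding M_def using \<epsilon>(2) \<eta>(2) tn by (intro mult_right_mono mult_left_mono) auto
      finally show "norm (\<alpha> (y t) (U (y t) (y s) v) - \<alpha> (y s) v - cov_deriv_form A U \<alpha> (y s) (y' s (x t - x s)) v)
        \<le> M * r\<^sup>2 * tnorm g (y s) v"
        by (simp only: cov form)
      have "norm (?N b (y' t w c) (par_coord U c (b, a) e) - ?N a (y' s w c) e)
          \<le> C * (norm h * (norm (y' s w c) + norm (y' t w c)) + norm (y' t w c - y' s w c)) * norm e"
        using loc unfolding h_def by blast
      also have "\<dots> \<le> C * (K * r * (K * norm w + K * norm w) + K * r * norm w) * (K * tnorm g (y s) v)"
        using \<epsilon>(2) \<eta>(2) r h f e tn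
        by (intro mult_mono mult_left_mono add_mono) auto
      also have "\<dots> = M * r * (norm w * tnorm g (y s) v)"
        by (simp add: M_def power2_eq_square algebra_simps)
      finally show "norm (cov_deriv_form A U \<alpha> (y t) (y' t w) (U (y t) (y s) v) - cov_deriv_form A U \<alpha> (y s) (y' s w) v)
        \<le> M * r * (norm w * tnorm g (y s) v)"
        by (simp only: cov)
    qed
    then show ?thesis using D unfolding r2 r_def by blast
  qed
  then show ?thesis using \<eta>(1) by blast
qed

end

section \<open>Uniform estimates along the whole path\<close>

theorem proposition4p2:
  fixes A :: "('m::{t2_space,second_countable_topology}, 'e::real_inner) atlas"
    and g :: "'m \<Rightarrow> ('m, 'e) tangent \<Rightarrow> ('m, 'e) tangent \<Rightarrow> real"
    and T p :: real
    and \<omega> :: "real \<Rightarrow> real \<Rightarrow> real"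
    and x :: "real \<Rightarrow> real^'k"
    and X :: "real \<Rightarrow> real \<Rightarrow> real^'k^'k"
    and y :: "real \<Rightarrow> 'm"
    and y' :: "real \<Rightarrow> real^'k \<Rightarrow> ('m, 'e) tangent"
    and \<alpha> :: "'m \<Rightarrow> ('m, 'e) tangent \<Rightarrow> 'v::banach"
    and D :: "('m \<times> 'm) set"
    and U :: "'m \<Rightarrow> 'm \<Rightarrow> ('m, 'e) tangent \<Rightarrow> ('m, 'e) tangent"
  assumes "smooth_manifold A"
    and "riemannian_metric A g"
    and "0 < T" and "1 \<le> p" and "p < 3"
    and "weak_geometric_rough_path T p \<omega> x X"
    and "(y, y') \<in> CRP A g T p \<omega> x"
    and "\<alpha> \<in> one_forms A"
    and "parallelism A D U"
  shows "((\<lambda>s. \<alpha> (y s)), (\<lambda>s w v. cov_deriv_form A U \<alpha> (y s) (y' s w) v))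
           \<in> CRP_form A g T p \<omega> x y D U"
proof -
  interpret smooth_atlas A by standard (rule assms(1))
  let ?N = "\<lambda>s w v. cov_deriv_form A U \<alpha> (y s) (y' s w) v"
  have \<omega>: "control T \<omega>" using assms(6) by (simp add: weak_geometric_rough_path_def)
  have x: "\<forall>s t. 0 \<le> s \<and> s \<le> t \<and> t \<le> T \<longrightarrow> norm (x t - x s) \<le> \<omega> s t powr (1 / p)"
    using assms(6) unfolding weak_geometric_rough_path_def simplex_on_def by blast
  note y' = CRP_D(2,3)[OF assms(7)]
  note local = form_along_path_local_estimates[OF assms(2,4) \<omega> x assms(7-9)]
  have lin: "linear_map_on (TM (y s)) (\<alpha> (y s)) \<and> (\<forall>w. linear_map_on (TM (y s)) (?N s w)) \<and>
      (\<forall>v\<in>TM (y s). linear (\<lambda>w. ?N s w v))" if s: "s \<in> {0..T}" for s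
  proof (intro conjI allI ballI)
    show "linear_map_on (TM (y s)) (\<alpha> (y s))" using assms(8) by (simp add: one_forms_def)
    show "linear_map_on (TM (y s)) (?N s w)" for w
      using linear_cov_deriv_form(1)[OF assms(8,9) y'(2)[OF s]] .
    show "linear (\<lambda>w. ?N s w v)" if "v \<in> TM (y s)" for v
      using linear_cov_deriv_form(2)[OF assms(8,9) that] y'(2)[OF s] linear_add[OF y'(1)[OF s]]
        linear_cmul[OF y'(1)[OF s]]
      by (intro linearI) (auto simp: linear_map_on_def)
  qed
  have ap2: "approx T \<omega> p 2 (\<lambda>s t. (y t, y s) \<in> D)
      (\<lambda>s t K. \<forall>v\<in>TM (y s).
        norm (\<alpha> (y t) (U (y t) (y s) v) - \<alpha> (y s) v - ?N s (x t - x s) v) \<le> K * tnorm g (y s) v)"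
  proof (rule approx_local)
    fix s0 assume "s0 \<in> {0..T}"
    \<comment> \<open>The exponent in \<open>approx\<close> is \<open>real i / p\<close> with a
      natural number \<open>i\<close>; rewriting it as \<open>2 / p\<close> matches the local
      estimate.\<close>
    from local[OF this] show "\<exists>\<eta>>0. \<exists>C. \<forall>s t. 0 \<le> s \<and> s \<le> t \<and> t \<le> T \<and> \<bar>s - s0\<bar> < \<eta> \<and> \<bar>t - s0\<bar> < \<eta> \<longrightarrow>
      (y t, y s) \<in> D \<and> (\<forall>v\<in>TM (y s).
        norm (\<alpha> (y t) (U (y t) (y s) v) - \<alpha> (y s) v - ?N s (x t - x s) v)
          \<le> C * \<omega> s t powr (real 2 / p) * tnorm g (y s) v)"
      unfolding of_nat_numeral by blast
  next
    \<comment> \<open>Enlarging the constant is harmless because \<open>tnorm\<close> is nonnegative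
      on tangent vectors.\<close>
    fix s t K K'
    assume *: "\<forall>v\<in>TM (y s). norm (\<alpha> (y t) (U (y t) (y s) v) - \<alpha> (y s) v - ?N s (x t - x s) v)
        \<le> K * tnorm g (y s) v" "K \<le> K'"
    show "\<forall>v\<in>TM (y s). norm (\<alpha> (y t) (U (y t) (y s) v) - \<alpha> (y s) v - ?N s (x t - x s) v)
        \<le> K' * tnorm g (y s) v"
      using * mult_right_mono[OF *(2) tnorm_nonneg[OF assms(2)]] by (meson order.trans)
  qed
  have ap1: "approx T \<omega> p 1 (\<lambda>s t. (y t, y s) \<in> D)
      (\<lambda>s t K. \<forall>w. \<forall>v\<in>TM (y s).
        norm (?N t w (U (y t) (y s) v) - ?N s w v) \<le> K * (norm w * tnorm g (y s) v))"
  proof (rule approx_local)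
    fix s0 assume "s0 \<in> {0..T}"
    from local[OF this] show "\<exists>\<eta>>0. \<exists>C. \<forall>s t. 0 \<le> s \<and> s \<le> t \<and> t \<le> T \<and> \<bar>s - s0\<bar> < \<eta> \<and> \<bar>t - s0\<bar> < \<eta> \<longrightarrow>
      (y t, y s) \<in> D \<and> (\<forall>w. \<forall>v\<in>TM (y s).
        norm (?N t w (U (y t) (y s) v) - ?N s w v)
          \<le> C * \<omega> s t powr (real 1 / p) * (norm w * tnorm g (y s) v))"
      unfolding of_nat_1 by blast
  next
    fix s t K K'
    assume *: "\<forall>w. \<forall>v\<in>TM (y s). norm (?N t w (U (y t) (y s) v) - ?N s w v)
        \<le> K * (norm w * tnorm g (y s) v)" "K \<le> K'"
    show "\<forall>w. \<forall>v\<in>TM (y s). norm (?N t w (U (y t) (y s) v) - ?N s w v)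
        \<le> K' * (norm w * tnorm g (y s) v)"
    proof (intro allI ballI)
      fix w :: "real^'k" and v assume v: "v \<in> TM (y s)"
      have "K * (norm w * tnorm g (y s) v) \<le> K' * (norm w * tnorm g (y s) v)"
        using tnorm_nonneg[OF assms(2) v] by (intro mult_right_mono[OF *(2)]) simp
      then show "norm (?N t w (U (y t) (y s) v) - ?N s w v) \<le> K' * (norm w * tnorm g (y s) v)"
        using * v by (meson order.trans)
    qed
  qed
  show ?thesis unfolding CRP_form_def using lin ap2 ap1 by simp
qed

end
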